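(* (a) Let $X$ be a compact oriented $7$-manifold and $\psi$ a closed positive $4$-form on $X$. Then $$\mathcal C_{X,\psi}:=\bigl\{\varphi\in\Gamma^\infty(\Lambda^3T^*X): (X,\varphi,\psi)\text{ is a TA-}G_2\text{-manifold}\bigr\}$$ is an open convex cone in $\{\varphi\in\Gamma^\infty(\Lambda^3T^*X): d\varphi=0\}$. Hence $\mathcal K_{X,\psi}:=\{[\varphi]:\varphi\in\mathcal C_{X,\psi}\}$ is an open convex cone in $H^3_{\rm dR}(X;\mathbb R)$. (b) Let $X$ be a compact $7$-manifold and $\varphi$ a closed positive $3$-form on $X$. Then $$\mathcal C'_{X,\varphi}:=\bigl\{\psi\in\Gamma^\infty(\Lambda^4T^*X): (X,\varphi,\psi)\text{ is a TA-}G_2\text{-manifold}\bigr\}$$ is an open convex cone in $\{\psi\in\Gamma^\infty(\Lambda^4T^*X): d\psi=0\}$. Hence $\mathcal K'_{X,\varphi}:=\{[\psi]:\psi\in\mathcal C'_{X,\varphi}\}$ is an open convex cone in $H^4_{\rm dR}(X;\mathbb R)$.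
   Context: Write $dx_{ij\ldots l}=dx_i\wedge dx_j\wedge\cdots\wedge dx_l$ on $\mathbb R^7$ and set $$\varphi_0=dx_{123}+dx_{145}+dx_{167}+dx_{246}-dx_{257}-dx_{347}-dx_{356},$$ $$*\varphi_0=dx_{4567}+dx_{2367}+dx_{2345}+dx_{1357}-dx_{1346}-dx_{1256}-dx_{1247}.$$ The stabilizer of $\varphi_0$ in $GL(7,\mathbb R)$ is $G_2$, which preserves the Euclidean metric, the orientation and $*\varphi_0$; the orientation-preserving stabilizer of $*\varphi_0$ is also $G_2$. A smooth $3$-form $\varphi$ (resp. $4$-form $\psi$) on a $7$-manifold $X$ is positive if for each $x\in X$ there is an isomorphism $T_xX\cong\mathbb R^7$ identifying $\varphi|_x$ with $\varphi_0$ (resp. $\psi|_x$ with $*\varphi_0$). A positive $3$-form $\varphi$ determines a $G_2$-structure $P_\varphi$, hence a metric $g_\varphi$ and an orientation on $X$. On an oriented $7$-manifold, a positive $4$-form $\psi$ determines a $G_2$-structure $P_\psi$ compatible with the orientation (using oriented isomorphisms $T_xX\cong\mathbb R^7$ identifying $\psi|_x$ with $*\varphi_0$), hence a metric $g_\psi$ and a positive $3$-form $\varphi_\psi$ with Hodge dual $\psi$. For a $G_2$-structure with positive $3$-form $\varphi'$, $4$-form $*\varphi'$ and metric $g'$, an oriented $3$-plane $V\subset T_xX$ is associative if $\varphi'|_V$ is the volume form of $g'|_V$, and an oriented $4$-plane $W\subset T_xX$ is coassociative if $*\varphi'|_W$ is the volume form of $g'|_W$. A TA-$G_2$-manifold (tamed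 almost-$G_2$-manifold) $(X,\varphi,\psi)$ is a $7$-manifold $X$ with a closed positive $3$-form $\varphi$ and a closed positive $4$-form $\psi$ such that, taking $X$ with the orientation induced by $\varphi$ and defining $P_\psi$ with this orientation, the following equivalent conditions hold: (i) for all $x\in X$ and all oriented $3$-planes $V\subset T_xX$ associative with respect to $P_\psi$, $\varphi|_V>0$; (ii) for all $x\in X$ and all oriented $4$-planes $W\subset T_xX$ coassociative with respect to $P_\varphi$, $\psi|_W>0$; (iii) there do not exist $x\in X$, a $P_\psi$-associative $3$-plane $V\subset T_xX$ and a $P_\varphi$-coassociative $4$-plane $W\subset T_xX$ with $V\subset W$. In (a), the orientation induced by $\varphi$ is required to be the given orientation of $X$. The spaces of closed forms carry the $C^\infty$-topology. A convex cone is a subset closed under $(a,b)\mapsto t_1a+t_2b$ for $t_1,t_2\ge 0$ not both zero (it may be empty). *)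

theory Defs
  imports "HOL-Analysis.Analysis"
begin

section \<open>Smooth maps on open subsets of Euclidean space\<close>

fun ck_on :: "nat \<Rightarrow> 'b::real_normed_vector set \<Rightarrow> ('b \<Rightarrow> 'c::real_normed_vector) \<Rightarrow> bool" where
  "ck_on 0 S f \<longleftrightarrow> continuous_on S f"
| "ck_on (Suc n) S f \<longleftrightarrow>
     (\<forall>x\<in>S. f differentiable (at x)) \<and> (\<forall>v. ck_on n S (\<lambda>x. frechet_derivative f (at x) v))"

text \<open>Only used for open \<open>S\<close>.\<close>

definition smooth_on :: "'b::real_normed_vector set \<Rightarrow> ('b \<Rightarrow> 'c::real_normed_vector) \<Rightarrow> bool" where
  "smooth_on S f \<longleftrightarrow> (\<forall>n. ck_on n S f)"

fun iter_deriv :: "('b::real_normed_vector \<Rightarrow> real) \<Rightarrow> 'b list \<Rightarrow> 'b \<Rightarrow> real" where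
  "iter_deriv f [] = f"
| "iter_deriv f (v # vs) = iter_deriv (\<lambda>y. frechet_derivative f (at y) v) vs"


section \<open>Smooth 7-manifolds and tangent spaces\<close>

text \<open>The underlying space of the manifold is a whole type. A chart \<open>(U, f)\<close> maps the open set
  \<open>U\<close> homeomorphically onto an open subset of \<open>real^7\<close>. The atlas is not required to be maximal.\<close>

type_synonym 'a chart = "'a set \<times> ('a \<Rightarrow> real^7)"

abbreviation chart_inv :: "'a chart \<Rightarrow> real^7 \<Rightarrow> 'a" where
  "chart_inv c \<equiv> inv_into (fst c) (snd c)"

definition transition :: "'a chart \<Rightarrow> 'a chart \<Rightarrow> real^7 \<Rightarrow> real^7" where
  "transition c c' = snd c' \<circ> chart_inv c"

definition smooth_atlas :: "'a::topological_space chart set \<Rightarrow> bool" where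
  "smooth_atlas A \<longleftrightarrow>
     (\<forall>c\<in>A. open (fst c) \<and> open (snd c ` fst c) \<and>
             homeomorphism (fst c) (snd c ` fst c) (snd c) (chart_inv c)) \<and>
     (\<Union>c\<in>A. fst c) = UNIV \<and>
     (\<forall>c\<in>A. \<forall>c'\<in>A. smooth_on (snd c ` (fst c \<inter> fst c')) (transition c c'))"

text \<open>A tangent vector at \<open>x\<close> is the family of its coordinate vectors in all charts around \<open>x\<close>,
  related by the derivatives of the transition maps; it is \<open>0\<close> at all other charts, so that equality
  of tangent vectors at \<open>x\<close> is equality of functions.\<close>

type_synonym 'a tvec = "'a chart \<Rightarrow> real^7"

definition tangent :: "'a chart set \<Rightarrow> 'a \<Rightarrow> 'a tvec set" where
  "tangent A x = {v.
     (\<forall>c. \<not> (c \<in> A \<and> x \<in> fst c) \<longrightarrow> v c = 0) \<and>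
     (\<forall>c\<in>A. \<forall>c'\<in>A. x \<in> fst c \<and> x \<in> fst c' \<longrightarrow>
        v c' = frechet_derivative (transition c c') (at (snd c x)) (v c))}"

definition tlin :: "real \<Rightarrow> 'a tvec \<Rightarrow> real \<Rightarrow> 'a tvec \<Rightarrow> 'a tvec" where
  "tlin a u b v = (\<lambda>c. a *\<^sub>R u c + b *\<^sub>R v c)"

definition tcomb :: "(nat \<Rightarrow> real) \<Rightarrow> 'a tvec list \<Rightarrow> 'a tvec" where
  "tcomb a vs = (\<lambda>c. \<Sum>i<length vs. a i *\<^sub>R (vs ! i) c)"

text \<open>\<open>frames A x\<close> is the set of linear isomorphisms from \<open>real^7\<close> onto the tangent space at \<open>x\<close>.\<close>

definition frames :: "'a chart set \<Rightarrow> 'a \<Rightarrow> (real^7 \<Rightarrow> 'a tvec) set" where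
  "frames A x = {e. bij_betw e UNIV (tangent A x) \<and>
     (\<forall>a u b v. e (a *\<^sub>R u + b *\<^sub>R v) = tlin a (e u) b (e v))}"

text \<open>\<open>coord_frame A c x\<close> is the derivative at \<open>snd c x\<close> of the inverse of the chart \<open>c\<close>.\<close>

definition coord_frame :: "'a chart set \<Rightarrow> 'a chart \<Rightarrow> 'a \<Rightarrow> real^7 \<Rightarrow> 'a tvec" where
  "coord_frame A c x w = (\<lambda>c'. if c' \<in> A \<and> x \<in> fst c'
     then frechet_derivative (transition c c') (at (snd c x)) w else 0)"


section \<open>Orientations\<close>

definition same_orient :: "(real^7 \<Rightarrow> 'a tvec) \<Rightarrow> (real^7 \<Rightarrow> 'a tvec) \<Rightarrow> bool" where
  "same_orient e e' \<longleftrightarrow> det (matrix (inv e \<circ> e')) > 0"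

text \<open>An orientation picks at every point one of the two classes of frames; continuity means that
  each coordinate frame is oriented on a relatively clopen subset of the domain of its chart.\<close>

definition orientation :: "'a::topological_space chart set \<Rightarrow> ('a \<Rightarrow> (real^7 \<Rightarrow> 'a tvec) set) \<Rightarrow> bool" where
  "orientation A ori \<longleftrightarrow>
     (\<forall>x. \<exists>e\<in>frames A x. ori x = {e'\<in>frames A x. same_orient e e'}) \<and>
     (\<forall>c\<in>A. open {x\<in>fst c. coord_frame A c x \<in> ori x} \<and>
             open {x\<in>fst c. coord_frame A c x \<notin> ori x})"


section \<open>Differential forms\<close>

text \<open>A \<open>k\<close>-form is evaluated on lists of tangent vectors; it is \<open>0\<close> on lists which do not
  consist of \<open>k\<close> vectors of the tangent space in question.\<close>

type_synonym 'a form = "'a \<Rightarrow> 'a tvec list \<Rightarrow> real"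

definition alt_form_at :: "'a chart set \<Rightarrow> nat \<Rightarrow> 'a \<Rightarrow> ('a tvec list \<Rightarrow> real) \<Rightarrow> bool" where
  "alt_form_at A k x \<alpha> \<longleftrightarrow>
     (\<forall>vs. \<not> (length vs = k \<and> set vs \<subseteq> tangent A x) \<longrightarrow> \<alpha> vs = 0) \<and>
     (\<forall>vs i a u b w. length vs = k \<and> set vs \<subseteq> tangent A x \<and> i < k \<and>
        u \<in> tangent A x \<and> w \<in> tangent A x \<longrightarrow>
        \<alpha> (vs[i := tlin a u b w]) = a * \<alpha> (vs[i := u]) + b * \<alpha> (vs[i := w])) \<and>
     (\<forall>vs i j. length vs = k \<and> i < k \<and> j < k \<and> i \<noteq> j \<and> vs ! i = vs ! j \<longrightarrow> \<alpha> vs = 0)"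

text \<open>The pull-back of a form by the inverse of the chart \<open>c\<close>, a form on the open set
  \<open>snd c ` fst c\<close>.\<close>

definition local_rep :: "'a chart set \<Rightarrow> 'a chart \<Rightarrow> 'a form \<Rightarrow> real^7 \<Rightarrow> (real^7) list \<Rightarrow> real" where
  "local_rep A c \<omega> y ws =
     (let x = chart_inv c y in \<omega> x (map (coord_frame A c x) ws))"

definition smooth_forms :: "'a chart set \<Rightarrow> nat \<Rightarrow> 'a form set" where
  "smooth_forms A k = {\<omega>. (\<forall>x. alt_form_at A k x (\<omega> x)) \<and>
     (\<forall>c\<in>A. \<forall>ws. length ws = k \<longrightarrow> smooth_on (snd c ` fst c) (\<lambda>y. local_rep A c \<omega> y ws))}"

definition form_lin :: "real \<Rightarrow> 'a form \<Rightarrow> real \<Rightarrow> 'a form \<Rightarrow> 'a form" where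
  "form_lin s \<alpha> t \<beta> = (\<lambda>x vs. s * \<alpha> x vs + t * \<beta> x vs)"

definition form_comb :: "nat \<Rightarrow> (nat \<Rightarrow> real) \<Rightarrow> (nat \<Rightarrow> 'a form) \<Rightarrow> 'a form" where
  "form_comb n t \<omega> = (\<lambda>x vs. \<Sum>i<n. t i * \<omega> i x vs)"

text \<open>The invariant formula for the exterior derivative, evaluated on constant vector fields.\<close>

definition eucl_d :: "(real^7 \<Rightarrow> (real^7) list \<Rightarrow> real) \<Rightarrow> real^7 \<Rightarrow> (real^7) list \<Rightarrow> real" where
  "eucl_d \<alpha> y ws = (\<Sum>j<length ws. (- 1) ^ j *
     frechet_derivative (\<lambda>z. \<alpha> z (take j ws @ drop (Suc j) ws)) (at y) (ws ! j))"

text \<open>The exterior derivative of a smooth \<open>k\<close>-form at \<open>x\<close> is computed in a chart around \<open>x\<close>; by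
  naturality of the exterior derivative it does not depend on which one is chosen. Note that
  \<open>v c\<close> is the coordinate vector of the tangent vector \<open>v\<close> in the chart \<open>c\<close>.\<close>

definition ext_d :: "'a chart set \<Rightarrow> nat \<Rightarrow> 'a form \<Rightarrow> 'a form" where
  "ext_d A k \<omega> x vs =
     (if length vs = Suc k \<and> set vs \<subseteq> tangent A x
      then let c = (SOME c. c \<in> A \<and> x \<in> fst c)
           in eucl_d (local_rep A c \<omega>) (snd c x) (map (\<lambda>v. v c) vs)
      else 0)"

definition closed_forms :: "'a chart set \<Rightarrow> nat \<Rightarrow> 'a form set" where
  "closed_forms A k = {\<omega> \<in> smooth_forms A k. ext_d A k \<omega> = (\<lambda>x vs. 0)}"


section \<open>The smooth topology on forms\<close>

text \<open>Open balls for the seminorms measuring, on a compact set \<open>K\<close> in the image of a chart, the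
  partial derivatives of order at most \<open>m\<close> of the components in that chart.\<close>

definition cinf_ball ::
  "'a chart set \<Rightarrow> nat \<Rightarrow> 'a form \<Rightarrow> 'a chart \<Rightarrow> (real^7) set \<Rightarrow> nat \<Rightarrow> real \<Rightarrow> 'a form set" where
  "cinf_ball A k \<omega> c K m \<epsilon> = {\<eta> \<in> smooth_forms A k.
     \<forall>y\<in>K. \<forall>ws ds. length ws = k \<and> set ws \<subseteq> Basis \<and> length ds \<le> m \<and> set ds \<subseteq> Basis \<longrightarrow>
       \<bar>iter_deriv (\<lambda>z. local_rep A c \<eta> z ws - local_rep A c \<omega> z ws) ds y\<bar> < \<epsilon>}"

definition cinf_topology :: "'a chart set \<Rightarrow> nat \<Rightarrow> 'a form topology" where
  "cinf_topology A k = topology_generated_by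
     {cinf_ball A k \<omega> c K m \<epsilon> | \<omega> c K m \<epsilon>.
        \<omega> \<in> smooth_forms A k \<and> c \<in> A \<and> compact K \<and> K \<subseteq> snd c ` fst c \<and> \<epsilon> > 0}"

definition closed_forms_topology :: "'a chart set \<Rightarrow> nat \<Rightarrow> 'a form topology" where
  "closed_forms_topology A k = subtopology (cinf_topology A k) (closed_forms A k)"


section \<open>De Rham cohomology in positive degree\<close>

definition dR_rel :: "'a chart set \<Rightarrow> nat \<Rightarrow> ('a form \<times> 'a form) set" where
  "dR_rel A k = {(\<alpha>, \<beta>). \<alpha> \<in> closed_forms A k \<and> \<beta> \<in> closed_forms A k \<and>
     (\<exists>\<xi>\<in>smooth_forms A (k - 1). form_lin 1 \<alpha> (- 1) \<beta> = ext_d A (k - 1) \<xi>)}"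

definition dR_class :: "'a chart set \<Rightarrow> nat \<Rightarrow> 'a form \<Rightarrow> 'a form set" where
  "dR_class A k \<omega> = dR_rel A k `` {\<omega>}"

definition dR_cohomology :: "'a chart set \<Rightarrow> nat \<Rightarrow> 'a form set set" where
  "dR_cohomology A k = closed_forms A k // dR_rel A k"

definition dR_lin ::
  "'a chart set \<Rightarrow> nat \<Rightarrow> real \<Rightarrow> 'a form set \<Rightarrow> real \<Rightarrow> 'a form set \<Rightarrow> 'a form set" where
  "dR_lin A k s a t b = (\<Union>\<alpha>\<in>a. \<Union>\<beta>\<in>b. dR_class A k (form_lin s \<alpha> t \<beta>))"

text \<open>On a compact manifold the cohomology is finite-dimensional, and its standard topology can be
  described in two ways: as the quotient topology of the smooth topology on closed forms, and as the
  topology of a finite-dimensional vector space, in which a set is open if its preimages under all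
  linear maps from Euclidean spaces are open. In the second definition such a linear map sends the
  first \<open>n\<close> coordinates of \<open>t\<close> to the class of a linear combination of \<open>n\<close> closed forms, and its
  preimages are regarded as cylinders in \<open>nat \<Rightarrow> real\<close>.\<close>

definition dR_quotient_topology :: "'a chart set \<Rightarrow> nat \<Rightarrow> 'a form set topology" where
  "dR_quotient_topology A k = topology (\<lambda>U. U \<subseteq> dR_cohomology A k \<and>
     openin (closed_forms_topology A k) {\<omega> \<in> closed_forms A k. dR_class A k \<omega> \<in> U})"

definition dR_linear_topology :: "'a chart set \<Rightarrow> nat \<Rightarrow> 'a form set topology" where
  "dR_linear_topology A k = topology (\<lambda>U. U \<subseteq> dR_cohomology A k \<and>
     (\<forall>n \<omega>. (\<forall>i<n. \<omega> i \<in> closed_forms A k) \<longrightarrow>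
        open {t :: nat \<Rightarrow> real. dR_class A k (form_comb n t \<omega>) \<in> U}))"

lemma openin_dR_quotient_topology:
  "openin (dR_quotient_topology A k) U \<longleftrightarrow> U \<subseteq> dR_cohomology A k \<and>
     openin (closed_forms_topology A k) {\<omega> \<in> closed_forms A k. dR_class A k \<omega> \<in> U}"
proof -
  have "istopology (\<lambda>U. U \<subseteq> dR_cohomology A k \<and>
     openin (closed_forms_topology A k) {\<omega> \<in> closed_forms A k. dR_class A k \<omega> \<in> U})"
    unfolding istopology_def
  proof (rule conjI; intro allI impI)
    fix S T :: "'a form set set"
    assume S: "S \<subseteq> dR_cohomology A k \<and>
        openin (closed_forms_topology A k) {\<omega> \<in> closed_forms A k. dR_class A k \<omega> \<in> S}"
      and T: "T \<subseteq> dR_cohomology A k \<and>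
        openin (closed_forms_topology A k) {\<omega> \<in> closed_forms A k. dR_class A k \<omega> \<in> T}"
    have "{\<omega> \<in> closed_forms A k. dR_class A k \<omega> \<in> S \<inter> T} =
        {\<omega> \<in> closed_forms A k. dR_class A k \<omega> \<in> S} \<inter> {\<omega> \<in> closed_forms A k. dR_class A k \<omega> \<in> T}"
      by auto
    with S T show "S \<inter> T \<subseteq> dR_cohomology A k \<and>
        openin (closed_forms_topology A k) {\<omega> \<in> closed_forms A k. dR_class A k \<omega> \<in> S \<inter> T}"
      by auto
  next
    fix \<K> :: "'a form set set set"
    assume K: "\<forall>S\<in>\<K>. S \<subseteq> dR_cohomology A k \<and>
        openin (closed_forms_topology A k) {\<omega> \<in> closed_forms A k. dR_class A k \<omega> \<in> S}"
    have "{\<omega> \<in> closed_forms A k. dR_class A k \<omega> \<in> \<Union>\<K>} =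
        (\<Union>S\<in>\<K>. {\<omega> \<in> closed_forms A k. dR_class A k \<omega> \<in> S})"
      by auto
    moreover have "openin (closed_forms_topology A k)
        (\<Union>S\<in>\<K>. {\<omega> \<in> closed_forms A k. dR_class A k \<omega> \<in> S})"
      using K by (intro openin_Union) auto
    ultimately show "\<Union>\<K> \<subseteq> dR_cohomology A k \<and>
        openin (closed_forms_topology A k) {\<omega> \<in> closed_forms A k. dR_class A k \<omega> \<in> \<Union>\<K>}"
      using K by auto
  qed
  then show ?thesis
    unfolding dR_quotient_topology_def by (simp add: topology_inverse')
qed

lemma openin_dR_linear_topology:
  "openin (dR_linear_topology A k) U \<longleftrightarrow> U \<subseteq> dR_cohomology A k \<and>
     (\<forall>n \<omega>. (\<forall>i<n. \<omega> i \<in> closed_forms A k) \<longrightarrow>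
        open {t :: nat \<Rightarrow> real. dR_class A k (form_comb n t \<omega>) \<in> U})"
proof -
  have "istopology (\<lambda>U. U \<subseteq> dR_cohomology A k \<and>
     (\<forall>n \<omega>. (\<forall>i<n. \<omega> i \<in> closed_forms A k) \<longrightarrow>
        open {t :: nat \<Rightarrow> real. dR_class A k (form_comb n t \<omega>) \<in> U}))"
    unfolding istopology_def
  proof (rule conjI; intro allI impI conjI)
    fix \<K> :: "'a form set set set" and n :: nat and \<omega> :: "nat \<Rightarrow> 'a form"
    assume K: "\<forall>S\<in>\<K>. S \<subseteq> dR_cohomology A k \<and>
        (\<forall>n \<omega>. (\<forall>i<n. \<omega> i \<in> closed_forms A k) \<longrightarrow>
          open {t :: nat \<Rightarrow> real. dR_class A k (form_comb n t \<omega>) \<in> S})"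
      and \<omega>: "\<forall>i<n. \<omega> i \<in> closed_forms A k"
    have "{t :: nat \<Rightarrow> real. dR_class A k (form_comb n t \<omega>) \<in> \<Union>\<K>} =
        (\<Union>S\<in>\<K>. {t. dR_class A k (form_comb n t \<omega>) \<in> S})"
      by auto
    then show "open {t :: nat \<Rightarrow> real. dR_class A k (form_comb n t \<omega>) \<in> \<Union>\<K>}"
      using K \<omega> by auto
  qed (auto simp: Collect_conj_eq intro!: open_Int)
  then show ?thesis
    unfolding dR_linear_topology_def by (simp add: topology_inverse')
qed


section \<open>Convex cones\<close>

text \<open>Unlike the library's notion, a convex cone may be empty and need not contain the origin.\<close>

definition form_cone :: "'a form set \<Rightarrow> bool" where
  "form_cone C \<longleftrightarrow> (\<forall>a\<in>C. \<forall>b\<in>C. \<forall>t1 t2. t1 \<ge> 0 \<and> t2 \<ge> 0 \<and> \<not> (t1 = 0 \<and> t2 = 0) \<longrightarrow>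
     form_lin t1 a t2 b \<in> C)"

definition dR_cone :: "'a chart set \<Rightarrow> nat \<Rightarrow> 'a form set set \<Rightarrow> bool" where
  "dR_cone A k C \<longleftrightarrow> (\<forall>a\<in>C. \<forall>b\<in>C. \<forall>t1 t2. t1 \<ge> 0 \<and> t2 \<ge> 0 \<and> \<not> (t1 = 0 \<and> t2 = 0) \<longrightarrow>
     dR_lin A k t1 a t2 b \<in> C)"


section \<open>The model forms and G2-structures\<close>

definition ndet :: "nat \<Rightarrow> (nat \<Rightarrow> nat \<Rightarrow> real) \<Rightarrow> real" where
  "ndet n M = (\<Sum>\<sigma> | \<sigma> permutes {..<n}. of_int (sign \<sigma>) * (\<Prod>i<n. M i (\<sigma> i)))"

text \<open>\<open>dx [i, j, \<dots>, l]\<close> is the wedge product of the coordinate covectors. The index type \<open>7\<close>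
  consists of the residues modulo 7, so that the seventh coordinate has index \<open>7 = 0\<close>.\<close>

definition dx :: "7 list \<Rightarrow> (real^7) list \<Rightarrow> real" where
  "dx I vs = (if length vs = length I then ndet (length I) (\<lambda>a b. (vs ! b) $ (I ! a)) else 0)"

definition phi0 :: "(real^7) list \<Rightarrow> real" where
  "phi0 vs = dx [1,2,3] vs + dx [1,4,5] vs + dx [1,6,7] vs + dx [2,4,6] vs
     - dx [2,5,7] vs - dx [3,4,7] vs - dx [3,5,6] vs"

definition star_phi0 :: "(real^7) list \<Rightarrow> real" where
  "star_phi0 vs = dx [4,5,6,7] vs + dx [2,3,6,7] vs + dx [2,3,4,5] vs + dx [1,3,5,7] vs
     - dx [1,3,4,6] vs - dx [1,2,5,6] vs - dx [1,2,4,7] vs"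

definition pullback :: "(real^7 \<Rightarrow> 'a tvec) \<Rightarrow> ('a tvec list \<Rightarrow> real) \<Rightarrow> (real^7) list \<Rightarrow> real" where
  "pullback e \<alpha> ws = \<alpha> (map e ws)"

definition positive3 :: "'a chart set \<Rightarrow> 'a form \<Rightarrow> bool" where
  "positive3 A \<phi> \<longleftrightarrow> \<phi> \<in> smooth_forms A 3 \<and> (\<forall>x. \<exists>e\<in>frames A x. pullback e (\<phi> x) = phi0)"

definition positive4 :: "'a chart set \<Rightarrow> 'a form \<Rightarrow> bool" where
  "positive4 A \<psi> \<longleftrightarrow> \<psi> \<in> smooth_forms A 4 \<and> (\<forall>x. \<exists>e\<in>frames A x. pullback e (\<psi> x) = star_phi0)"

text \<open>A G2-structure is given by the set of its frames at each point.\<close>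

type_synonym 'a g2_structure = "'a \<Rightarrow> (real^7 \<Rightarrow> 'a tvec) set"

definition g2_of3 :: "'a chart set \<Rightarrow> 'a form \<Rightarrow> 'a g2_structure" where
  "g2_of3 A \<phi> x = {e \<in> frames A x. pullback e (\<phi> x) = phi0}"

definition g2_of4 :: "('a \<Rightarrow> (real^7 \<Rightarrow> 'a tvec) set) \<Rightarrow> 'a form \<Rightarrow> 'a g2_structure" where
  "g2_of4 ori \<psi> x = {e \<in> ori x. pullback e (\<psi> x) = star_phi0}"

definition g2_orientation :: "'a chart set \<Rightarrow> 'a g2_structure \<Rightarrow> 'a \<Rightarrow> (real^7 \<Rightarrow> 'a tvec) set" where
  "g2_orientation A P x = {e' \<in> frames A x. \<exists>e\<in>P x. same_orient e e'}"

text \<open>The metric and the 3-form of a G2-structure, independent of the chosen frame since G2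
  preserves the Euclidean metric and \<open>phi0\<close>.\<close>

definition g2_metric :: "'a g2_structure \<Rightarrow> 'a \<Rightarrow> 'a tvec \<Rightarrow> 'a tvec \<Rightarrow> real" where
  "g2_metric P x u v = (let e = (SOME e. e \<in> P x) in inv e u \<bullet> inv e v)"

definition g2_form3 :: "'a g2_structure \<Rightarrow> 'a form" where
  "g2_form3 P x vs = (let e = (SOME e. e \<in> P x) in phi0 (map (inv e) vs))"


section \<open>Associative planes and TA-G2-manifolds\<close>

text \<open>An oriented \<open>k\<close>-plane in the tangent space at \<open>x\<close> is represented by the set of its oriented
  bases; all of them arise from one basis \<open>vs\<close> by matrices of positive determinant.\<close>

definition oriented_planes :: "'a chart set \<Rightarrow> nat \<Rightarrow> 'a \<Rightarrow> 'a tvec list set set" where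
  "oriented_planes A k x = {V. \<exists>vs. length vs = k \<and> set vs \<subseteq> tangent A x \<and>
     (\<forall>a. tcomb a vs = (\<lambda>c. 0) \<longrightarrow> (\<forall>i<k. a i = 0)) \<and>
     V = {us. length us = k \<and>
       (\<exists>M. (\<forall>i<k. us ! i = tcomb (M i) vs) \<and> ndet k M > 0)}}"

definition orthonormal :: "('a tvec \<Rightarrow> 'a tvec \<Rightarrow> real) \<Rightarrow> 'a tvec list \<Rightarrow> bool" where
  "orthonormal g us \<longleftrightarrow>
     (\<forall>i<length us. \<forall>j<length us. g (us ! i) (us ! j) = (if i = j then 1 else 0))"

text \<open>The volume form of an oriented \<open>k\<close>-plane is the \<open>k\<close>-form with value 1 on oriented
  orthonormal bases.\<close>

definition is_volume_form ::
  "('a tvec \<Rightarrow> 'a tvec \<Rightarrow> real) \<Rightarrow> 'a tvec list set \<Rightarrow> ('a tvec list \<Rightarrow> real) \<Rightarrow> bool" where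
  "is_volume_form g V \<alpha> \<longleftrightarrow> (\<forall>us\<in>V. orthonormal g us \<longrightarrow> \<alpha> us = 1)"

definition associative :: "'a g2_structure \<Rightarrow> 'a \<Rightarrow> 'a tvec list set \<Rightarrow> bool" where
  "associative P x V \<longleftrightarrow> is_volume_form (g2_metric P x) V (g2_form3 P x)"

definition positive_on_plane :: "'a tvec list set \<Rightarrow> ('a tvec list \<Rightarrow> real) \<Rightarrow> bool" where
  "positive_on_plane V \<alpha> \<longleftrightarrow> (\<forall>us\<in>V. \<alpha> us > 0)"

text \<open>Of the equivalent pointwise taming conditions, the one used is that \<open>\<phi>\<close> is positive on the
  3-planes which are associative for \<open>\<psi>\<close> and the orientation induced by \<open>\<phi>\<close>.\<close>

definition TA_G2 :: "'a chart set \<Rightarrow> 'a form \<Rightarrow> 'a form \<Rightarrow> bool" where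
  "TA_G2 A \<phi> \<psi> \<longleftrightarrow>
     \<phi> \<in> closed_forms A 3 \<and> positive3 A \<phi> \<and> \<psi> \<in> closed_forms A 4 \<and> positive4 A \<psi> \<and>
     (\<forall>x. \<forall>V\<in>oriented_planes A 3 x.
        associative (g2_of4 (g2_orientation A (g2_of3 A \<phi>)) \<psi>) x V \<longrightarrow> positive_on_plane V (\<phi> x))"

text \<open>In the first definition the 3-form has to induce the given orientation.\<close>

definition TA_cone3 ::
  "'a chart set \<Rightarrow> ('a \<Rightarrow> (real^7 \<Rightarrow> 'a tvec) set) \<Rightarrow> 'a form \<Rightarrow> 'a form set" where
  "TA_cone3 A ori \<psi> =
     {\<phi> \<in> smooth_forms A 3. TA_G2 A \<phi> \<psi> \<and> g2_orientation A (g2_of3 A \<phi>) = ori}"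

definition TA_cone4 :: "'a chart set \<Rightarrow> 'a form \<Rightarrow> 'a form set" where
  "TA_cone4 A \<phi> = {\<psi> \<in> smooth_forms A 4. TA_G2 A \<phi> \<psi>}"

end

theory Submission
  imports Defs
begin

text \<open>Write \<open>a \<times> b\<close> for the cross product of the model 3-form \<open>\<phi>\<^sub>0\<close>, and call a 3-form \<open>f\<close> on the
  model space tame if \<open>f(a, b, a \<times> b) > 0\<close> for all orthonormal \<open>a, b\<close>, that is, if \<open>f\<close> is positive on
  all associative planes. Tame forms are a convex set containing \<open>\<phi>\<^sub>0\<close>. Every tame form \<open>f\<close> is equivalent
  to \<open>\<phi>\<^sub>0\<close> by a matrix of positive determinant: the parameters on the segment from \<open>\<phi>\<^sub>0\<close> to \<open>f\<close> for
  which this holds form an open set, since the orbit of \<open>\<phi>\<^sub>0\<close> is open, and a closed set, since the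
  frames adapted to a compact family of nondegenerate forms are bounded. So positivity and
  orientation come for free, and for fixed \<open>\<psi>\<close> being TA is a pointwise convex condition on \<open>\<phi>\<close>.

  For fixed \<open>\<phi>\<close>, say \<open>\<phi>\<^sub>0\<close> in a suitable frame, the Hodge star turns \<open>\<psi>\<close> into a 3-form. If the matrix \<open>E\<close> pulls \<open>\<psi>\<close> back
  to the model 4-form, taming says that \<open>E\<^sup>*\<phi>\<^sub>0\<close> is tame, while tameness of the Hodge dual of \<open>\<psi>\<close>, a
  condition linear in \<open>\<psi>\<close>, says that \<open>(E\<^sup>T)\<^sup>*\<phi>\<^sub>0\<close> is tame. These are equivalent.

  Openness in the space of closed forms holds already for the \<open>C\<^sup>0\<close>-topology, because the frames
  adapted to the fixed form over a compact set are compact. It passes to cohomology since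
  cohomologous forms differ by a fixed exact form, which can be moved from one side to the other.\<close>


section \<open>The cross product of the model 3-form\<close>

text \<open>Boundedness of adapted frames rests on a polynomial invariant: if
  \<open>pb3 E f = P3\<close> and \<open>E *v w = u\<close> is a unit vector, then
  \<open>(qf f u)^2 * det E ^ 4\<close> is the eighth power of \<open>norm w\<close>. On a compact
  family of nondegenerate forms \<open>qf\<close> is bounded and bounded away from 0, so only
  \<open>det E\<close> is left to control, and applying the formula to the determinant of the
  inverse frame controls it.

  The equivalence under transposition says that positivity of one form on associative planes amounts
  to positivity of the other on coassociative planes. A zero of one quantity would put an
  associative plane of one structure inside a coassociative plane of the other. The obstacle is the
  sign, which nonvanishing leaves open; a trace that is symmetric in \<open>E\<close> and its
  transpose settles it.

  Orientation enters asymmetrically. A positive 3-form determines it, whereas negation preserves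
  every 4-form and reverses orientation in odd dimension. So frames adapted to a 4-form come in
  opposite pairs, and the arguments about them have to fix the sign of the determinant.\<close>

lemma exhaust_7:
  fixes x :: 7
  shows "x = 0 \<or> x = 1 \<or> x = 2 \<or> x = 3 \<or> x = 4 \<or> x = 5 \<or> x = 6"
proof (induct x)
  case (of_int z)
  then have "0 \<le> z" and "z < 7" by simp_all
  then have "z = 0 \<or> z = 1 \<or> z = 2 \<or> z = 3 \<or> z = 4 \<or> z = 5 \<or> z = 6" by arith
  then show ?case by auto
qed

lemma UNIV_7: "(UNIV :: 7 set) = {0,1,2,3,4,5,6}"
  using exhaust_7 by auto

lemma seven_eq_0 [simp]: "(7::7) = 0"
  by simp

lemma sum_7: "sum f (UNIV :: 7 set) = f 0 + f 1 + f 2 + f 3 + f 4 + f 5 + f 6"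
  unfolding UNIV_7 by (simp add: add.assoc)

lemma forall_7: "(\<forall>i::7. P i) \<longleftrightarrow> P 0 \<and> P 1 \<and> P 2 \<and> P 3 \<and> P 4 \<and> P 5 \<and> P 6"
proof -
  have "(\<forall>i::7. P i) \<longleftrightarrow> (\<forall>i\<in>UNIV. P i)" by simp
  then show ?thesis unfolding UNIV_7 by simp
qed

lemma lessThan_3: "{..<3::nat} = {0,1,2}"
  and lessThan_4: "{..<4::nat} = {0,1,2,3}"
  by auto

lemma ndet_3:
  "ndet 3 M = M 0 0 * M 1 1 * M 2 2 + M 0 1 * M 1 2 * M 2 0 + M 0 2 * M 1 0 * M 2 1
     - M 0 0 * M 1 2 * M 2 1 - M 0 1 * M 1 0 * M 2 2 - M 0 2 * M 1 1 * M 2 0"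
proof -
  have f: "finite {1,2::nat}" "0 \<notin> {1,2::nat}" "finite {2::nat}" "1 \<notin> {2::nat}"
    by auto
  show ?thesis
    unfolding ndet_def lessThan_3 sum_over_permutations_insert[OF f(1,2)]
      sum_over_permutations_insert[OF f(3,4)] permutes_sing
    by (simp add: sign_swap_id permutation_swap_id sign_compose sign_id swap_id_eq
        transpose_def algebra_simps)
qed

lemma ndet_4:
  "ndet 4 M =
     M 0 0 * ndet 3 (\<lambda>i j. M ([1,2,3] ! i) ([1,2,3] ! j))
   - M 0 1 * ndet 3 (\<lambda>i j. M ([1,2,3] ! i) ([0,2,3] ! j))
   + M 0 2 * ndet 3 (\<lambda>i j. M ([1,2,3] ! i) ([0,1,3] ! j))
   - M 0 3 * ndet 3 (\<lambda>i j. M ([1,2,3] ! i) ([0,1,2] ! j))"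
proof -
  have f: "finite {1,2,3::nat}" "0 \<notin> {1,2,3::nat}"
    "finite {2,3::nat}" "1 \<notin> {2,3::nat}" "finite {3::nat}" "2 \<notin> {3::nat}"
    by auto
  show ?thesis
    unfolding ndet_3
    unfolding ndet_def lessThan_4 sum_over_permutations_insert[OF f(1,2)]
      sum_over_permutations_insert[OF f(3,4)] sum_over_permutations_insert[OF f(5,6)] permutes_sing
    by (simp add: sign_swap_id permutation_swap_id permutation_compose sign_compose sign_id swap_id_eq
        transpose_def algebra_simps eval_nat_numeral)
qed

text \<open>Curried on vectors, so that linearity in one slot and matrix pull-backs involve no list
  updates. Index 0 is the seventh coordinate in all expansions below.\<close>

definition P3 :: "real^7 \<Rightarrow> real^7 \<Rightarrow> real^7 \<Rightarrow> real" where
  "P3 u v w = phi0 [u, v, w]"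

definition S4 :: "real^7 \<Rightarrow> real^7 \<Rightarrow> real^7 \<Rightarrow> real^7 \<Rightarrow> real" where
  "S4 u v w z = star_phi0 [u, v, w, z]"

definition cross :: "real^7 \<Rightarrow> real^7 \<Rightarrow> real^7" where
  "cross u v = (\<chi> k. P3 u v (axis k 1))"

lemma dx_3:
  "dx [i,j,k] [u,v,w] = u$i * (v$j * w$k - v$k * w$j) - u$j * (v$i * w$k - v$k * w$i)
     + u$k * (v$i * w$j - v$j * w$i)"
  by (simp add: dx_def ndet_3[unfolded numeral_3_eq_3] algebra_simps)

lemma dx_4:
  "dx [i,j,k,l] [z,u,v,w] = z$i * dx [j,k,l] [u,v,w] - z$j * dx [i,k,l] [u,v,w]
     + z$k * dx [i,j,l] [u,v,w] - z$l * dx [i,j,k] [u,v,w]"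
proof -
  have 4: "(4::nat) = Suc (Suc (Suc (Suc 0)))" by simp
  show ?thesis
    unfolding dx_3 by (simp add: dx_def ndet_4[unfolded 4] ndet_3 algebra_simps)
qed

lemma P3_expand:
  "P3 u v w = dx [1,2,3] [u,v,w] + dx [1,4,5] [u,v,w] + dx [1,6,0] [u,v,w] + dx [2,4,6] [u,v,w]
     - dx [2,5,0] [u,v,w] - dx [3,4,0] [u,v,w] - dx [3,5,6] [u,v,w]"
  by (simp add: P3_def phi0_def)

lemma S4_expand:
  "S4 u v w z = dx [4,5,6,0] [u,v,w,z] + dx [2,3,6,0] [u,v,w,z] + dx [2,3,4,5] [u,v,w,z]
     + dx [1,3,5,0] [u,v,w,z] - dx [1,3,4,6] [u,v,w,z] - dx [1,2,5,6] [u,v,w,z] - dx [1,2,4,0] [u,v,w,z]"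
  by (simp add: S4_def star_phi0_def)

lemma cross_components:
  "cross u v $ 0 = u$1 * v$6 - u$6 * v$1 - u$2 * v$5 + u$5 * v$2 - u$3 * v$4 + u$4 * v$3"
  "cross u v $ 1 = u$2 * v$3 - u$3 * v$2 + u$4 * v$5 - u$5 * v$4 + u$6 * v$0 - u$0 * v$6"
  "cross u v $ 2 = u$3 * v$1 - u$1 * v$3 + u$4 * v$6 - u$6 * v$4 - u$5 * v$0 + u$0 * v$5"
  "cross u v $ 3 = u$1 * v$2 - u$2 * v$1 - u$4 * v$0 + u$0 * v$4 - u$5 * v$6 + u$6 * v$5"
  "cross u v $ 4 = u$5 * v$1 - u$1 * v$5 + u$6 * v$2 - u$2 * v$6 - u$0 * v$3 + u$3 * v$0"
  "cross u v $ 5 = u$1 * v$4 - u$4 * v$1 - u$0 * v$2 + u$2 * v$0 - u$6 * v$3 + u$3 * v$6"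
  "cross u v $ 6 = u$0 * v$1 - u$1 * v$0 + u$2 * v$4 - u$4 * v$2 - u$3 * v$5 + u$5 * v$3"
  by (simp_all add: cross_def P3_expand dx_3 axis_def algebra_simps)

lemma inner_7: "(u :: real^7) \<bullet> v = u$0 * v$0 + u$1 * v$1 + u$2 * v$2 + u$3 * v$3 + u$4 * v$4
    + u$5 * v$5 + u$6 * v$6"
  by (simp add: inner_vec_def sum_7)

lemma P3_cross: "P3 u v w = cross u v \<bullet> w"
  by (simp add: inner_7 cross_components P3_expand dx_3 algebra_simps)

text \<open>Up to the real part \<open>cross\<close> is the product of imaginary octonions, and this
  is the alternative law u(uv) = (uu)v. It makes \<open>cross u\<close> act as \<open>norm u\<close>
  times a complex structure on the complement of \<open>u\<close>, which is behind most computations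
  with the model forms.\<close>

lemma cross_cross: "cross u (cross u v) = (u \<bullet> v) *\<^sub>R u - (u \<bullet> u) *\<^sub>R v"
  unfolding vec_eq_iff forall_7
  by (intro conjI; simp only: vector_minus_component vector_scaleR_component real_scaleR_def
      cross_components inner_7; simp add: algebra_simps)

text \<open>The 4-form measures how far the double cross product is from the formula valid in
  dimension 3. Being built from the metric and the cross product, it is alternating and invariant
  under isometries that preserve \<open>P3\<close>.\<close>

lemma S4_cross: "S4 u v w z = (u \<bullet> w) * (v \<bullet> z) - (u \<bullet> v) * (w \<bullet> z) - P3 u (cross v w) z"
proof -
  \<comment> \<open>Linearity in the last slot reduces the identity to the seven basis vectors,
    which keeps each coordinate expansion small.\<close>
  have 1: "S4 u v w z = z$0 * S4 u v w (axis 0 1) + z$1 * S4 u v w (axis 1 1) + z$2 * S4 u v w (axis 2 1)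
    + z$3 * S4 u v w (axis 3 1) + z$4 * S4 u v w (axis 4 1) + z$5 * S4 u v w (axis 5 1) + z$6 * S4 u v w (axis 6 1)"
    unfolding S4_expand dx_4 dx_3 by (simp add: axis_def) (simp add: algebra_simps)
  have 2: "\<forall>k. S4 u v w (axis k 1) = ((u \<bullet> w) *\<^sub>R v - (u \<bullet> v) *\<^sub>R w - cross u (cross v w)) $ k"
    unfolding forall_7 vector_minus_component vector_scaleR_component real_scaleR_def
    by (intro conjI; unfold S4_expand dx_4 dx_3 cross_components inner_7; simp add: axis_def; simp add: algebra_simps)
  have "S4 u v w z = ((u \<bullet> w) *\<^sub>R v - (u \<bullet> v) *\<^sub>R w - cross u (cross v w)) \<bullet> z"
    unfolding 1 inner_7[of _ z] using 2 by (simp add: mult.commute)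
  then show ?thesis
    by (simp add: inner_diff_left P3_cross)
qed

section \<open>Alternating 3-forms and their pull-backs\<close>

definition alt3 :: "('v::real_vector \<Rightarrow> 'v \<Rightarrow> 'v \<Rightarrow> real) \<Rightarrow> bool" where
  "alt3 f \<longleftrightarrow> (\<forall>v w. linear (\<lambda>u. f u v w)) \<and> (\<forall>u w. linear (\<lambda>v. f u v w)) \<and> (\<forall>u v. linear (f u v))
     \<and> (\<forall>u v. f u u v = 0) \<and> (\<forall>u v. f u v v = 0)"

lemma alt3D:
  assumes "alt3 f"
  shows alt3_linear1: "linear (\<lambda>u. f u v w)" and alt3_linear2: "linear (\<lambda>v. f u v w)"
    and alt3_linear3: "linear (f u v)" "linear (\<lambda>w. f u v w)"
    and alt3_self12: "f u u v = 0" and alt3_self23: "f u v v = 0"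
  using assms unfolding alt3_def by auto

lemma alt3_simps:
  assumes "alt3 f"
  shows "f (u + u') v w = f u v w + f u' v w" "f u (v + v') w = f u v w + f u v' w"
    "f u v (w + w') = f u v w + f u v w'"
    "f (u - u') v w = f u v w - f u' v w" "f u (v - v') w = f u v w - f u v' w"
    "f u v (w - w') = f u v w - f u v w'"
    "f (c *\<^sub>R u) v w = c * f u v w" "f u (c *\<^sub>R v) w = c * f u v w" "f u v (c *\<^sub>R w) = c * f u v w"
    "f (- u) v w = - f u v w" "f u (- v) w = - f u v w" "f u v (- w) = - f u v w"
    "f 0 v w = 0" "f u 0 w = 0" "f u v 0 = 0"
    "f u u v = 0" "f u v v = 0"
  using linear_add[OF alt3D(1)[OF assms]] linear_add[OF alt3D(2)[OF assms]] linear_add[OF alt3D(3)[OF assms]]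
    linear_diff[OF alt3D(1)[OF assms]] linear_diff[OF alt3D(2)[OF assms]] linear_diff[OF alt3D(3)[OF assms]]
    linear_scale[OF alt3D(1)[OF assms]] linear_scale[OF alt3D(2)[OF assms]] linear_scale[OF alt3D(3)[OF assms]]
    linear_neg[OF alt3D(1)[OF assms]] linear_neg[OF alt3D(2)[OF assms]] linear_neg[OF alt3D(3)[OF assms]]
    linear_0[OF alt3D(1)[OF assms]] linear_0[OF alt3D(2)[OF assms]] linear_0[OF alt3D(3)[OF assms]]
    alt3D(5,6)[OF assms]
  by (auto simp del: scaleR_conv_of_real)

text \<open>Polarisation of the vanishing on equal neighbours gives the sign of neighbouring
  transpositions, and these generate the outer ones.\<close>

lemma alt3_swap:
  assumes "alt3 f"
  shows alt3_swap12: "f v u w = - f u v w" and alt3_swap23: "f u w v = - f u v w"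
    and alt3_swap13: "f w v u = - f u v w"
    and alt3_self13: "f u v u = 0"
proof -
  show 1: "f v u w = - f u v w" for u v w
  proof -
    have "f u v w + f v u w = 0"
      using alt3_simps(16)[OF assms, of "u + v" w]
      unfolding alt3_simps(1)[OF assms] alt3_simps(2)[OF assms] by (simp add: alt3_self12[OF assms])
    then show ?thesis by linarith
  qed
  show 2: "f u w v = - f u v w" for u v w
  proof -
    have "f u v w + f u w v = 0"
      using alt3_simps(17)[OF assms, of u "v + w"]
      unfolding alt3_simps(2)[OF assms] alt3_simps(3)[OF assms] by (simp add: alt3_self23[OF assms])
    then show ?thesis by linarith
  qed
  show "f w v u = - f u v w"
    using 1[of w v u] 2[of v w u] 1[of v u w] by simp
  show "f u v u = 0"
    using 1[of v u u] by (simp add: alt3_simps[OF assms])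
qed

lemma linear_sum_axis:
  fixes g :: "real^'n \<Rightarrow> real"
  assumes "linear g" shows "g u = (\<Sum>i\<in>UNIV. u $ i * g (axis i 1))"
proof -
  have "g u = g (\<Sum>i\<in>UNIV. u $ i *\<^sub>R axis i 1)"
    by (simp add: basis_expansion scalar_mult_eq_scaleR[symmetric])
  then show ?thesis
    using assms by (simp add: linear_sum linear_scale)
qed

lemma alt3_expand:
  fixes f :: "real^'n \<Rightarrow> real^'n \<Rightarrow> real^'n \<Rightarrow> real"
  assumes "alt3 f"
  shows "f u v w = (\<Sum>i\<in>UNIV. \<Sum>j\<in>UNIV. \<Sum>k\<in>UNIV. u$i * (v$j * (w$k * f (axis i 1) (axis j 1) (axis k 1))))"
  apply (subst linear_sum_axis[OF alt3D(1)[OF assms]])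
  apply (subst linear_sum_axis[OF alt3D(2)[OF assms]])
  apply (subst linear_sum_axis[OF alt3D(3)[OF assms]])
  by (simp add: sum_distrib_left)

definition pb3 :: "real^7^7 \<Rightarrow> (real^7 \<Rightarrow> real^7 \<Rightarrow> real^7 \<Rightarrow> 'c) \<Rightarrow> real^7 \<Rightarrow> real^7 \<Rightarrow> real^7 \<Rightarrow> 'c" where
  "pb3 E f u v w = f (E *v u) (E *v v) (E *v w)"

lemma alt3_pb3:
  assumes "alt3 f" shows "alt3 (pb3 E f)"
  unfolding alt3_def pb3_def
  by (auto simp: alt3_simps[OF assms] matrix_vector_right_distrib matrix_vector_mult_scaleR
      intro!: linearI)

lemma alt3_lin: "alt3 f \<Longrightarrow> alt3 g \<Longrightarrow> alt3 (\<lambda>u v w. s * f u v w + t * g u v w)"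
  unfolding alt3_def by (auto simp: linear_iff algebra_simps)

lemma alt3_P3: "alt3 P3"
  unfolding alt3_def P3_expand dx_3
  by (auto simp: algebra_simps intro!: linearI)

lemmas P3_simps = alt3_simps[OF alt3_P3]

lemma cross_inner: "cross u v \<bullet> w = P3 u v w"
  by (simp add: P3_cross)

lemma cross_simps:
  "cross (u + u') v = cross u v + cross u' v" "cross u (v + v') = cross u v + cross u v'"
  "cross (u - u') v = cross u v - cross u' v" "cross u (v - v') = cross u v - cross u v'"
  "cross (c *\<^sub>R u) v = c *\<^sub>R cross u v" "cross u (c *\<^sub>R v) = c *\<^sub>R cross u v"
  "cross (- u) v = - cross u v" "cross u (- v) = - cross u v"
  "cross 0 v = 0" "cross u 0 = 0" "cross u u = 0"
  by (simp_all add: cross_def vec_eq_iff P3_simps)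

lemma cross_swap: "cross v u = - cross u v"
  by (simp add: cross_def vec_eq_iff alt3_swap12[OF alt3_P3, of v u])

lemma P3_rot: "P3 v w u = P3 u v w"
  using alt3_swap12[OF alt3_P3] alt3_swap23[OF alt3_P3] by (metis minus_minus)

lemma inner_cross: "w \<bullet> cross u v = P3 u v w"
  by (simp add: P3_cross inner_commute)

lemma cross_orth [simp]: "cross u v \<bullet> u = 0" "cross u v \<bullet> v = 0" "u \<bullet> cross u v = 0" "v \<bullet> cross u v = 0"
  by (simp_all add: cross_inner inner_cross P3_simps alt3_self13[OF alt3_P3])

lemma inner_cross_cross: "cross u v \<bullet> cross u w = (u \<bullet> u) * (v \<bullet> w) - (u \<bullet> v) * (u \<bullet> w)"
proof -
  have "cross u v \<bullet> cross u w = P3 u v (cross u w)" by (rule cross_inner)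
  also have "\<dots> = - P3 u (cross u w) v" by (rule alt3_swap23[OF alt3_P3])
  also have "\<dots> = - (cross u (cross u w) \<bullet> v)" by (simp add: cross_inner)
  finally show ?thesis
    by (simp add: cross_cross inner_diff_right inner_commute)
qed

lemma cross_cross': "cross u (cross v u) = (u \<bullet> u) *\<^sub>R v - (u \<bullet> v) *\<^sub>R u"
  using cross_cross[of u v] by (simp add: cross_swap[of v u] cross_simps)

text \<open>This is the squared length of \<open>cross u v\<close>, hence the Gram determinant of
  the pair. Independence of two vectors is expressed below by this number being nonzero.\<close>

lemma P3_cross_self: "P3 u v (cross u v) = (u \<bullet> u) * (v \<bullet> v) - (u \<bullet> v)\<^sup>2"
  by (simp add: P3_cross inner_cross_cross power2_eq_square)

text \<open>The bases \<open>(a, b, cross a b)\<close> represent exactly the oriented associative planes of the model.\<close>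

definition tame3 :: "(real^7 \<Rightarrow> real^7 \<Rightarrow> real^7 \<Rightarrow> real) \<Rightarrow> bool" where
  "tame3 f \<longleftrightarrow> (\<forall>a b. a \<bullet> a = 1 \<and> b \<bullet> b = 1 \<and> a \<bullet> b = 0 \<longrightarrow> f a b (cross a b) > 0)"

lemma tame3_lin:
  assumes "tame3 f" "tame3 g" "s \<ge> 0" "t \<ge> 0" "\<not> (s = 0 \<and> t = 0)"
  shows "tame3 (\<lambda>u v w. s * f u v w + t * g u v w)"
  unfolding tame3_def
proof (intro allI impI)
  fix a b :: "real^7" assume "a \<bullet> a = 1 \<and> b \<bullet> b = 1 \<and> a \<bullet> b = 0"
  then have "f a b (cross a b) > 0" "g a b (cross a b) > 0"
    using assms(1,2) unfolding tame3_def by auto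
  then show "0 < s * f a b (cross a b) + t * g a b (cross a b)"
    using assms(3-5) by (cases "s = 0"; cases "t = 0") (auto intro!: add_pos_pos)
qed

lemma tame3_P3: "tame3 P3"
  by (simp add: tame3_def P3_cross_self)

text \<open>The hypothesis is strict Cauchy-Schwarz, that is, independence of \<open>u\<close> and
  \<open>v\<close>. The change of basis is triangular with positive diagonal and so preserves
  orientation.\<close>

lemma gram_schmidt_2:
  fixes u v :: "'a::real_inner"
  assumes "(u \<bullet> u) * (v \<bullet> v) \<noteq> (u \<bullet> v)\<^sup>2"
  obtains a b r s t where "a \<bullet> a = 1" "b \<bullet> b = 1" "a \<bullet> b = 0" "u = r *\<^sub>R a" "v = s *\<^sub>R a + t *\<^sub>R b"
    "r > 0" "t > 0"
proof -
  have u: "u \<noteq> 0" using assms by auto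
  define r where "r = norm u"
  define a where "a = u /\<^sub>R r"
  have r: "r > 0" using u by (simp add: r_def)
  have rr: "r * r = u \<bullet> u" by (simp add: r_def power2_norm_eq_inner[symmetric] power2_eq_square)
  have ua: "u = r *\<^sub>R a" using r by (simp add: a_def)
  have aa: "a \<bullet> a = 1" using r by (simp add: a_def rr[symmetric] field_simps)
  define s where "s = a \<bullet> v"
  define v' where "v' = v - s *\<^sub>R a"
  have av': "a \<bullet> v' = 0" by (simp add: v'_def s_def inner_diff_right aa)
  have v'0: "v' \<noteq> 0"
  proof
    assume "v' = 0"
    then have v: "v = s *\<^sub>R a" by (simp add: v'_def)
    show False using assms unfolding v ua by (simp add: aa power2_eq_square)
  qed
  define t where "t = norm v'"
  define b where "b = v' /\<^sub>R t"
  have t: "t > 0" using v'0 by (simp add: t_def)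
  have tt: "t * t = v' \<bullet> v'" by (simp add: t_def power2_norm_eq_inner[symmetric] power2_eq_square)
  have vb: "v = s *\<^sub>R a + t *\<^sub>R b" using t by (simp add: b_def v'_def)
  have "b \<bullet> b = 1" using t by (simp add: b_def tt[symmetric] field_simps)
  moreover have "a \<bullet> b = 0" by (simp add: b_def av')
  ultimately show ?thesis using that aa ua vb r t by blast
qed

text \<open>The expression is a quadratic function of the bivector of \<open>u\<close> and
  \<open>v\<close>, so passing to an orthonormal basis of their span only introduces the square of
  the determinant \<open>r * t\<close>.\<close>

lemma tame3_pos:
  assumes "alt3 f" "tame3 f" "(u \<bullet> u) * (v \<bullet> v) \<noteq> (u \<bullet> v)\<^sup>2"
  shows "f u v (cross u v) > 0"
proof -
  obtain a b r s t where *: "a \<bullet> a = 1" "b \<bullet> b = 1" "a \<bullet> b = 0" "u = r *\<^sub>R a" "v = s *\<^sub>R a + t *\<^sub>R b"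
    "r > 0" "t > 0"
    using gram_schmidt_2[OF assms(3)] by metis
  have "f a b (cross a b) > 0" using assms(2) * unfolding tame3_def by blast
  moreover have "f u v (cross u v) = r\<^sup>2 * t\<^sup>2 * f a b (cross a b)"
    unfolding * by (simp add: alt3_simps[OF assms(1)] cross_simps power2_eq_square algebra_simps)
  ultimately show ?thesis using * by simp
qed

text \<open>Contraction of \<open>f\<close> with \<open>u\<close> always kills \<open>u\<close>.
  That it kills nothing else is stated on the orthogonal complement of \<open>u\<close>, where a
  kernel vector has to vanish.\<close>

definition nondeg3 :: "(real^7 \<Rightarrow> real^7 \<Rightarrow> real^7 \<Rightarrow> real) \<Rightarrow> bool" where
  "nondeg3 f \<longleftrightarrow> (\<forall>u v. u \<noteq> 0 \<and> u \<bullet> v = 0 \<and> (\<forall>w. f u v w = 0) \<longrightarrow> v = 0)"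

lemma tame3_nondeg3:
  assumes "alt3 f" "tame3 f" shows "nondeg3 f"
  unfolding nondeg3_def
proof (intro allI impI, rule ccontr)
  fix u v :: "real^7" assume *: "u \<noteq> 0 \<and> u \<bullet> v = 0 \<and> (\<forall>w. f u v w = 0)" and "v \<noteq> 0"
  then have "(u \<bullet> u) * (v \<bullet> v) \<noteq> (u \<bullet> v)\<^sup>2" by simp
  from tame3_pos[OF assms this] * show False by simp
qed

lemma P3_kernel:
  assumes "\<And>w. P3 u v w = 0" shows "(u \<bullet> u) *\<^sub>R v = (u \<bullet> v) *\<^sub>R u"
proof -
  have "cross u v = 0" using assms by (simp add: cross_def vec_eq_iff)
  then show ?thesis using cross_cross[of u v] by (simp add: cross_simps)
qed

text \<open>Although \<open>nondeg3\<close> mentions the metric, it only says that kernel vectors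
  are multiples of \<open>u\<close>, and this is invariant under linear isomorphisms. In the model
  it is \<open>P3_kernel\<close>.\<close>

lemma nondeg3_pb3:
  assumes "invertible E" "pb3 E f = P3" shows "nondeg3 f"
  unfolding nondeg3_def
proof (intro allI impI)
  fix u v :: "real^7" assume *: "u \<noteq> 0 \<and> u \<bullet> v = 0 \<and> (\<forall>w. f u v w = 0)"
  obtain F where F: "E ** F = mat 1" "F ** E = mat 1" using assms(1) unfolding invertible_def by blast
  define u' v' where "u' = F *v u" "v' = F *v v"
  have uv: "u = E *v u'" "v = E *v v'" by (simp_all add: u'_v'_def matrix_vector_mul_assoc F)
  have "P3 u' v' w = 0" for w
    using assms(2) * uv by (metis pb3_def)
  then have k: "(u' \<bullet> u') *\<^sub>R v' = (u' \<bullet> v') *\<^sub>R u'" by (rule P3_kernel)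
  have "(u' \<bullet> u') *\<^sub>R v = (u' \<bullet> v') *\<^sub>R u"
    unfolding uv using k by (metis matrix_vector_mult_scaleR)
  moreover have "u' \<noteq> 0" using * uv by auto
  ultimately have v: "v = ((u' \<bullet> v') / (u' \<bullet> u')) *\<^sub>R u"
    by (metis (no_types) divide_inverse_commute inner_eq_zero_iff scaleR_one scaleR_scaleR left_inverse)
  have "(u' \<bullet> v') / (u' \<bullet> u') * (u \<bullet> u) = 0"
    using * v by (metis inner_scaleR_right)
  then have "(u' \<bullet> v') / (u' \<bullet> u') = 0" using * by simp
  then show "v = 0" using v by simp
qed

text \<open>For a unit vector \<open>x\<close> orthogonal to \<open>a\<close>, \<open>b\<close>,
  \<open>c = cross a b\<close>, the complement of \<open>a\<close>, \<open>b\<close>,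
  \<open>c\<close> is spanned by \<open>x\<close> and its cross products with \<open>a\<close>,
  \<open>b\<close>, \<open>c\<close>. So \<open>cross x\<close> sends \<open>y\<close> into the span
  of \<open>a\<close>, \<open>b\<close>, \<open>c\<close>, which is orthogonal to
  \<open>z\<close>.\<close>

lemma P3_on_coassociative:
  assumes ab: "a \<bullet> a = 1" "b \<bullet> b = 1" "a \<bullet> b = 0"
    and x: "x \<bullet> a = 0" "x \<bullet> b = 0" "x \<bullet> cross a b = 0"
    and y: "y \<bullet> a = 0" "y \<bullet> b = 0" "y \<bullet> cross a b = 0"
    and z: "z \<bullet> a = 0" "z \<bullet> b = 0" "z \<bullet> cross a b = 0"
  shows "P3 x y z = 0"
proof -
  define c where "c = cross a b"
  have unit: "P3 x y z = 0" if x: "x \<bullet> x = 1" "x \<bullet> a = 0" "x \<bullet> b = 0" "x \<bullet> c = 0" for x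
  proof -
    have [simp]: "a \<bullet> a = 1" "b \<bullet> b = 1" "a \<bullet> b = 0" "b \<bullet> a = 0" "x \<bullet> x = 1"
      "x \<bullet> a = 0" "x \<bullet> b = 0" "x \<bullet> c = 0" "a \<bullet> x = 0" "b \<bullet> x = 0" "c \<bullet> x = 0"
      "a \<bullet> c = 0" "b \<bullet> c = 0" "c \<bullet> a = 0" "c \<bullet> b = 0"
      using ab x by (simp_all add: c_def inner_commute)
    have [simp]: "c \<bullet> c = 1" by (simp add: c_def inner_cross_cross)
    have ac: "cross a c = - b" "cross b c = a"
      by (simp_all add: c_def cross_cross cross_cross')
    have abx: "P3 a b x = 0" "P3 a c x = 0" "P3 b c x = 0"
      by (simp add: P3_cross flip: c_def, simp_all add: P3_cross ac)
    note sw = alt3_swap12[OF alt3_P3] alt3_swap23[OF alt3_P3]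
    have e: "P3 x v (cross x w) = (x \<bullet> x) * (v \<bullet> w) - (x \<bullet> v) * (x \<bullet> w)" for v w
      by (simp add: P3_cross inner_cross_cross)
    have abx': "P3 x a b = 0" "P3 x a c = 0" "P3 x b c = 0" "P3 x b a = 0" "P3 x c a = 0" "P3 x c b = 0"
      using abx sw by (metis minus_zero)+
    \<comment> \<open>An orthonormal basis adapted to the splitting: the first three vectors span
      the associative plane, the last four its complement.\<close>
    define B where "B = [a, b, c, x, cross x a, cross x b, cross x c]"
    have on: "\<forall>i<7. \<forall>j<7. (B ! i) \<bullet> (B ! j) = (if i = j then 1 else 0)"
      by (simp add: B_def eval_nat_numeral All_less_Suc inner_cross_cross inner_cross cross_inner abx' P3_simps e
          alt3_self13[OF alt3_P3])
    have len: "length B = 7" by (simp add: B_def)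
    have onS: "u \<bullet> v = (if u = v then 1 else 0)" if "u \<in> set B" "v \<in> set B" for u v
      using that on unfolding in_set_conv_nth len by (metis zero_neq_one)
    have "distinct B"
      unfolding distinct_conv_nth len using on by (metis zero_neq_one)
    then have card: "card (set B) = 7" using distinct_card len by metis
    have orth: "pairwise orthogonal (set B)"
      unfolding pairwise_def orthogonal_def using onS by auto
    moreover have "0 \<notin> set B" using onS by force
    ultimately have "independent (set B)" by (rule pairwise_orthogonal_independent)
    then have "span (set B) = UNIV"
      using card card_eq_dim[of "set B" UNIV] by auto
    then have "(\<Sum>i\<in>set B. (y \<bullet> i) *\<^sub>R i) = y"
      by (intro orthonormal_basis_expand[OF orth]) (auto simp: norm_eq_1 onS)
    also have "(\<Sum>i\<in>set B. (y \<bullet> i) *\<^sub>R i) = sum_list (map (\<lambda>i. (y \<bullet> i) *\<^sub>R i) B)"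
      using \<open>distinct B\<close> by (simp add: sum_list_distinct_conv_sum_set)
    finally have y_eq: "y = (y \<bullet> x) *\<^sub>R x + (y \<bullet> cross x a) *\<^sub>R cross x a + (y \<bullet> cross x b) *\<^sub>R cross x b
        + (y \<bullet> cross x c) *\<^sub>R cross x c"
      using y by (simp add: B_def c_def add.assoc)
    have "P3 x y z = cross x y \<bullet> z" by (rule P3_cross)
    also have "cross x y = - (y \<bullet> cross x a) *\<^sub>R a - (y \<bullet> cross x b) *\<^sub>R b - (y \<bullet> cross x c) *\<^sub>R c"
      by (subst y_eq) (simp add: cross_simps cross_cross)
    also have "\<dots> \<bullet> z = 0"
      using z by (simp add: inner_diff_right inner_commute c_def)
    finally show ?thesis .
  qed
  show ?thesis
  proof (cases "x = 0")
    case True then show ?thesis by (simp add: P3_simps)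
  next
    case False
    have "P3 (x /\<^sub>R norm x) y z = 0"
      using x False by (intro unit) (simp_all add: c_def power2_norm_eq_inner[symmetric] power2_eq_square)
    then show ?thesis using False by (simp add: P3_simps)
  qed
qed

text \<open>The triple product is cyclic, so each claim about \<open>cross u v\<close> reduces to a
  double cross product such as \<open>cross x u\<close>, which lies in the span of \<open>x\<close>
  and \<open>y\<close>.\<close>

lemma cross_pair_orth:
  assumes "P3 x y z = 0"
  defines "u \<equiv> cross x y" and "v \<equiv> cross x z"
  shows "u \<bullet> x = 0" "u \<bullet> y = 0" "u \<bullet> z = 0" "v \<bullet> x = 0" "v \<bullet> y = 0" "v \<bullet> z = 0"
    "cross u v \<bullet> x = 0" "cross u v \<bullet> y = 0" "cross u v \<bullet> z = 0"
proof -
  note sw = alt3_swap12[OF alt3_P3] alt3_swap23[OF alt3_P3] alt3_swap13[OF alt3_P3]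
  show 1: "u \<bullet> x = 0" "u \<bullet> y = 0" "u \<bullet> z = 0" "v \<bullet> x = 0" "v \<bullet> y = 0" "v \<bullet> z = 0"
    using assms(1) sw(2)[of x z y] by (simp_all add: u_def v_def cross_inner)
  have r: "cross u v \<bullet> t = cross t u \<bullet> v" for t
    by (simp add: cross_inner P3_rot)
  have r': "cross u v \<bullet> t = - (cross t v \<bullet> u)" for t
    using sw(2)[of t u v] by (simp add: cross_inner P3_rot)
  show "cross u v \<bullet> x = 0" "cross u v \<bullet> y = 0"
    unfolding r unfolding u_def using 1 by (simp_all add: cross_cross cross_cross' inner_diff_right inner_commute)
  show "cross u v \<bullet> z = 0"
    unfolding r' unfolding v_def using 1 by (simp add: cross_cross cross_cross' inner_diff_right inner_commute)
qed

lemma gram_injective: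
  assumes "invertible (E :: real^'n^'n)" "(u \<bullet> u) * (v \<bullet> v) \<noteq> (u \<bullet> v)\<^sup>2"
  shows "((E *v u) \<bullet> (E *v u)) * ((E *v v) \<bullet> (E *v v)) \<noteq> ((E *v u) \<bullet> (E *v v))\<^sup>2"
proof
  assume eq: "((E *v u) \<bullet> (E *v u)) * ((E *v v) \<bullet> (E *v v)) = ((E *v u) \<bullet> (E *v v))\<^sup>2"
  define p q where "p = (E *v u) \<bullet> (E *v u)" "q = (E *v u) \<bullet> (E *v v)"
  obtain F where F: "F ** E = mat 1" using assms(1) unfolding invertible_def by blast
  have inj: "w = 0" if "E *v w = 0" for w
    using that F by (metis matrix_vector_mul_assoc matrix_vector_mul_lid matrix_vector_mult_0_right)
  have "u \<noteq> 0" using assms(2) by auto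
  then have p: "p \<noteq> 0" using inj by (auto simp: p_q_def)
  \<comment> \<open>\<open>E *v w\<close> is \<open>p\<close> times the component of
    \<open>E *v v\<close> orthogonal to \<open>E *v u\<close>, so its squared norm is
    \<open>p\<close> times the Gram determinant of the images.\<close>
  define w where "w = p *\<^sub>R v - q *\<^sub>R u"
  have Ew: "E *v w = p *\<^sub>R (E *v v) - q *\<^sub>R (E *v u)"
    by (simp add: w_def matrix_vector_mult_diff_distrib matrix_vector_mult_scaleR)
  have "(E *v w) \<bullet> (E *v w) = p * (p * ((E *v v) \<bullet> (E *v v)) - q\<^sup>2)"
    unfolding Ew by (simp add: inner_diff_left inner_diff_right p_q_def inner_commute power2_eq_square algebra_simps)
  also have "\<dots> = 0" using eq by (simp add: p_q_def)
  finally have "w = 0" using inj by simp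
  then have "v = (q / p) *\<^sub>R u"
    using p by (simp add: w_def divide_inverse_commute) (metis scaleR_scaleR scaleR_one left_inverse)
  then show False using assms(2) by (simp add: power2_eq_square)
qed

section \<open>Rank-one updates of matrices\<close>

definition outer :: "real^'n \<Rightarrow> real^'n \<Rightarrow> real^'n^'n" where
  "outer a b = (\<chi> i j. a $ i * b $ j)"

lemma outer_mult_vec [simp]: "outer a b *v x = (b \<bullet> x) *\<^sub>R a"
  by (simp add: outer_def matrix_vector_mult_def vec_eq_iff inner_vec_def sum_distrib_left ac_simps)

lemma transpose_inner: "(transpose A *v x) \<bullet> y = x \<bullet> (A *v (y :: real^'n))"
  by (simp add: transpose_matrix_vector dot_lmul_matrix)

text \<open>An orthogonal change of basis turns \<open>a\<close> into a multiple of
  \<open>axis k 1\<close>. The matrix then differs from the identity only in row \<open>k\<close>,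
  and Cramer's rule evaluates it.\<close>

lemma det_one_plus_outer: "det (mat 1 + outer a b) = 1 + a \<bullet> (b :: real^'n)"
proof (cases "a = 0")
  case True
  then have "outer a b = 0" by (simp add: outer_def vec_eq_iff)
  then show ?thesis using True by simp
next
  case False
  define r where "r = norm a"
  have r: "r > 0" using False by (simp add: r_def)
  define k :: 'n where "k = undefined"
  obtain R :: "real^'n^'n" where R: "orthogonal_matrix R" "R *v (axis k 1) = a /\<^sub>R r"
    using orthogonal_matrix_exists_basis[of "a /\<^sub>R r" k] r r_def by auto
  have RR: "R ** transpose R = mat 1" using R(1) by (simp add: orthogonal_matrix_def)
  define c where "c = r *\<^sub>R (transpose R *v b)"
  have "mat 1 + outer a b = R ** (mat 1 + outer (axis k 1) c) ** transpose R"
    unfolding matrix_eq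
  proof
    fix x
    have "c \<bullet> (transpose R *v x) = r * (b \<bullet> x)"
      by (simp only: c_def inner_scaleR_left transpose_inner matrix_vector_mul_assoc RR matrix_vector_mul_lid)
    moreover have "R *v (transpose R *v x) = x"
      by (simp only: matrix_vector_mul_assoc RR matrix_vector_mul_lid)
    ultimately show "(mat 1 + outer a b) *v x = R ** (mat 1 + outer (axis k 1) c) ** transpose R *v x"
      using r by (simp only: matrix_vector_mul_assoc[symmetric] matrix_vector_mult_add_rdistrib outer_mult_vec
          matrix_vector_right_distrib matrix_vector_mult_scaleR R(2) matrix_vector_mul_lid) simp
  qed
  then have "det (mat 1 + outer a b) = det (mat 1 + outer (axis k 1) c) * (det R * det (transpose R))"
    by (simp add: det_mul)
  also have "det R * det (transpose R) = 1" using RR by (metis det_I det_mul)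
  also have "mat 1 + outer (axis k 1) c = (\<chi> i. if i = k then sum (\<lambda>i. (axis k 1 + c)$i *s row i (mat 1)) UNIV else row i (mat 1))"
    by (auto simp: vec_eq_iff outer_def axis_def row_def mat_def if_distrib cong: if_cong)
  also have "det \<dots> = (axis k 1 + c) $ k * det (mat 1 :: real^'n^'n)"
    by (rule cramer_lemma_transpose)
  also have "\<dots> * 1 = 1 + c $ k" by (simp add: axis_def)
  also have "c $ k = r * ((transpose R *v b) \<bullet> axis k 1)" by (simp add: c_def inner_axis)
  also have "(transpose R *v b) \<bullet> axis k 1 = b \<bullet> (R *v axis k 1)"
    by (rule transpose_inner)
  also have "r * \<dots> = a \<bullet> b" using r by (simp add: R(2) inner_commute)
  finally show ?thesis .
qed


section \<open>Boundedness of adapted frames\<close>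

lemma det_scaleR: "det (c *\<^sub>R (A :: real^'n^'n)) = c ^ CARD('n) * det A"
proof -
  have "c *\<^sub>R A = (\<chi> i. c *s (A $ i))"
    by (simp add: vec_eq_iff)
  then show ?thesis
    using det_rows_mul[of "\<lambda>_. c" "\<lambda>i. A $ i"] by simp
qed

text \<open>On the complement of \<open>w\<close> the matrix \<open>M\<close> is
  \<open>norm w\<close> times a complex structure, contributing \<open>(w \<bullet> w) ^ 3\<close>;
  the outer product fills in the kernel direction. The square appears because \<open>det N\<close>
  is computed from \<open>N ** transpose N\<close>.\<close>

lemma det_skew_plus_outer:
  fixes M :: "real^7^7"
  assumes tr: "\<And>x y. x \<bullet> (M *v y) = - ((M *v x) \<bullet> y)" and Mw: "M *v w = 0"
    and MM: "\<And>x. M *v (M *v x) = (w \<bullet> x) *\<^sub>R w - (w \<bullet> w) *\<^sub>R x" and xi: "\<xi> \<bullet> w = 1"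
  shows "(det (M + outer \<xi> \<xi>))\<^sup>2 = (w \<bullet> w) ^ 4"
proof -
  have w: "w \<noteq> 0" using xi by auto
  have wM: "w \<bullet> (M *v x) = 0" for x using tr[of w x] Mw by simp
  define \<beta> where "\<beta> = 1 / (w \<bullet> w)"
  have b: "\<beta> * (w \<bullet> w) = 1" using w by (simp add: \<beta>_def)
  have bpos: "w \<bullet> w > 0" "\<beta> > 0" using w by (simp_all add: \<beta>_def)
  define \<eta> where "\<eta> = \<xi> - \<beta> *\<^sub>R w"
  have xe: "\<xi> = \<eta> + \<beta> *\<^sub>R w" by (simp add: \<eta>_def)
  have ew: "\<eta> \<bullet> w = 0" by (simp add: \<eta>_def inner_diff_left xi b)
  define N where "N = M + \<beta>\<^sup>2 *\<^sub>R outer w w"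
  have Nv: "N *v x = M *v x + (\<beta>\<^sup>2 * (w \<bullet> x)) *\<^sub>R w" for x
    by (simp add: N_def matrix_vector_mult_add_rdistrib scaleR_matrix_vector_assoc[symmetric])
  \<comment> \<open>Both shears have determinant 1 since \<open>\<eta>\<close> is orthogonal to
    \<open>w\<close>. They strip \<open>\<xi>\<close> of its component \<open>\<eta>\<close>,
    leaving the part along \<open>w\<close>.\<close>
  have "(mat 1 + outer \<eta> w) ** N ** (mat 1 + outer w \<eta>) = M + outer \<xi> \<xi>"
    unfolding matrix_eq
  proof
    fix x
    define s where "s = \<eta> \<bullet> x"
    have s: "\<beta>\<^sup>2 * ((w \<bullet> w) * t) = \<beta> * t" for t
      using b by (simp add: power2_eq_square) 
    have 1: "N *v (x + s *\<^sub>R w) = M *v x + (\<beta>\<^sup>2 * (w \<bullet> x) + \<beta> * s) *\<^sub>R w"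
      using s[of s] by (simp add: Nv matrix_vector_right_distrib matrix_vector_mult_scaleR Mw inner_add_right algebra_simps)
    have "(mat 1 + outer \<eta> w) *v (N *v (x + s *\<^sub>R w)) =
       M *v x + (\<beta>\<^sup>2 * (w \<bullet> x) + \<beta> * s) *\<^sub>R w + ((\<beta>\<^sup>2 * (w \<bullet> x) + \<beta> * s) * (w \<bullet> w)) *\<^sub>R \<eta>"
      unfolding 1 by (simp add: matrix_vector_mult_add_rdistrib matrix_vector_right_distrib
          matrix_vector_mult_scaleR inner_add_right wM algebra_simps)
    also have "(\<beta>\<^sup>2 * (w \<bullet> x) + \<beta> * s) * (w \<bullet> w) = \<beta> * (w \<bullet> x) + s"
      using b by (simp add: power2_eq_square) algebra
    also have "M *v x + (\<beta>\<^sup>2 * (w \<bullet> x) + \<beta> * s) *\<^sub>R w + (\<beta> * (w \<bullet> x) + s) *\<^sub>R \<eta> = (M + outer \<xi> \<xi>) *v x"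
      by (simp add: xe matrix_vector_mult_add_rdistrib inner_add_left s_def algebra_simps power2_eq_square)
    finally show "((mat 1 + outer \<eta> w) ** N ** (mat 1 + outer w \<eta>)) *v x = (M + outer \<xi> \<xi>) *v x"
      by (simp add: matrix_vector_mul_assoc[symmetric] matrix_vector_mult_add_rdistrib[of _ _ x] s_def)
  qed
  then have 1: "det (M + outer \<xi> \<xi>) = det N"
    using ew by (metis det_mul det_one_plus_outer inner_commute add.right_neutral mult_1 mult.right_neutral)
  have trN: "transpose N *v x = (\<beta>\<^sup>2 * (w \<bullet> x)) *\<^sub>R w - M *v x" for x
  proof (rule vector_eq_ldot[THEN iffD1, rule_format])
    fix y
    have "y \<bullet> (transpose N *v x) = x \<bullet> (N *v y)" by (metis inner_commute transpose_inner)
    then show "y \<bullet> (transpose N *v x) = y \<bullet> ((\<beta>\<^sup>2 * (w \<bullet> x)) *\<^sub>R w - M *v x)"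
      unfolding Nv using tr[of x y] by (simp add: inner_diff_right inner_add_right inner_commute)
  qed
  \<comment> \<open>Forced by the value on \<open>w\<close>: there \<open>N ** transpose N\<close>
    acts as \<open>\<beta>^2\<close>, so \<open>1 + \<kappa> * (w \<bullet> w)\<close> has to be
    \<open>\<beta> ^ 3\<close>.\<close>
  define \<kappa> where "\<kappa> = \<beta> * (\<beta> ^ 3 - 1)"
  have NN: "N ** transpose N = (w \<bullet> w) *\<^sub>R (mat 1 + outer (\<kappa> *\<^sub>R w) w)"
    unfolding matrix_eq
  proof
    fix x
    have "(N ** transpose N) *v x = N *v ((\<beta>\<^sup>2 * (w \<bullet> x)) *\<^sub>R w - M *v x)"
      by (simp only: matrix_vector_mul_assoc[symmetric] trN)
    also have "\<dots> = (w \<bullet> w) *\<^sub>R x + ((\<beta>\<^sup>2 * (w \<bullet> x)) * (\<beta>\<^sup>2 * (w \<bullet> w)) - w \<bullet> x) *\<^sub>R w"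
      unfolding Nv by (simp add: matrix_vector_right_distrib matrix_vector_mult_scaleR Mw MM wM
          inner_add_right inner_diff_right matrix_vector_mult_diff_distrib algebra_simps)
    also have "(\<beta>\<^sup>2 * (w \<bullet> x)) * (\<beta>\<^sup>2 * (w \<bullet> w)) - w \<bullet> x = (w \<bullet> w) * (\<kappa> * (w \<bullet> x))"
      using b unfolding \<kappa>_def by algebra
    finally show "(N ** transpose N) *v x = ((w \<bullet> w) *\<^sub>R (mat 1 + outer (\<kappa> *\<^sub>R w) w)) *v x"
      by (simp add: scaleR_matrix_vector_assoc[symmetric] matrix_vector_mult_add_rdistrib algebra_simps)
  qed
  have "det N * det N = (w \<bullet> w) ^ 7 * (1 + \<kappa> * (w \<bullet> w))"
    using arg_cong[OF NN, of det] unfolding det_mul det_transpose det_scaleR det_one_plus_outer by simp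
  also have "1 + \<kappa> * (w \<bullet> w) = \<beta> ^ 3" using b unfolding \<kappa>_def by algebra
  also have "(w \<bullet> w) ^ 7 * \<beta> ^ 3 = (w \<bullet> w) ^ 4" using b by algebra
  finally show ?thesis unfolding 1 by (simp add: power2_eq_square)
qed

section \<open>A determinant invariant of 3-forms\<close>

definition Mf :: "(real^7 \<Rightarrow> real^7 \<Rightarrow> real^7 \<Rightarrow> real) \<Rightarrow> real^7 \<Rightarrow> real^7^7" where
  "Mf f u = (\<chi> i j. f u (axis i 1) (axis j 1))"

lemma Mf_inner:
  assumes "alt3 f" shows "y \<bullet> (Mf f u *v z) = f u y z"
proof -
  have "f u y z = (\<Sum>i\<in>UNIV. y $ i * f u (axis i 1) z)"
    by (rule linear_sum_axis[OF alt3_linear2[OF assms]])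
  also have "\<dots> = (\<Sum>i\<in>UNIV. y $ i * (\<Sum>j\<in>UNIV. z $ j * f u (axis i 1) (axis j 1)))"
    by (subst linear_sum_axis[OF alt3_linear3(1)[OF assms]]) simp
  finally show ?thesis
    by (simp add: inner_vec_def Mf_def matrix_vector_mult_def mult.commute)
qed

lemma Mf_P3: "Mf P3 w *v x = - cross w x"
  by (rule vector_eq_ldot[THEN iffD1, rule_format])
    (simp add: Mf_inner[OF alt3_P3] inner_cross alt3_swap23[OF alt3_P3, of w x])

lemma Mf_pb3:
  assumes "alt3 f"
  shows "transpose E ** (Mf f (E *v w) + outer u u) ** E = Mf (pb3 E f) w + outer (transpose E *v u) (transpose E *v u)"
  unfolding matrix_eq
proof
  fix x
  show "(transpose E ** (Mf f (E *v w) + outer u u) ** E) *v x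
      = (Mf (pb3 E f) w + outer (transpose E *v u) (transpose E *v u)) *v x"
  proof (rule vector_eq_ldot[THEN iffD1, rule_format])
    fix y
    have "y \<bullet> (transpose E *v z) = (E *v y) \<bullet> z" for z by (metis inner_commute transpose_inner)
    moreover have "y \<bullet> (Mf (pb3 E f) w *v x) = f (E *v w) (E *v y) (E *v x)"
      using Mf_inner[OF alt3_pb3[OF assms]] by (simp add: pb3_def)
    ultimately show "y \<bullet> ((transpose E ** (Mf f (E *v w) + outer u u) ** E) *v x)
      = y \<bullet> ((Mf (pb3 E f) w + outer (transpose E *v u) (transpose E *v u)) *v x)"
      by (simp only: matrix_vector_mul_assoc[symmetric] matrix_vector_mult_add_rdistrib inner_add_right
          Mf_inner[OF assms] outer_mult_vec inner_scaleR_right transpose_inner)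
  qed
qed

text \<open>For the symmetric form \<open>B\<close> with values in 7-forms given by
  \<open>B(u, u) = \<iota>\<^sub>u f \<and> \<iota>\<^sub>u f \<and> f\<close>, the following is \<open>B(u, u)\<^sup>2 |u|\<^sup>4\<close> up to a constant: the adjugate of a
  skew matrix of odd size is the square of its vector of Pfaffians.\<close>

definition qf :: "(real^7 \<Rightarrow> real^7 \<Rightarrow> real^7 \<Rightarrow> real) \<Rightarrow> real^7 \<Rightarrow> real" where
  "qf f u = det (Mf f u + outer u u)"

text \<open>In the model \<open>det_skew_plus_outer\<close> applies with the vector
  \<open>transpose E *v u\<close>, whose inner product with \<open>w\<close> is
  \<open>u \<bullet> u\<close>, and the congruence by \<open>E\<close> contributes
  \<open>det E\<close> twice. So up to its determinant, an adapted frame has prescribed lengths of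
  preimages of unit vectors.\<close>

lemma qf_frame:
  assumes f: "alt3 f" and E: "pb3 E f = P3" and u: "E *v w = u" "u \<bullet> u = 1"
  shows "(qf f u)\<^sup>2 * det E ^ 4 = (w \<bullet> w) ^ 4"
proof -
  have "(det (Mf P3 w + outer (transpose E *v u) (transpose E *v u)))\<^sup>2 = (w \<bullet> w) ^ 4"
  proof (rule det_skew_plus_outer)
    show "x \<bullet> (Mf P3 w *v y) = - ((Mf P3 w *v x) \<bullet> y)" for x y
      by (simp add: Mf_P3 inner_cross cross_inner alt3_swap23[OF alt3_P3, of w x])
    show "Mf P3 w *v w = 0" by (simp add: Mf_P3 cross_simps)
    show "Mf P3 w *v (Mf P3 w *v x) = (w \<bullet> x) *\<^sub>R w - (w \<bullet> w) *\<^sub>R x" for x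
      by (simp add: Mf_P3 cross_simps cross_cross)
    show "(transpose E *v u) \<bullet> w = 1" by (simp only: transpose_inner u)
  qed
  also have "Mf P3 w + outer (transpose E *v u) (transpose E *v u) = transpose E ** (Mf f u + outer u u) ** E"
    using Mf_pb3[OF f, of E w u] by (simp only: E u)
  finally show ?thesis
    by (simp add: det_mul qf_def power2_eq_square power4_eq_xxxx ac_simps)
qed

text \<open>Pairing a kernel vector \<open>v\<close> with itself leaves
  \<open>(u \<bullet> v)^2 = 0\<close>. Then \<open>v\<close> is orthogonal to \<open>u\<close> and
  is killed by the contraction of \<open>f\<close> with \<open>u\<close>.\<close>

lemma qf_nonzero:
  assumes f: "alt3 f" and n: "nondeg3 f" and u: "u \<bullet> u = 1"
  shows "qf f u \<noteq> 0"
proof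
  assume "qf f u = 0"
  then have "\<not> invertible (Mf f u + outer u u)"
    by (simp add: qf_def invertible_det_nz)
  then obtain v where v: "(Mf f u + outer u u) *v v = 0" "v \<noteq> 0"
    using matrix_left_invertible_ker invertible_left_inverse by metis
  have e: "f u y v + (u \<bullet> v) * (y \<bullet> u) = 0" for y
    using arg_cong[OF v(1), of "inner y"]
    by (simp add: matrix_vector_mult_add_rdistrib inner_add_right Mf_inner[OF f])
  have uv: "u \<bullet> v = 0"
    using e[of v] by (simp add: alt3_simps[OF f] inner_commute)
  have "f u v y = 0" for y
    using e[of y] uv alt3_swap23[OF f, of u y v] by simp
  then show False
    using n v uv u unfolding nondeg3_def by (metis inner_zero_left zero_neq_one)
qed

section \<open>Uniform bounds for adapted frames\<close>

lemma abs_det_le: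
  fixes A :: "real^'n^'n"
  assumes "\<And>i j. \<bar>A $ i $ j\<bar> \<le> m"
  shows "\<bar>det A\<bar> \<le> fact CARD('n) * m ^ CARD('n)"
proof -
  have "\<bar>det A\<bar> \<le> (\<Sum>p | p permutes (UNIV :: 'n set). \<bar>of_int (sign p) * (\<Prod>i\<in>UNIV. A $ i $ p i)\<bar>)"
    unfolding det_def by (rule sum_abs)
  also have "\<dots> \<le> (\<Sum>p | p permutes (UNIV :: 'n set). m ^ CARD('n))"
  proof (rule sum_mono)
    fix p
    have "\<bar>\<Prod>i\<in>UNIV. A $ i $ p i\<bar> \<le> (\<Prod>i\<in>(UNIV::'n set). m)"
      unfolding abs_prod by (rule prod_mono) (use assms in auto)
    then show "\<bar>of_int (sign p) * (\<Prod>i\<in>UNIV. A $ i $ p i)\<bar> \<le> m ^ CARD('n)"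
      by (cases p rule: sign_cases) (auto simp: abs_mult)
  qed
  finally show ?thesis
    by (simp add: card_permutations)
qed

lemma continuous_on_det [continuous_intros]:
  fixes A :: "'a::topological_space \<Rightarrow> real^'n^'n"
  assumes "\<And>i j. continuous_on S (\<lambda>x. A x $ i $ j)"
  shows "continuous_on S (\<lambda>x. det (A x))"
  unfolding det_def by (intro continuous_intros assms)

text \<open>A kernel vector of \<open>E\<close> is annihilated by \<open>P3\<close>. If it were
  nonzero, \<open>P3_kernel\<close> would make every vector a multiple of it.\<close>

lemma pb3_P3_invertible:
  assumes "alt3 f" "pb3 E f = P3" shows "invertible E"
proof -
  have "w = 0" if "E *v w = 0" for w
  proof -
    have "P3 w v z = 0" for v z
      using that unfolding assms(2)[symmetric] pb3_def by (simp add: alt3_simps[OF assms(1)])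
    then have "(w \<bullet> w) *\<^sub>R v = (w \<bullet> v) *\<^sub>R w" for v by (rule P3_kernel)
    then have eq: "(w \<bullet> w) * v $ i = (w \<bullet> v) * w $ i" for v i
      by (metis real_scaleR_def vector_scaleR_component)
    have "w $ i = 0" for i
    proof (rule ccontr)
      assume wi: "w $ i \<noteq> 0"
      obtain j where j: "j \<noteq> i" by (metis (full_types) exhaust_7 zero_neq_one)
      have "(w \<bullet> w) * axis j 1 $ j = (w \<bullet> axis j 1) * w $ j"
        "(w \<bullet> w) * axis j 1 $ i = (w \<bullet> axis j 1) * w $ i" by (rule eq)+
      then have "w \<bullet> w = w $ j * w $ j" "w $ j = 0"
        using j wi by (auto simp: inner_axis axis_def)
      then have "w = 0" by simp
      then show False using wi by simp
    qed
    then show ?thesis by (simp add: vec_eq_iff)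
  qed
  then show ?thesis
    unfolding invertible_left_inverse matrix_left_invertible_ker by blast
qed

text \<open>Replaces the n-th root of \<open>Y\<close> by the cruder \<open>max 1 Y\<close>, whose
  n-th power is still at least \<open>Y\<close>.\<close>

lemma power_le_scaled:
  fixes x y Y :: real
  assumes "x ^ n \<le> Y * y ^ n" "0 \<le> x" "0 \<le> y" "n > 0"
  shows "x \<le> max 1 Y * y"
proof -
  have "Y \<le> max 1 Y ^ n"
    using self_le_power[of "max 1 Y" n] assms(4) by linarith
  then have "x ^ n \<le> (max 1 Y * y) ^ n"
    unfolding power_mult_distrib using assms(1,3) by (meson mult_right_mono order_trans zero_le_power)
  then show ?thesis
    using assms by (subst (asm) power_mono_iff) auto
qed

text \<open>By hypothesis the inverse of \<open>E\<close> has size of order \<open>d\<close> to the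
  power 1/2, where \<open>d = \<bar>det E\<bar>\<close>. So \<open>1 / d\<close> is at most of order
  7/2 in \<open>d\<close>, which keeps \<open>d\<close> away from 0. This bounds \<open>E\<close>,
  hence \<open>d\<close> from above, hence the inverse. The bounds are explicit in \<open>c\<close>
  and \<open>C\<close> so as to be uniform in families.\<close>

lemma frame_bounds:
  fixes E :: "real^7^7"
  assumes inv: "invertible E" and cC: "c > 0" "C > 0"
    and h: "\<And>w. norm (E *v w) = 1 \<Longrightarrow> c * det E ^ 4 \<le> norm w ^ 8 \<and> norm w ^ 8 \<le> C * det E ^ 4"
  defines "Y \<equiv> 1 / (c * (min 1 (1 / (fact 7 ^ 8 * C ^ 7))) ^ 4)"
  shows "norm (E *v w) \<le> max 1 Y * norm w"
    and "norm w \<le> max 1 (C * (fact 7 * max 1 Y ^ 7) ^ 4) * norm (E *v w)"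
proof -
  define d where "d = \<bar>det E\<bar>"
  have d: "d > 0" using inv by (simp add: d_def invertible_det_nz)
  have d4: "det E ^ 4 = d ^ 4" by (simp add: d_def)
  have E0: "E *v w = 0 \<longleftrightarrow> w = 0" for w
    using inv unfolding invertible_left_inverse matrix_left_invertible_ker by auto
  have h': "c * d ^ 4 * norm (E *v w) ^ 8 \<le> norm w ^ 8 \<and> norm w ^ 8 \<le> C * d ^ 4 * norm (E *v w) ^ 8" for w
  proof (cases "w = 0")
    case False
    define r where "r = norm (E *v w)"
    have r: "r > 0" using False E0 by (simp add: r_def)
    have "norm (E *v (w /\<^sub>R r)) = 1" using r by (simp add: matrix_vector_mult_scaleR r_def)
    from h[OF this] have "c * d ^ 4 \<le> (norm w / r) ^ 8" "(norm w / r) ^ 8 \<le> C * d ^ 4"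
      using r by (simp_all add: d4 divide_inverse mult.commute)
    then show ?thesis
      using r by (simp add: power_divide field_simps flip: r_def)
  qed (simp add: d)
  obtain F where F: "E ** F = mat 1" using inv unfolding invertible_def by blast
  have EF: "E *v (F *v u) = u" for u by (simp add: matrix_vector_mul_assoc F)
  \<comment> \<open>A bound for the entries of the inverse: it maps unit vectors to vectors whose
    eighth power of the norm is at most \<open>C * d ^ 4\<close>.\<close>
  define m where "m = root 8 (C * d ^ 4)"
  have m: "m \<ge> 0" "m ^ 8 = C * d ^ 4" using cC d by (simp_all add: m_def)
  have "\<bar>F $ i $ j\<bar> \<le> m" for i j
  proof -
    have "norm (F *v axis j 1) ^ 8 \<le> m ^ 8 * norm (axis j 1 :: real^7) ^ 8"
      using h'[of "F *v axis j 1"] by (simp add: EF m)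
    then have "norm (F *v axis j 1) \<le> m"
      using m power_mono_iff[of "norm (F *v axis j 1)" m 8] by (simp add: norm_axis_1)
    moreover have "F $ i $ j = (F *v axis j 1) $ i"
      by (simp add: matrix_vector_mul_component inner_axis row_def)
    ultimately show ?thesis
      using component_le_norm_cart[of "F *v axis j 1" i] by simp
  qed
  then have "\<bar>det F\<bar> \<le> fact 7 * m ^ 7" using abs_det_le[of F m] by simp
  moreover have "d * \<bar>det F\<bar> = 1"
    using arg_cong[OF F, of det] by (simp add: d_def det_mul flip: abs_mult)
  ultimately have "1 \<le> d * (fact 7 * m ^ 7)" using d by (metis mult_left_mono less_imp_le)
  then have "1 \<le> (d * (fact 7 * m ^ 7)) ^ 8" by simp
  also have "\<dots> = d ^ 8 * (fact 7 ^ 8 * (m ^ 8) ^ 7)"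
    by (simp only: power_mult_distrib power_mult[symmetric] mult.commute)
  \<comment> \<open>The exponent 36 consists of 8 from the factor \<open>d\<close> and 4 * 7 from
    \<open>(m ^ 8) ^ 7\<close>.\<close>
  also have "\<dots> = (fact 7 ^ 8 * C ^ 7) * d ^ 36"
    unfolding m(2) by (simp add: power_mult_distrib power_mult[symmetric] power_add[symmetric] mult_ac) 
  finally have N: "1 \<le> (fact 7 ^ 8 * C ^ 7) * d ^ 36" .
  define N where "N = (fact 7 ^ 8 * C ^ 7 :: real)"
  have N0: "N > 0" using cC by (simp add: N_def)
  \<comment> \<open>For \<open>d < 1\<close> the power \<open>d ^ 36\<close> is at most
    \<open>d\<close>, so \<open>1 / N\<close> is a lower bound for \<open>d\<close> without taking a
    root.\<close>
  define \<delta> where "\<delta> = min 1 (1 / N)"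
  have \<delta>: "\<delta> > 0" using N0 by (simp add: \<delta>_def)
  have "\<delta> \<le> d"
  proof (cases "d \<ge> 1")
    case False
    then have "d ^ 36 \<le> d" using d power_decreasing[of 1 36 d] by simp
    then have "1 \<le> N * d" using N N0 unfolding N_def[symmetric] by (meson mult_left_mono order_trans less_imp_le)
    then have "1 / N \<le> d" using N0 by (simp add: field_simps)
    then show ?thesis by (simp add: \<delta>_def)
  qed (simp add: \<delta>_def)
  then have dd: "\<delta> ^ 4 \<le> d ^ 4" using \<delta> by (intro power_mono) auto
  have Y: "Y = 1 / (c * \<delta> ^ 4)" by (simp add: Y_def \<delta>_def N_def)
  have 1: "norm (E *v w) \<le> max 1 Y * norm w" for w
  proof (rule power_le_scaled)
    have "c * \<delta> ^ 4 * norm (E *v w) ^ 8 \<le> c * d ^ 4 * norm (E *v w) ^ 8"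
      using dd cC by (intro mult_right_mono mult_left_mono) auto
    also have "\<dots> \<le> norm w ^ 8" using h'[of w] by simp
    finally show "norm (E *v w) ^ 8 \<le> Y * norm w ^ 8"
      unfolding Y using cC \<delta> by (simp add: field_simps)
  qed auto
  then show "norm (E *v w) \<le> max 1 Y * norm w" .
  have "\<bar>E $ i $ j\<bar> \<le> max 1 Y" for i j
  proof -
    have "E $ i $ j = (E *v axis j 1) $ i"
      by (simp add: matrix_vector_mul_component inner_axis row_def)
    then show ?thesis
      using component_le_norm_cart[of "E *v axis j 1" i] 1[of "axis j 1"] by (simp add: norm_axis_1)
  qed
  then have D: "d \<le> fact 7 * max 1 Y ^ 7" unfolding d_def using abs_det_le[of E "max 1 Y"] by simp
  show "norm w \<le> max 1 (C * (fact 7 * max 1 Y ^ 7) ^ 4) * norm (E *v w)"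
  proof (rule power_le_scaled)
    have "norm w ^ 8 \<le> C * d ^ 4 * norm (E *v w) ^ 8" using h'[of w] by simp
    also have "\<dots> \<le> C * (fact 7 * max 1 Y ^ 7) ^ 4 * norm (E *v w) ^ 8"
      using D d cC by (intro mult_right_mono mult_left_mono power_mono) auto
    finally show "norm w ^ 8 \<le> C * (fact 7 * max 1 Y ^ 7) ^ 4 * norm (E *v w) ^ 8" .
  qed auto
qed

text \<open>The square of \<open>qf\<close> is continuous and positive on \<open>K\<close> times the
  unit sphere. Its extrema there serve as the constants of \<open>frame_bounds\<close>, so
  \<open>R\<close> depends on the family only.\<close>

lemma frames_bounded:
  fixes f :: "'p::metric_space \<Rightarrow> real^7 \<Rightarrow> real^7 \<Rightarrow> real^7 \<Rightarrow> real"
  assumes K: "compact K" and alt: "\<And>p. p \<in> K \<Longrightarrow> alt3 (f p)" and nd: "\<And>p. p \<in> K \<Longrightarrow> nondeg3 (f p)"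
    and cont: "\<And>i j k. continuous_on K (\<lambda>p. f p (axis i 1) (axis j 1) (axis k 1))"
  shows "\<exists>R>0. \<forall>p\<in>K. \<forall>E w. pb3 E (f p) = P3 \<longrightarrow> norm (E *v w) \<le> R * norm w \<and> norm w \<le> R * norm (E *v w)"
proof -
  define S where "S = K \<times> sphere (0::real^7) 1"
  define g where "g = (\<lambda>x. (qf (f (fst x)) (snd x))\<^sup>2)"
  have S: "compact S" using K by (simp add: S_def compact_Times)
  have cont': "continuous_on S (\<lambda>x. f (fst x) (axis i 1) (axis j 1) (axis k 1))" for i j k
    by (rule continuous_on_compose2[OF cont continuous_on_fst[OF continuous_on_id]]) (auto simp: S_def)
  have fc: "continuous_on S (\<lambda>x. f (fst x) (snd x) (axis i 1) (axis j 1))" for i j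
  proof (rule continuous_on_eq)
    show "continuous_on S (\<lambda>x. \<Sum>a\<in>UNIV. snd x $ a * f (fst x) (axis a 1) (axis i 1) (axis j 1))"
      by (intro continuous_intros cont')
    show "(\<Sum>a\<in>UNIV. snd x $ a * f (fst x) (axis a 1) (axis i 1) (axis j 1)) = f (fst x) (snd x) (axis i 1) (axis j 1)"
      if "x \<in> S" for x
      using that alt by (subst (2) linear_sum_axis[OF alt3_linear1]) (auto simp: S_def)
  qed
  have g: "continuous_on S g"
    unfolding g_def qf_def Mf_def outer_def by (auto intro!: continuous_intros fc)
  obtain c C where cC: "c > 0" "C > 0" "\<And>x. x \<in> S \<Longrightarrow> c \<le> g x \<and> g x \<le> C"
  proof (cases "S = {}")
    case True
    then show ?thesis using that[of 1 1] by auto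
  next
    case False
    obtain x where x: "x \<in> S" "\<And>y. y \<in> S \<Longrightarrow> g x \<le> g y" using continuous_attains_inf[OF S False g] by blast
    obtain y where y: "y \<in> S" "\<And>z. z \<in> S \<Longrightarrow> g z \<le> g y" using continuous_attains_sup[OF S False g] by blast
    have "g x > 0"
      using x(1) alt nd qf_nonzero unfolding g_def S_def by (auto simp: norm_eq_1)
    then show ?thesis using that[of "g x" "g y"] x y by fastforce
  qed
  define Y where "Y = 1 / (c * (min 1 (1 / (fact 7 ^ 8 * C ^ 7))) ^ 4)"
  define R where "R = max (max 1 Y) (max 1 (C * (fact 7 * max 1 Y ^ 7) ^ 4))"
  show ?thesis
  proof (intro exI[of _ R] conjI ballI allI impI)
    show "R > 0" by (simp add: R_def)
  next
    fix p E w assume p: "p \<in> K" and E: "pb3 E (f p) = P3"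
    have inv: "invertible E" using pb3_P3_invertible alt p E by blast
    have b: "c * det E ^ 4 \<le> norm w ^ 8 \<and> norm w ^ 8 \<le> C * det E ^ 4" if "norm (E *v w) = 1" for w
    proof -
      have "norm w ^ 8 = (w \<bullet> w) ^ 4"
        unfolding power2_norm_eq_inner[symmetric] by (simp add: power_mult[symmetric])
      moreover have "g (p, E *v w) * det E ^ 4 = (w \<bullet> w) ^ 4"
        unfolding g_def using qf_frame[OF alt[OF p] E, of w] that by (simp add: norm_eq_1)
      moreover have "c \<le> g (p, E *v w) \<and> g (p, E *v w) \<le> C"
        using cC(3)[of "(p, E *v w)"] p that by (simp add: S_def)
      then have "c * det E ^ 4 \<le> g (p, E *v w) * det E ^ 4 \<and> g (p, E *v w) * det E ^ 4 \<le> C * det E ^ 4"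
        by (auto intro!: mult_right_mono)
      ultimately show ?thesis by simp
    qed
    show "norm (E *v w) \<le> R * norm w"
      by (rule order_trans[OF frame_bounds(1)[OF inv cC(1,2) b, of w]])
        (assumption, unfold R_def Y_def, rule mult_right_mono[OF max.cobounded1 norm_ge_zero])
    show "norm w \<le> R * norm (E *v w)"
      by (rule order_trans[OF frame_bounds(2)[OF inv cC(1,2) b, of w]])
        (assumption, unfold R_def Y_def, rule mult_right_mono[OF max.cobounded2 norm_ge_zero])
  qed
qed


section \<open>The orbit of the model 3-form is open\<close>

definition v7 :: "'a \<Rightarrow> 'a \<Rightarrow> 'a \<Rightarrow> 'a \<Rightarrow> 'a \<Rightarrow> 'a \<Rightarrow> 'a \<Rightarrow> 'a^7" where
  "v7 a b c d e f g = (\<chi> i. if i = 0 then a else if i = 1 then b else if i = 2 then c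
     else if i = 3 then d else if i = 4 then e else if i = 5 then f else g)"

lemma v7_nth [simp]:
  "v7 a b c d e f g $ 0 = a" "v7 a b c d e f g $ 1 = b" "v7 a b c d e f g $ 2 = c"
  "v7 a b c d e f g $ 3 = d" "v7 a b c d e f g $ 4 = e" "v7 a b c d e f g $ 5 = f" "v7 a b c d e f g $ 6 = g"
  by (simp_all add: v7_def)

text \<open>Moves the order of indices to \<open>nat\<close>, where case distinctions on three
  indices are arithmetic.\<close>

definition idx :: "7 \<Rightarrow> nat" where
  "idx i = (if i = 0 then 0 else if i = 1 then 1 else if i = 2 then 2
     else if i = 3 then 3 else if i = 4 then 4 else if i = 5 then 5 else 6)"

lemma idx_simps [simp]: "idx 0 = 0" "idx 1 = 1" "idx 2 = 2" "idx 3 = 3" "idx 4 = 4" "idx 5 = 5" "idx 6 = 6"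
  by (simp_all add: idx_def)

lemma inj_idx: "idx i = idx j \<longleftrightarrow> i = j"
  using exhaust_7[of i] exhaust_7[of j] by auto

abbreviation increasing :: "7 \<Rightarrow> 7 \<Rightarrow> 7 \<Rightarrow> bool" where
  "increasing i j k \<equiv> idx i < idx j \<and> idx j < idx k"

text \<open>The 35 entries with increasing indices determine an alternating form. Zeros elsewhere
  make the form a point of a Euclidean space of arrays, in which neighbourhoods can be
  taken.\<close>

definition upper :: "(real^7 \<Rightarrow> real^7 \<Rightarrow> real^7 \<Rightarrow> real) \<Rightarrow> real^7^7^7" where
  "upper f = (\<chi> i j k. if increasing i j k then f (axis i 1) (axis j 1) (axis k 1) else 0)"

text \<open>A right inverse of the derivative of \<open>E \<mapsto> pb3 E P3\<close> at the identity: contracting two indices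
  of \<open>P3\<close> and \<open>c\<close> gives a matrix \<open>C\<close>, and the matrix below is \<open>C / 6 + C\<^sup>T / 12 - trace C / 36\<close>.\<close>

definition dP3_inv :: "real^7^7^7 \<Rightarrow> real^7^7" where
  "dP3_inv c =
    (v7 (v7 (c$0$1$6 / 3 - c$0$2$5 / 3 - c$0$3$4 / 3 - c$1$2$3 / 6 - c$1$4$5 / 6 - c$2$4$6 / 6 + c$3$5$6 / 6)
      (c$0$2$3 / 6 + c$0$4$5 / 6 - c$1$2$5 / 3 - c$1$3$4 / 3) (- c$0$1$3 / 6 + c$0$4$6 / 6 - c$1$2$6 / 3 -
      c$2$3$4 / 3) (c$0$1$2 / 6 - c$0$5$6 / 6 - c$1$3$6 / 3 + c$2$3$5 / 3) (- c$0$1$5 / 6 - c$0$2$6 / 6 -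
      c$1$4$6 / 3 + c$2$4$5 / 3) (c$0$1$4 / 6 + c$0$3$6 / 6 - c$1$5$6 / 3 - c$3$4$5 / 3) (c$0$2$4 / 6 -
      c$0$3$5 / 6 - c$2$5$6 / 3 - c$3$4$6 / 3))
        (v7 (c$0$2$3 / 3 + c$0$4$5 / 3 - c$1$2$5 / 6 - c$1$3$4 / 6) (c$0$1$6 / 3 + c$0$2$5 / 6 + c$0$3$4 / 6 +
      c$1$2$3 / 3 + c$1$4$5 / 3 - c$2$4$6 / 6 + c$3$5$6 / 6) (- c$0$1$5 / 6 + c$0$2$6 / 3 + c$1$4$6 / 6 +
      c$2$4$5 / 3) (- c$0$1$4 / 6 + c$0$3$6 / 3 - c$1$5$6 / 6 + c$3$4$5 / 3) (c$0$1$3 / 6 + c$0$4$6 / 3 -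
      c$1$2$6 / 6 + c$2$3$4 / 3) (c$0$1$2 / 6 + c$0$5$6 / 3 + c$1$3$6 / 6 + c$2$3$5 / 3) (c$1$2$4 / 6 -
      c$1$3$5 / 6 + c$2$3$6 / 3 + c$4$5$6 / 3))
        (v7 (- c$0$1$3 / 3 + c$0$4$6 / 3 - c$1$2$6 / 6 - c$2$3$4 / 6) (- c$0$1$5 / 3 + c$0$2$6 / 6 + c$1$4$6 /
      3 + c$2$4$5 / 6) (- c$0$1$6 / 6 - c$0$2$5 / 3 + c$0$3$4 / 6 + c$1$2$3 / 3 - c$1$4$5 / 6 + c$2$4$6 / 3 +
      c$3$5$6 / 6) (- c$0$2$4 / 6 - c$0$3$5 / 3 - c$2$5$6 / 6 + c$3$4$6 / 3) (c$0$2$3 / 6 - c$0$4$5 / 3 +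
      c$1$2$5 / 6 - c$1$3$4 / 3) (- c$1$2$4 / 6 - c$1$3$5 / 3 + c$2$3$6 / 6 - c$4$5$6 / 3) (c$0$1$2 / 6 +
      c$0$5$6 / 3 - c$1$3$6 / 3 - c$2$3$5 / 6))
        (v7 (c$0$1$2 / 3 - c$0$5$6 / 3 - c$1$3$6 / 6 + c$2$3$5 / 6) (- c$0$1$4 / 3 + c$0$3$6 / 6 - c$1$5$6 / 3
      + c$3$4$5 / 6) (- c$0$2$4 / 3 - c$0$3$5 / 6 - c$2$5$6 / 3 + c$3$4$6 / 6) (- c$0$1$6 / 6 + c$0$2$5 / 6 -
      c$0$3$4 / 3 + c$1$2$3 / 3 - c$1$4$5 / 6 - c$2$4$6 / 6 - c$3$5$6 / 3) (c$1$2$4 / 3 + c$1$3$5 / 6 +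
      c$2$3$6 / 6 - c$4$5$6 / 3) (- c$0$2$3 / 6 + c$0$4$5 / 3 + c$1$2$5 / 3 - c$1$3$4 / 6) (c$0$1$3 / 6 +
      c$0$4$6 / 3 + c$1$2$6 / 3 - c$2$3$4 / 6))
        (v7 (- c$0$1$5 / 3 - c$0$2$6 / 3 - c$1$4$6 / 6 + c$2$4$5 / 6) (c$0$1$3 / 3 + c$0$4$6 / 6 - c$1$2$6 / 3
      + c$2$3$4 / 6) (c$0$2$3 / 3 - c$0$4$5 / 6 + c$1$2$5 / 3 - c$1$3$4 / 6) (c$1$2$4 / 6 + c$1$3$5 / 3 +
      c$2$3$6 / 3 - c$4$5$6 / 6) (- c$0$1$6 / 6 + c$0$2$5 / 6 - c$0$3$4 / 3 - c$1$2$3 / 6 + c$1$4$5 / 3 +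
      c$2$4$6 / 3 + c$3$5$6 / 6) (- c$0$2$4 / 6 - c$0$3$5 / 3 + c$2$5$6 / 3 - c$3$4$6 / 6) (c$0$1$4 / 6 -
      c$0$3$6 / 3 - c$1$5$6 / 3 + c$3$4$5 / 6))
        (v7 (c$0$1$4 / 3 + c$0$3$6 / 3 - c$1$5$6 / 6 - c$3$4$5 / 6) (c$0$1$2 / 3 + c$0$5$6 / 6 + c$1$3$6 / 3 +
      c$2$3$5 / 6) (- c$1$2$4 / 3 - c$1$3$5 / 6 + c$2$3$6 / 3 - c$4$5$6 / 6) (- c$0$2$3 / 3 + c$0$4$5 / 6 +
      c$1$2$5 / 6 - c$1$3$4 / 3) (- c$0$2$4 / 3 - c$0$3$5 / 6 + c$2$5$6 / 6 - c$3$4$6 / 3) (- c$0$1$6 / 6 -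
      c$0$2$5 / 3 + c$0$3$4 / 6 - c$1$2$3 / 6 + c$1$4$5 / 3 - c$2$4$6 / 6 - c$3$5$6 / 3) (c$0$1$5 / 6 -
      c$0$2$6 / 3 + c$1$4$6 / 3 + c$2$4$5 / 6))
        (v7 (c$0$2$4 / 3 - c$0$3$5 / 3 - c$2$5$6 / 6 - c$3$4$6 / 6) (c$1$2$4 / 3 - c$1$3$5 / 3 + c$2$3$6 / 6 +
      c$4$5$6 / 6) (c$0$1$2 / 3 + c$0$5$6 / 6 - c$1$3$6 / 6 - c$2$3$5 / 3) (c$0$1$3 / 3 + c$0$4$6 / 6 +
      c$1$2$6 / 6 - c$2$3$4 / 3) (c$0$1$4 / 3 - c$0$3$6 / 6 - c$1$5$6 / 6 + c$3$4$5 / 3) (c$0$1$5 / 3 -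
      c$0$2$6 / 6 + c$1$4$6 / 6 + c$2$4$5 / 3) (c$0$1$6 / 3 + c$0$2$5 / 6 + c$0$3$4 / 6 - c$1$2$3 / 6 -
      c$1$4$5 / 6 + c$2$4$6 / 3 - c$3$5$6 / 3)))"

lemma dP3_inv_nth:
  "dP3_inv c $ 0 $ 0 = c$0$1$6 / 3 - c$0$2$5 / 3 - c$0$3$4 / 3 - c$1$2$3 / 6 - c$1$4$5 / 6 - c$2$4$6 / 6 + c$3$5$6 / 6"
  "dP3_inv c $ 0 $ 1 = c$0$2$3 / 6 + c$0$4$5 / 6 - c$1$2$5 / 3 - c$1$3$4 / 3"
  "dP3_inv c $ 0 $ 2 = - c$0$1$3 / 6 + c$0$4$6 / 6 - c$1$2$6 / 3 - c$2$3$4 / 3"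
  "dP3_inv c $ 0 $ 3 = c$0$1$2 / 6 - c$0$5$6 / 6 - c$1$3$6 / 3 + c$2$3$5 / 3"
  "dP3_inv c $ 0 $ 4 = - c$0$1$5 / 6 - c$0$2$6 / 6 - c$1$4$6 / 3 + c$2$4$5 / 3"
  "dP3_inv c $ 0 $ 5 = c$0$1$4 / 6 + c$0$3$6 / 6 - c$1$5$6 / 3 - c$3$4$5 / 3"
  "dP3_inv c $ 0 $ 6 = c$0$2$4 / 6 - c$0$3$5 / 6 - c$2$5$6 / 3 - c$3$4$6 / 3"
  "dP3_inv c $ 1 $ 0 = c$0$2$3 / 3 + c$0$4$5 / 3 - c$1$2$5 / 6 - c$1$3$4 / 6"
  "dP3_inv c $ 1 $ 1 = c$0$1$6 / 3 + c$0$2$5 / 6 + c$0$3$4 / 6 + c$1$2$3 / 3 + c$1$4$5 / 3 - c$2$4$6 / 6 + c$3$5$6 / 6"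
  "dP3_inv c $ 1 $ 2 = - c$0$1$5 / 6 + c$0$2$6 / 3 + c$1$4$6 / 6 + c$2$4$5 / 3"
  "dP3_inv c $ 1 $ 3 = - c$0$1$4 / 6 + c$0$3$6 / 3 - c$1$5$6 / 6 + c$3$4$5 / 3"
  "dP3_inv c $ 1 $ 4 = c$0$1$3 / 6 + c$0$4$6 / 3 - c$1$2$6 / 6 + c$2$3$4 / 3"
  "dP3_inv c $ 1 $ 5 = c$0$1$2 / 6 + c$0$5$6 / 3 + c$1$3$6 / 6 + c$2$3$5 / 3"
  "dP3_inv c $ 1 $ 6 = c$1$2$4 / 6 - c$1$3$5 / 6 + c$2$3$6 / 3 + c$4$5$6 / 3"
  "dP3_inv c $ 2 $ 0 = - c$0$1$3 / 3 + c$0$4$6 / 3 - c$1$2$6 / 6 - c$2$3$4 / 6"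
  "dP3_inv c $ 2 $ 1 = - c$0$1$5 / 3 + c$0$2$6 / 6 + c$1$4$6 / 3 + c$2$4$5 / 6"
  "dP3_inv c $ 2 $ 2 = - c$0$1$6 / 6 - c$0$2$5 / 3 + c$0$3$4 / 6 + c$1$2$3 / 3 - c$1$4$5 / 6 + c$2$4$6 / 3 + c$3$5$6 / 6"
  "dP3_inv c $ 2 $ 3 = - c$0$2$4 / 6 - c$0$3$5 / 3 - c$2$5$6 / 6 + c$3$4$6 / 3"
  "dP3_inv c $ 2 $ 4 = c$0$2$3 / 6 - c$0$4$5 / 3 + c$1$2$5 / 6 - c$1$3$4 / 3"
  "dP3_inv c $ 2 $ 5 = - c$1$2$4 / 6 - c$1$3$5 / 3 + c$2$3$6 / 6 - c$4$5$6 / 3"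
  "dP3_inv c $ 2 $ 6 = c$0$1$2 / 6 + c$0$5$6 / 3 - c$1$3$6 / 3 - c$2$3$5 / 6"
  "dP3_inv c $ 3 $ 0 = c$0$1$2 / 3 - c$0$5$6 / 3 - c$1$3$6 / 6 + c$2$3$5 / 6"
  "dP3_inv c $ 3 $ 1 = - c$0$1$4 / 3 + c$0$3$6 / 6 - c$1$5$6 / 3 + c$3$4$5 / 6"
  "dP3_inv c $ 3 $ 2 = - c$0$2$4 / 3 - c$0$3$5 / 6 - c$2$5$6 / 3 + c$3$4$6 / 6"
  "dP3_inv c $ 3 $ 3 = - c$0$1$6 / 6 + c$0$2$5 / 6 - c$0$3$4 / 3 + c$1$2$3 / 3 - c$1$4$5 / 6 - c$2$4$6 / 6 - c$3$5$6 / 3"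
  "dP3_inv c $ 3 $ 4 = c$1$2$4 / 3 + c$1$3$5 / 6 + c$2$3$6 / 6 - c$4$5$6 / 3"
  "dP3_inv c $ 3 $ 5 = - c$0$2$3 / 6 + c$0$4$5 / 3 + c$1$2$5 / 3 - c$1$3$4 / 6"
  "dP3_inv c $ 3 $ 6 = c$0$1$3 / 6 + c$0$4$6 / 3 + c$1$2$6 / 3 - c$2$3$4 / 6"
  "dP3_inv c $ 4 $ 0 = - c$0$1$5 / 3 - c$0$2$6 / 3 - c$1$4$6 / 6 + c$2$4$5 / 6"
  "dP3_inv c $ 4 $ 1 = c$0$1$3 / 3 + c$0$4$6 / 6 - c$1$2$6 / 3 + c$2$3$4 / 6"
  "dP3_inv c $ 4 $ 2 = c$0$2$3 / 3 - c$0$4$5 / 6 + c$1$2$5 / 3 - c$1$3$4 / 6"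
  "dP3_inv c $ 4 $ 3 = c$1$2$4 / 6 + c$1$3$5 / 3 + c$2$3$6 / 3 - c$4$5$6 / 6"
  "dP3_inv c $ 4 $ 4 = - c$0$1$6 / 6 + c$0$2$5 / 6 - c$0$3$4 / 3 - c$1$2$3 / 6 + c$1$4$5 / 3 + c$2$4$6 / 3 + c$3$5$6 / 6"
  "dP3_inv c $ 4 $ 5 = - c$0$2$4 / 6 - c$0$3$5 / 3 + c$2$5$6 / 3 - c$3$4$6 / 6"
  "dP3_inv c $ 4 $ 6 = c$0$1$4 / 6 - c$0$3$6 / 3 - c$1$5$6 / 3 + c$3$4$5 / 6"
  "dP3_inv c $ 5 $ 0 = c$0$1$4 / 3 + c$0$3$6 / 3 - c$1$5$6 / 6 - c$3$4$5 / 6"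
  "dP3_inv c $ 5 $ 1 = c$0$1$2 / 3 + c$0$5$6 / 6 + c$1$3$6 / 3 + c$2$3$5 / 6"
  "dP3_inv c $ 5 $ 2 = - c$1$2$4 / 3 - c$1$3$5 / 6 + c$2$3$6 / 3 - c$4$5$6 / 6"
  "dP3_inv c $ 5 $ 3 = - c$0$2$3 / 3 + c$0$4$5 / 6 + c$1$2$5 / 6 - c$1$3$4 / 3"
  "dP3_inv c $ 5 $ 4 = - c$0$2$4 / 3 - c$0$3$5 / 6 + c$2$5$6 / 6 - c$3$4$6 / 3"
  "dP3_inv c $ 5 $ 5 = - c$0$1$6 / 6 - c$0$2$5 / 3 + c$0$3$4 / 6 - c$1$2$3 / 6 + c$1$4$5 / 3 - c$2$4$6 / 6 - c$3$5$6 / 3"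
  "dP3_inv c $ 5 $ 6 = c$0$1$5 / 6 - c$0$2$6 / 3 + c$1$4$6 / 3 + c$2$4$5 / 6"
  "dP3_inv c $ 6 $ 0 = c$0$2$4 / 3 - c$0$3$5 / 3 - c$2$5$6 / 6 - c$3$4$6 / 6"
  "dP3_inv c $ 6 $ 1 = c$1$2$4 / 3 - c$1$3$5 / 3 + c$2$3$6 / 6 + c$4$5$6 / 6"
  "dP3_inv c $ 6 $ 2 = c$0$1$2 / 3 + c$0$5$6 / 6 - c$1$3$6 / 6 - c$2$3$5 / 3"
  "dP3_inv c $ 6 $ 3 = c$0$1$3 / 3 + c$0$4$6 / 6 + c$1$2$6 / 6 - c$2$3$4 / 3"
  "dP3_inv c $ 6 $ 4 = c$0$1$4 / 3 - c$0$3$6 / 6 - c$1$5$6 / 6 + c$3$4$5 / 3"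
  "dP3_inv c $ 6 $ 5 = c$0$1$5 / 3 - c$0$2$6 / 6 + c$1$4$6 / 6 + c$2$4$5 / 3"
  "dP3_inv c $ 6 $ 6 = c$0$1$6 / 3 + c$0$2$5 / 6 + c$0$3$4 / 6 - c$1$2$3 / 6 - c$1$4$5 / 6 + c$2$4$6 / 3 - c$3$5$6 / 3"
  by (simp_all only: dP3_inv_def v7_nth)

definition dP3 :: "real^7^7 \<Rightarrow> real^7 \<Rightarrow> real^7 \<Rightarrow> real^7 \<Rightarrow> real" where
  "dP3 X u v w = P3 (X *v u) v w + P3 u (X *v v) w + P3 u v (X *v w)"

lemma matrix_axis: "((X :: real^'n^'m) *v axis j 1) $ i = X $ i $ j"
  by (simp add: matrix_vector_mul_component inner_axis row_def)

lemma increasing_7: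
  "(\<forall>i j k. increasing i j k \<longrightarrow> P i j k) \<longleftrightarrow>
    (P 0 1 2 \<and> P 0 1 3 \<and> P 0 1 4 \<and> P 0 1 5 \<and> P 0 1 6) \<and> (P 0 2 3 \<and> P 0 2 4 \<and> P 0 2 5 \<and> P 0 2 6) \<and>
    (P 0 3 4 \<and> P 0 3 5 \<and> P 0 3 6) \<and> (P 0 4 5 \<and> P 0 4 6 \<and> P 0 5 6) \<and>
    (P 1 2 3 \<and> P 1 2 4 \<and> P 1 2 5 \<and> P 1 2 6) \<and> (P 1 3 4 \<and> P 1 3 5 \<and> P 1 3 6) \<and> (P 1 4 5 \<and> P 1 4 6 \<and> P 1 5 6) \<and>
    (P 2 3 4 \<and> P 2 3 5 \<and> P 2 3 6) \<and> (P 2 4 5 \<and> P 2 4 6 \<and> P 2 5 6) \<and> (P 3 4 5 \<and> P 3 4 6 \<and> P 3 5 6 \<and> P 4 5 6)"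
  unfolding forall_7 by simp

lemma dP3_dP3_inv:
  assumes "increasing i j k"
  shows "dP3 (dP3_inv c) (axis i 1) (axis j 1) (axis k 1) = c $ i $ j $ k"
proof -
  have "\<forall>i j k. increasing i j k \<longrightarrow> dP3 (dP3_inv c) (axis i 1) (axis j 1) (axis k 1) = c $ i $ j $ k"
    unfolding increasing_7
    by (intro conjI; simp add: dP3_def P3_expand dx_3 matrix_axis; simp add: axis_def; simp add: dP3_inv_nth field_simps)
  then show ?thesis using assms by blast
qed

lemma linear_dP3_inv: "linear dP3_inv"
proof (rule linearI)
  show "dP3_inv (b + c) = dP3_inv b + dP3_inv c" for b c
    unfolding vec_eq_iff forall_7 by (intro conjI; simp only: vector_add_component vector_scaleR_component real_scaleR_def dP3_inv_nth; simp add: field_simps)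
  show "dP3_inv (r *\<^sub>R c) = r *\<^sub>R dP3_inv c" for r c
    unfolding vec_eq_iff forall_7 by (intro conjI; simp only: vector_add_component vector_scaleR_component real_scaleR_def dP3_inv_nth; simp add: field_simps)
qed

lemma alt3_eqI:
  fixes f g :: "real^7 \<Rightarrow> real^7 \<Rightarrow> real^7 \<Rightarrow> real"
  assumes f: "alt3 f" and g: "alt3 g" and eq: "upper f = upper g"
  shows "f = g"
proof -
  have up: "f (axis i 1) (axis j 1) (axis k 1) = g (axis i 1) (axis j 1) (axis k 1)" if "increasing i j k" for i j k
    using arg_cong[OF eq, of "\<lambda>c. c $ i $ j $ k"] that by (simp add: upper_def)
  have eq': "f (axis i 1) (axis j 1) (axis k 1) = g (axis i 1) (axis j 1) (axis k 1)" for i j k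
  proof -
    have "idx i = idx j \<or> idx j = idx k \<or> idx i = idx k \<or> increasing i j k \<or> increasing i k j \<or> increasing j i k
      \<or> increasing j k i \<or> increasing k i j \<or> increasing k j i"
      by arith
    then consider "i = j" | "j = k" | "i = k" | "increasing i j k" | "increasing i k j" | "increasing j i k"
      | "increasing j k i" | "increasing k i j" | "increasing k j i"
      unfolding inj_idx by blast
    then show ?thesis
    proof cases
      case 5
      then show ?thesis using up[OF 5] alt3_swap23[OF f, of "axis i 1" "axis k 1" "axis j 1"]
          alt3_swap23[OF g, of "axis i 1" "axis k 1" "axis j 1"] by linarith
    next
      case 6
      then show ?thesis using up[OF 6] alt3_swap12[OF f, of "axis i 1" "axis j 1" "axis k 1"]
          alt3_swap12[OF g, of "axis i 1" "axis j 1" "axis k 1"] by linarith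
    next
      case 7
      have "h (axis i 1) (axis j 1) (axis k 1) = h (axis j 1) (axis k 1) (axis i 1)" if "alt3 h" for h :: "real^7 \<Rightarrow> real^7 \<Rightarrow> real^7 \<Rightarrow> real"
        using alt3_swap12[OF that, of "axis i 1" "axis j 1" "axis k 1"] alt3_swap23[OF that, of "axis j 1" "axis k 1" "axis i 1"] by linarith
      then show ?thesis using up[OF 7] f g by metis
    next
      case 8
      have "h (axis i 1) (axis j 1) (axis k 1) = h (axis k 1) (axis i 1) (axis j 1)" if "alt3 h" for h :: "real^7 \<Rightarrow> real^7 \<Rightarrow> real^7 \<Rightarrow> real"
        using alt3_swap23[OF that, of "axis i 1" "axis j 1" "axis k 1"] alt3_swap12[OF that, of "axis i 1" "axis k 1" "axis j 1"] by linarith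
      then show ?thesis using up[OF 8] f g by metis
    next
      case 9
      then show ?thesis using up[OF 9] alt3_swap13[OF f, of "axis i 1" "axis j 1" "axis k 1"]
          alt3_swap13[OF g, of "axis i 1" "axis j 1" "axis k 1"] by linarith
    qed (simp_all add: alt3_simps(16,17)[OF f] alt3_simps(16,17)[OF g] alt3_self13[OF f] alt3_self13[OF g] up)
  qed
  show ?thesis
  proof (intro ext)
    show "f u v w = g u v w" for u v w
      unfolding alt3_expand[OF f, of u] alt3_expand[OF g, of u] eq' ..
  qed
qed

section \<open>The orbit map and its derivative\<close>

lemma bounded_bilinear_cross: "bounded_bilinear cross"
proof -
  have "bilinear cross"
    unfolding bilinear_def by (auto intro!: linearI simp: cross_simps)
  then show ?thesis by (simp add: bilinear_conv_bounded_bilinear)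
qed

lemma P3_has_derivative:
  assumes "(a has_derivative a') (at x)" "(b has_derivative b') (at x)" "(c has_derivative c') (at x)"
  shows "((\<lambda>x. P3 (a x) (b x) (c x)) has_derivative
    (\<lambda>h. P3 (a' h) (b x) (c x) + P3 (a x) (b' h) (c x) + P3 (a x) (b x) (c' h))) (at x)"
proof -
  have "((\<lambda>x. cross (a x) (b x) \<bullet> c x) has_derivative
    (\<lambda>h. cross (a x) (b x) \<bullet> c' h + (cross (a x) (b' h) + cross (a' h) (b x)) \<bullet> c x)) (at x)"
    by (intro has_derivative_inner bounded_bilinear.FDERIV[OF bounded_bilinear_cross] assms)
  then show ?thesis
    by (simp add: P3_cross inner_add_left add_ac)
qed

lemma has_derivative_vec_lambda:
  fixes f :: "'i::finite \<Rightarrow> 'a::real_normed_vector \<Rightarrow> 'b::euclidean_space"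
  assumes "\<And>i. ((\<lambda>x. f i x) has_derivative f' i) (at x)"
  shows "((\<lambda>x. \<chi> i. f i x) has_derivative (\<lambda>h. \<chi> i. f' i h)) (at x)"
proof (subst has_derivative_componentwise_within, rule ballI)
  fix b :: "'b^'i" assume "b \<in> Basis"
  then obtain i u where b: "b = axis i u" "u \<in> Basis" by (auto simp: Basis_vec_def)
  show "((\<lambda>x. (\<chi> i. f i x) \<bullet> b) has_derivative (\<lambda>h. (\<chi> i. f' i h) \<bullet> b)) (at x)"
    unfolding b inner_axis by (simp add: assms has_derivative_inner_left)
qed

text \<open>Adding the entries with non-increasing indices as free parameters makes the derivative of the
  orbit map surjective onto the whole space of three-index arrays.\<close>

lemma orbit_nhd:
  obtains U where "open U" "upper P3 \<in> U"
    "\<And>f. alt3 f \<Longrightarrow> upper f \<in> U \<Longrightarrow> \<exists>A. det A > 0 \<and> pb3 A P3 = f"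
proof -
  define F where "F = (\<lambda>(A :: real^7^7, t :: real^7^7^7). \<chi> i j k. if increasing i j k
     then P3 (A *v axis i 1) (A *v axis j 1) (A *v axis k 1) else t $ i $ j $ k)"
  define F' where "F' = (\<lambda>(X :: real^7^7, t :: real^7^7^7). \<chi> i j k. if increasing i j k
     then dP3 X (axis i 1) (axis j 1) (axis k 1) else t $ i $ j $ k)"
  define G where "G = (\<lambda>c. (dP3_inv c, c))"
  \<comment> \<open>Positivity of the determinant is an open condition that holds at the identity,
    so it can be imposed on the matrices produced by the open mapping theorem.\<close>
  define T where "T = {A :: real^7^7. det A > 0} \<times> (UNIV :: (real^7^7^7) set)"
  have lin: "((\<lambda>p. fst p *v v) has_derivative (\<lambda>h. fst h *v v)) (at p)" for v :: "real^7" and p :: "(real^7^7) \<times> (real^7^7^7)"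
  proof (rule bounded_linear_imp_has_derivative)
    show "bounded_linear (\<lambda>p :: (real^7^7) \<times> (real^7^7^7). fst p *v v)"
      by (intro linear_conv_bounded_linear[THEN iffD1] linearI)
        (simp_all add: matrix_vector_mult_add_rdistrib scaleR_matrix_vector_assoc)
  qed
  have derF: "(F has_derivative F') (at (mat 1, 0))"
  proof -
    have "((\<lambda>p. \<chi> i j k. if increasing i j k
        then P3 (fst p *v axis i 1) (fst p *v axis j 1) (fst p *v axis k 1) else snd p $ i $ j $ k) has_derivative
      (\<lambda>h. \<chi> i j k. if increasing i j k
        then dP3 (fst h) (axis i 1) (axis j 1) (axis k 1) else snd h $ i $ j $ k)) (at (mat 1, 0))"
    proof (intro has_derivative_vec_lambda)
      fix i j k :: 7
      show "((\<lambda>p. if increasing i j k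
        then P3 (fst p *v axis i 1) (fst p *v axis j 1) (fst p *v axis k 1) else snd p $ i $ j $ k) has_derivative
      (\<lambda>h. if increasing i j k
        then dP3 (fst h) (axis i 1) (axis j 1) (axis k 1) else snd h $ i $ j $ k)) (at (mat 1, 0))"
      proof (cases "increasing i j k")
        case True
        show ?thesis
          unfolding if_P[OF True]
          by (rule has_derivative_eq_rhs[OF P3_has_derivative[OF lin lin lin]]) (simp add: dP3_def)
      next
        case False
        have "bounded_linear (\<lambda>h :: (real^7^7) \<times> (real^7^7^7). snd h $ i $ j $ k)"
          by (intro linear_conv_bounded_linear[THEN iffD1] linearI) simp_all
        then show ?thesis
          unfolding if_not_P[OF False] by (rule bounded_linear_imp_has_derivative)
      qed
    qed
    then show ?thesis by (simp add: F_def F'_def case_prod_unfold)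
  qed
  have cl: "continuous_on UNIV (\<lambda>p :: (real^7^7) \<times> (real^7^7^7). fst p *v v)" for v :: "real^7"
    using lin by (rule has_derivative_continuous_on)
  have contF: "continuous_on UNIV F"
  proof -
    have "continuous_on UNIV (\<lambda>p :: (real^7^7) \<times> (real^7^7^7). if increasing i j k
      then P3 (fst p *v axis i 1) (fst p *v axis j 1) (fst p *v axis k 1) else snd p $ i $ j $ k)" for i j k
      by (cases "increasing i j k")
        (auto simp: P3_cross intro!: continuous_intros cl bounded_bilinear.continuous_on[OF bounded_bilinear_cross])
    then show ?thesis
      unfolding F_def case_prod_unfold by (intro continuous_on_vec_lambda)
  qed
  have "linear G"
    unfolding G_def using linear_add[OF linear_dP3_inv] linear_scale[OF linear_dP3_inv]
    by (intro linearI) simp_all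
  then have blG: "bounded_linear G" by (simp add: linear_conv_bounded_linear)
  have inv: "F' \<circ> G = id"
    by (rule ext) (auto simp: F'_def G_def vec_eq_iff dP3_dP3_inv)
  have "open T"
    unfolding T_def by (intro open_Times open_UNIV open_Collect_less continuous_intros)
  then have "(mat 1, 0) \<in> interior T" by (simp add: interior_open T_def)
  \<comment> \<open>This open mapping theorem asks for differentiability at one point and a bounded
    right inverse of the derivative there; \<open>G\<close> completes \<open>dP3_inv\<close> by the
    free entries.\<close>
  from sussmann_open_mapping[OF open_UNIV contF _ derF blG inv subset_UNIV this]
  have "F (mat 1, 0) \<in> interior (F ` T)" by simp
  moreover have "F (mat 1, 0) = upper P3"
    by (simp add: F_def upper_def vec_eq_iff)
  ultimately have in_U: "upper P3 \<in> interior (F ` T)" by simp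
  show ?thesis
  proof (rule that[OF open_interior in_U])
    fix f assume f: "alt3 f" and "upper f \<in> interior (F ` T)"
    then have "upper f \<in> F ` T" using interior_subset by blast
    then obtain A t where A: "upper f = F (A, t)" "det A > 0" by (auto simp: T_def)
    have "upper f $ i $ j $ k = upper (pb3 A P3) $ i $ j $ k" for i j k
    proof (cases "increasing i j k")
      case True
      then show ?thesis unfolding A(1) by (simp add: F_def upper_def pb3_def)
    next
      case False
      then show ?thesis by (simp only: upper_def vec_lambda_beta if_not_P if_False)
    qed
    then have "upper f = upper (pb3 A P3)" by (simp add: vec_eq_iff)
    then show "\<exists>A. det A > 0 \<and> pb3 A P3 = f"
      using alt3_eqI[OF f alt3_pb3[OF alt3_P3]] A(2) by metis
  qed
qed

section \<open>Compactness of adapted frames and the continuity argument\<close>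

lemma continuous_on_matrix_vector_mult [continuous_intros]:
  fixes A :: "'a::topological_space \<Rightarrow> real^'n^'m"
  assumes "continuous_on S A" "continuous_on S v"
  shows "continuous_on S (\<lambda>x. A x *v v x)"
  unfolding matrix_vector_mult_def using assms by (intro continuous_intros)

lemma pb3_mult: "pb3 (A ** B) f = pb3 B (pb3 A f)"
  by (simp add: pb3_def fun_eq_iff matrix_vector_mul_assoc)

lemma pb3_id: "pb3 (mat 1) f = f"
  by (simp add: pb3_def fun_eq_iff)

lemma norm_matrix_le:
  fixes E :: "real^'n^'m"
  assumes "\<And>i j. \<bar>E $ i $ j\<bar> \<le> R"
  shows "norm E \<le> real CARD('m) * (real CARD('n) * R)"
proof -
  have "norm (E $ i) \<le> real CARD('n) * R" for i
  proof -
    have "norm (E $ i) \<le> (\<Sum>j\<in>UNIV. \<bar>E $ i $ j\<bar>)" by (rule norm_le_l1_cart)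
    also have "\<dots> \<le> (\<Sum>j\<in>(UNIV :: 'n set). R :: real)" by (rule sum_mono) (rule assms)
    finally show ?thesis by simp
  qed
  then have "(\<Sum>i\<in>UNIV. norm (E $ i)) \<le> (\<Sum>i\<in>(UNIV :: 'm set). real CARD('n) * R)" by (intro sum_mono)
  moreover have "norm E \<le> (\<Sum>i\<in>UNIV. norm (E $ i))"
    unfolding norm_vec_def by (rule L2_set_le_sum) simp
  ultimately show ?thesis by simp
qed

lemma compact_Collect_eq:
  fixes g :: "'i \<Rightarrow> 'a::metric_space \<Rightarrow> real"
  assumes "compact Z" "\<And>i. continuous_on Z (g i)"
  shows "compact {x \<in> Z. \<forall>i. g i x = c i}"
proof -
  have "closedin (top_of_set Z) {x \<in> Z. g i x = c i}" for i
    using assms(2) by (rule continuous_closedin_preimage_constant)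
  then have "compact {x \<in> Z. g i x = c i}" for i
    using assms(1) closedin_compact by blast
  then have "closed (\<Inter>i. {x \<in> Z. g i x = c i})"
    by (intro closed_INT ballI compact_imp_closed)
  with assms(1) have "compact (Z \<inter> (\<Inter>i. {x \<in> Z. g i x = c i}))"
    by (rule compact_Int_closed)
  also have "Z \<inter> (\<Inter>i. {x \<in> Z. g i x = c i}) = {x \<in> Z. \<forall>i. g i x = c i}" by auto
  finally show ?thesis .
qed

text \<open>Boundedness is \<open>frames_bounded\<close>, and closedness holds because being adapted
  is a system of polynomial equations in the entries of \<open>E\<close> with coefficients
  continuous in \<open>p\<close>.\<close>

lemma compact_frames:
  fixes f :: "'p::heine_borel \<Rightarrow> real^7 \<Rightarrow> real^7 \<Rightarrow> real^7 \<Rightarrow> real"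
  assumes K: "compact K" and alt: "\<And>p. p \<in> K \<Longrightarrow> alt3 (f p)" and nd: "\<And>p. p \<in> K \<Longrightarrow> nondeg3 (f p)"
    and cont: "\<And>i j k. continuous_on K (\<lambda>p. f p (axis i 1) (axis j 1) (axis k 1))"
  shows "compact {(p, E). p \<in> K \<and> pb3 E (f p) = P3}"
proof -
  obtain R where R: "R > 0"
    "\<And>p E w. p \<in> K \<Longrightarrow> pb3 E (f p) = P3 \<Longrightarrow> norm (E *v w) \<le> R * norm w"
    using frames_bounded[OF K alt nd cont] by blast
  define B where "B = 7 * (7 * R)"
  have B: "norm E \<le> B" if "p \<in> K" "pb3 E (f p) = P3" for p E
  proof -
    have "\<bar>E $ i $ j\<bar> \<le> R" for i j
      using R(2)[OF that, of "axis j 1"] component_le_norm_cart[of "E *v axis j 1" i]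
      by (simp add: matrix_axis norm_axis_1)
    then show ?thesis using norm_matrix_le[of E R] by (simp add: B_def)
  qed
  \<comment> \<open>Expanding in components reduces continuity in \<open>p\<close> to the hypothesis
    about basis vectors.\<close>
  define g where "g = (\<lambda>(i, j, k) (p, E :: real^7^7). \<Sum>a\<in>UNIV. \<Sum>b\<in>UNIV. \<Sum>c\<in>UNIV.
      (E *v axis i 1) $ a * ((E *v axis j 1) $ b * ((E *v axis k 1) $ c * f p (axis a 1) (axis b 1) (axis c 1))))"
  define S where "S = (\<lambda>(i, j, k). P3 (axis i 1) (axis j 1) (axis k 1))"
  define Z where "Z = K \<times> cball (0 :: real^7^7) B"
  have "compact {x \<in> Z. \<forall>i. g i x = S i}"
  proof (rule compact_Collect_eq)
    show "compact Z" by (simp add: Z_def K compact_Times)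
    have c: "continuous_on Z (\<lambda>x. f (fst x) (axis a 1) (axis b 1) (axis c 1))" for a b c
      by (rule continuous_on_compose2[OF cont continuous_on_fst[OF continuous_on_id]]) (auto simp: Z_def)
    show "continuous_on Z (g i)" for i
      unfolding g_def case_prod_unfold by (intro continuous_intros c)
  qed
  also have "{x \<in> Z. \<forall>i. g i x = S i} = {(p, E). p \<in> K \<and> pb3 E (f p) = P3}"
  proof -
    have g: "g (i, j, k) (p, E) = pb3 E (f p) (axis i 1) (axis j 1) (axis k 1)" if "p \<in> K" for i j k p E
      unfolding g_def pb3_def case_prod_conv by (rule alt3_expand[OF alt[OF that], symmetric])
    have eq: "pb3 E (f p) = P3 \<longleftrightarrow> (\<forall>i. g i (p, E) = S i)" if p: "p \<in> K" for p E
    proof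
      assume *: "\<forall>i. g i (p, E) = S i"
      have e: "pb3 E (f p) (axis i 1) (axis j 1) (axis k 1) = P3 (axis i 1) (axis j 1) (axis k 1)" for i j k
        using *[rule_format, of "(i, j, k)"] by (simp add: g[OF p] S_def)
      show "pb3 E (f p) = P3"
        by (rule alt3_eqI[OF alt3_pb3[OF alt[OF p]] alt3_P3]) (simp only: upper_def e)
    qed (auto simp: g[OF p] S_def)
    show ?thesis using B eq by (auto simp: Z_def)
  qed
  finally show ?thesis .
qed

theorem tame3_frame:
  assumes f: "alt3 f" "tame3 f"
  shows "\<exists>E. det E > 0 \<and> pb3 E f = P3"
proof -
  define h where "h = (\<lambda>s :: real. \<lambda>u v w. (1 - s) * P3 u v w + s * f u v w)"
  define S where "S = {s \<in> {0..1}. \<exists>E. det E > 0 \<and> pb3 E (h s) = P3}"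
  have alt: "alt3 (h s)" for s
    unfolding h_def by (rule alt3_lin[OF alt3_P3 f(1)])
  have tame: "tame3 (h s)" if "s \<in> {0..1}" for s
    unfolding h_def using that by (intro tame3_lin[OF tame3_P3 f(2)]) auto
  have "compact {(s, E). s \<in> {0..1} \<and> pb3 E (h s) = P3}"
  proof (rule compact_frames)
    show "nondeg3 (h s)" if "s \<in> {0..1}" for s
      using alt tame[OF that] by (rule tame3_nondeg3)
    show "continuous_on {0..1} (\<lambda>s. h s (axis i 1) (axis j 1) (axis k 1))" for i j k
      unfolding h_def by (intro continuous_intros)
  qed (auto simp: alt)
  \<comment> \<open>The weak inequality keeps the set closed; it agrees with the strict one because
    adapted frames are invertible.\<close>
  moreover have "closed {x :: real \<times> (real^7^7). 0 \<le> det (snd x)}"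
    by (intro closed_Collect_le continuous_intros)
  ultimately have "compact ({(s, E). s \<in> {0..1} \<and> pb3 E (h s) = P3} \<inter> {x. 0 \<le> det (snd x)})"
    by (rule compact_Int_closed)
  then have "compact (fst ` ({(s, E). s \<in> {0..1} \<and> pb3 E (h s) = P3} \<inter> {x. 0 \<le> det (snd x)}))"
    by (intro compact_continuous_image continuous_intros)
  also have "fst ` ({(s, E). s \<in> {0..1} \<and> pb3 E (h s) = P3} \<inter> {x. 0 \<le> det (snd x)}) = S"
  proof -
    have "det E > 0" if "pb3 E (h s) = P3" "det E \<ge> 0" for s E
      using pb3_P3_invertible[OF alt that(1)] that(2) by (simp add: invertible_det_nz)
    then have "(\<exists>E. pb3 E (h s) = P3 \<and> det E \<ge> 0) \<longleftrightarrow> (\<exists>E. det E > 0 \<and> pb3 E (h s) = P3)" for s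
      by (meson less_imp_le)
    moreover have "fst ` ({(s, E). s \<in> {0..1} \<and> pb3 E (h s) = P3} \<inter> {x. 0 \<le> det (snd x)})
        = {s \<in> {0..1}. \<exists>E. pb3 E (h s) = P3 \<and> det E \<ge> 0}"
      by (force simp del: atLeastAtMost_iff)
    ultimately show ?thesis by (simp add: S_def)
  qed
  finally have "closed S" by (rule compact_imp_closed)
  then have cl: "closedin (top_of_set {0..1}) S"
    by (intro closed_subset) (auto simp: S_def)
  obtain U where U: "open U" "upper P3 \<in> U"
    "\<And>f. alt3 f \<Longrightarrow> upper f \<in> U \<Longrightarrow> \<exists>A. det A > 0 \<and> pb3 A P3 = f"
    using orbit_nhd by metis
  have op: "openin (top_of_set {0..1}) S"
  proof (subst openin_subopen, rule ballI)
    fix s assume s: "s \<in> S"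
    then obtain E where E: "det E > 0" "pb3 E (h s) = P3" by (auto simp: S_def)
    \<comment> \<open>In a frame \<open>E\<close> adapted at \<open>s\<close> the form
      \<open>h s\<close> is the model, so nearby \<open>h t\<close> fall into the neighbourhood of
      \<open>orbit_nhd\<close>. Correcting \<open>E\<close> by the inverse of the matrix obtained
      there gives a frame adapted to \<open>h t\<close>.\<close>
    define T where "T = {t \<in> {0..1}. upper (pb3 E (h t)) \<in> U}"
    have "continuous_on {0..1} (\<lambda>t. upper (pb3 E (h t)))"
    proof -
      have "continuous_on {0..1} (\<lambda>t. if increasing i j k
          then pb3 E (h t) (axis i 1) (axis j 1) (axis k 1) else 0)" for i j k
        by (cases "increasing i j k") (auto simp: pb3_def h_def intro!: continuous_intros)
      then show ?thesis unfolding upper_def by (intro continuous_on_vec_lambda)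
    qed
    then have "openin (top_of_set {0..1}) ({0..1} \<inter> (\<lambda>t. upper (pb3 E (h t))) -` U)"
      using U(1) by (rule continuous_openin_preimage_gen)
    also have "{0..1} \<inter> (\<lambda>t. upper (pb3 E (h t))) -` U = T" by (auto simp: T_def)
    finally have "openin (top_of_set {0..1}) T" .
    moreover have "s \<in> T" using s U(2) E by (simp add: T_def S_def)
    moreover have "T \<subseteq> S"
    proof
      fix t assume t: "t \<in> T"
      then obtain A where A: "det A > 0" "pb3 A P3 = pb3 E (h t)"
        using U(3)[OF alt3_pb3[OF alt]] by (auto simp: T_def)
      then obtain B where B: "A ** B = mat 1"
        by (metis invertible_det_nz invertible_def less_irrefl)
      have "pb3 (E ** B) (h t) = pb3 B (pb3 A P3)" by (simp only: pb3_mult A(2))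
      also have "\<dots> = P3" by (simp only: pb3_mult[symmetric] B pb3_id)
      finally have "pb3 (E ** B) (h t) = P3" .
      moreover have "det A * det B = 1" by (metis B det_I det_mul)
      then have "det B > 0" using A(1) by (metis zero_less_mult_pos zero_less_one)
      then have "det (E ** B) > 0" using E(1) by (simp add: det_mul)
      ultimately show "t \<in> S" using t by (auto simp: T_def S_def)
    qed
    ultimately show "\<exists>T. openin (top_of_set {0..1}) T \<and> s \<in> T \<and> T \<subseteq> S" by blast
  qed
  have "0 \<in> S"
    unfolding S_def h_def using pb3_id[of P3] by (auto intro!: exI[of _ "mat 1"])
  moreover have "S = {} \<or> S = {0..1}"
    using connected_Icc[of 0 "1::real"] cl op unfolding connected_clopen by blast
  ultimately have "1 \<in> S" by auto
  then show ?thesis by (simp add: S_def h_def)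
qed


section \<open>The Hodge star of 4-forms\<close>

definition alt4 :: "('v::real_vector \<Rightarrow> 'v \<Rightarrow> 'v \<Rightarrow> 'v \<Rightarrow> real) \<Rightarrow> bool" where
  "alt4 f \<longleftrightarrow> (\<forall>v w z. linear (\<lambda>u. f u v w z)) \<and> (\<forall>u w z. linear (\<lambda>v. f u v w z))
     \<and> (\<forall>u v z. linear (\<lambda>w. f u v w z)) \<and> (\<forall>u v w. linear (f u v w))
     \<and> (\<forall>u v w. f u u v w = 0) \<and> (\<forall>u v w. f u v v w = 0) \<and> (\<forall>u v w. f u v w w = 0)"

lemma alt4D:
  assumes "alt4 f"
  shows "linear (\<lambda>u. f u v w z)" "linear (\<lambda>v. f u v w z)" "linear (\<lambda>w. f u v w z)" "linear (f u v w)"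
    "f u u v w = 0" "f u v v w = 0" "f u v w w = 0"
  using assms unfolding alt4_def by auto

lemma alt4_simps:
  assumes "alt4 f"
  shows "f (u + u') v w z = f u v w z + f u' v w z" "f u (v + v') w z = f u v w z + f u v' w z"
    "f u v (w + w') z = f u v w z + f u v w' z" "f u v w (z + z') = f u v w z + f u v w z'"
    "f (c *\<^sub>R u) v w z = c * f u v w z" "f u (c *\<^sub>R v) w z = c * f u v w z"
    "f u v (c *\<^sub>R w) z = c * f u v w z" "f u v w (c *\<^sub>R z) = c * f u v w z"
  using linear_add[OF alt4D(1)[OF assms]] linear_add[OF alt4D(2)[OF assms]] linear_add[OF alt4D(3)[OF assms]]
    linear_add[OF alt4D(4)[OF assms]]
    linear_scale[OF alt4D(1)[OF assms]] linear_scale[OF alt4D(2)[OF assms]] linear_scale[OF alt4D(3)[OF assms]]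
    linear_scale[OF alt4D(4)[OF assms]]
  by auto

lemma alt4_swap:
  assumes "alt4 f"
  shows "f v u w z = - f u v w z" "f u w v z = - f u v w z" "f u v z w = - f u v w z"
proof -
  have "f u v w z + f v u w z = 0"
    using alt4D(5)[OF assms, of "u + v" w z]
    unfolding alt4_simps(1)[OF assms] alt4_simps(2)[OF assms] by (simp add: alt4D(5)[OF assms])
  then show "f v u w z = - f u v w z" by linarith
  have "f u v w z + f u w v z = 0"
    using alt4D(6)[OF assms, of u "v + w" z]
    unfolding alt4_simps(2)[OF assms] alt4_simps(3)[OF assms] by (simp add: alt4D(6)[OF assms])
  then show "f u w v z = - f u v w z" by linarith
  have "f u v w z + f u v z w = 0"
    using alt4D(7)[OF assms, of u v "w + z"]
    unfolding alt4_simps(3)[OF assms] alt4_simps(4)[OF assms] by (simp add: alt4D(7)[OF assms])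
  then show "f u v z w = - f u v w z" by linarith
qed

lemma alt4_self:
  assumes "alt4 f"
  shows "f u u v w = 0" "f u v v w = 0" "f u v w w = 0" "f u v u w = 0" "f u v w u = 0" "f v u w u = 0"
proof -
  note sw = alt4_swap[OF assms]
  show 0: "f u u v w = 0" "f u v v w = 0" "f u v w w = 0" for u v w using alt4D[OF assms] by auto
  show 1: "f u v u w = 0" for u v w using sw(1)[of u v u w] 0 by simp
  show "f v u w u = 0" for v u w using sw(3)[of v u w u] 0 by simp
  show "f u v w u = 0" using sw(3)[of u v w u] 1 by simp
qed

lemma alt4_expand:
  fixes f :: "real^'n \<Rightarrow> real^'n \<Rightarrow> real^'n \<Rightarrow> real^'n \<Rightarrow> real"
  assumes "alt4 f"
  shows "f u v w z = (\<Sum>i\<in>UNIV. \<Sum>j\<in>UNIV. \<Sum>k\<in>UNIV. \<Sum>l\<in>UNIV.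
    u$i * (v$j * (w$k * (z$l * f (axis i 1) (axis j 1) (axis k 1) (axis l 1)))))"
  apply (subst linear_sum_axis[OF alt4D(1)[OF assms]])
  apply (subst linear_sum_axis[OF alt4D(2)[OF assms]])
  apply (subst linear_sum_axis[OF alt4D(3)[OF assms]])
  apply (subst linear_sum_axis[OF alt4D(4)[OF assms]])
  by (simp add: sum_distrib_left)

definition pb4 :: "real^7^7 \<Rightarrow> (real^7 \<Rightarrow> real^7 \<Rightarrow> real^7 \<Rightarrow> real^7 \<Rightarrow> 'c) \<Rightarrow> real^7 \<Rightarrow> real^7 \<Rightarrow> real^7 \<Rightarrow> real^7 \<Rightarrow> 'c" where
  "pb4 E f u v w z = f (E *v u) (E *v v) (E *v w) (E *v z)"

lemma alt4_pb4:
  assumes "alt4 f" shows "alt4 (pb4 E f)"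
  unfolding alt4_def pb4_def
  by (auto simp: alt4_simps[OF assms] alt4_self[OF assms] matrix_vector_right_distrib matrix_vector_mult_scaleR
      intro!: linearI)

text \<open>By \<open>S4_cross\<close> the repeated arguments lead to double cross products, which
  \<open>cross_cross\<close> evaluates.\<close>

lemma alt4_S4: "alt4 S4"
proof -
  have 1: "P3 u (cross u w) z = (u \<bullet> w) * (u \<bullet> z) - (u \<bullet> u) * (w \<bullet> z)" for u w z
    by (simp add: P3_cross cross_cross inner_diff_left)
  have 2: "P3 u (cross v w) w = (u \<bullet> w) * (v \<bullet> w) - (u \<bullet> v) * (w \<bullet> w)" for u v w
  proof -
    have "P3 u (cross v w) w = cross (cross v w) w \<bullet> u" by (simp add: cross_inner P3_rot)
    also have "cross (cross v w) w = - cross w (cross v w)" by (rule cross_swap)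
    finally show ?thesis by (simp add: cross_cross' inner_diff_right inner_commute)
  qed
  show ?thesis
    unfolding alt4_def S4_cross
    by (auto simp: 1 2 P3_simps cross_simps inner_add_left inner_add_right inner_commute algebra_simps intro!: linearI)
qed

section \<open>The determinant as a function of seven rows\<close>

definition det7 :: "real^7 \<Rightarrow> real^7 \<Rightarrow> real^7 \<Rightarrow> real^7 \<Rightarrow> real^7 \<Rightarrow> real^7 \<Rightarrow> real^7 \<Rightarrow> real" where
  "det7 a b c d e f g = det (v7 a b c d e f g)"

lemma linear_det_row:
  fixes r :: "'n::finite \<Rightarrow> real^'n"
  shows "linear (\<lambda>x. det (\<chi> i. if i = k then x else r i))"
proof (rule linearI)
  show "det (\<chi> i. if i = k then x + y else r i) =
    det (\<chi> i. if i = k then x else r i) + det (\<chi> i. if i = k then y else r i)" for x y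
    by (rule det_row_add[of k "\<lambda>_. x" "\<lambda>_. y" r])
  show "det (\<chi> i. if i = k then s *\<^sub>R x else r i) = s *\<^sub>R det (\<chi> i. if i = k then x else r i)" for s x
    using det_row_mul[of k s "\<lambda>_. x" r] unfolding scalar_mult_eq_scaleR by simp
qed

lemma v7_row:
  "v7 x b c d e f g = (\<chi> i. if i = 0 then x else v7 0 b c d e f g $ i)"
  "v7 a x c d e f g = (\<chi> i. if i = 1 then x else v7 a 0 c d e f g $ i)"
  "v7 a b x d e f g = (\<chi> i. if i = 2 then x else v7 a b 0 d e f g $ i)"
  "v7 a b c x e f g = (\<chi> i. if i = 3 then x else v7 a b c 0 e f g $ i)"
  "v7 a b c d x f g = (\<chi> i. if i = 4 then x else v7 a b c d 0 f g $ i)"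
  "v7 a b c d e x g = (\<chi> i. if i = 5 then x else v7 a b c d e 0 g $ i)"
  "v7 a b c d e f x = (\<chi> i. if i = 6 then x else v7 a b c d e f 0 $ i)"
  unfolding vec_eq_iff[where 'b = 7] forall_7 by simp_all

lemma linear_det7:
  "linear (\<lambda>x. det7 x b c d e f g)" "linear (\<lambda>x. det7 a x c d e f g)" "linear (\<lambda>x. det7 a b x d e f g)"
  "linear (\<lambda>x. det7 a b c x e f g)" "linear (\<lambda>x. det7 a b c d x f g)" "linear (\<lambda>x. det7 a b c d e x g)"
  "linear (\<lambda>x. det7 a b c d e f x)"
  unfolding det7_def
  by (subst v7_row(1), rule linear_det_row, subst v7_row(2), rule linear_det_row, subst v7_row(3), rule linear_det_row,
      subst v7_row(4), rule linear_det_row, subst v7_row(5), rule linear_det_row, subst v7_row(6), rule linear_det_row,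
      subst v7_row(7), rule linear_det_row)

lemma det7_self:
  "det7 x x c d e f g = 0" "det7 x b x d e f g = 0" "det7 x b c x e f g = 0" "det7 x b c d x f g = 0"
  "det7 x b c d e x g = 0" "det7 x b c d e f x = 0" "det7 a x x d e f g = 0" "det7 a x c x e f g = 0"
  "det7 a x c d x f g = 0" "det7 a x c d e x g = 0" "det7 a x c d e f x = 0" "det7 a b x x e f g = 0"
  "det7 a b x d x f g = 0" "det7 a b x d e x g = 0" "det7 a b x d e f x = 0" "det7 a b c x x f g = 0"
  "det7 a b c x e x g = 0" "det7 a b c x e f x = 0" "det7 a b c d x x g = 0" "det7 a b c d x f x = 0"
  "det7 a b c d e x x = 0"
  unfolding det7_def
  by (rule det_identical_rows[of 0 1] det_identical_rows[of 0 2] det_identical_rows[of 0 3] det_identical_rows[of 0 4]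
      det_identical_rows[of 0 5] det_identical_rows[of 0 6] det_identical_rows[of 1 2] det_identical_rows[of 1 3]
      det_identical_rows[of 1 4] det_identical_rows[of 1 5] det_identical_rows[of 1 6] det_identical_rows[of 2 3]
      det_identical_rows[of 2 4] det_identical_rows[of 2 5] det_identical_rows[of 2 6] det_identical_rows[of 3 4]
      det_identical_rows[of 3 5] det_identical_rows[of 3 6] det_identical_rows[of 4 5] det_identical_rows[of 4 6]
      det_identical_rows[of 5 6]; simp add: row_def; fail)+

lemma swap_from_alt:
  fixes f :: "'v::real_vector \<Rightarrow> 'v \<Rightarrow> real"
  assumes "\<And>y. linear (\<lambda>x. f x y)" "\<And>x. linear (f x)" "\<And>x. f x x = 0"
  shows "f y x = - f x y"
proof -
  have "f (x + y) (x + y) = f x x + f y x + (f x y + f y y)"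
    by (simp add: linear_add[OF assms(1)] linear_add[OF assms(2)])
  then show ?thesis by (simp add: assms(3))
qed

lemma det7_swap:
  "det7 b a c d e f g = - det7 a b c d e f g" "det7 a c b d e f g = - det7 a b c d e f g"
  "det7 a b d c e f g = - det7 a b c d e f g" "det7 a b c e d f g = - det7 a b c d e f g"
  "det7 a b c d f e g = - det7 a b c d e f g" "det7 a b c d e g f = - det7 a b c d e f g"
  by (rule swap_from_alt[where f = "\<lambda>x y. det7 x y c d e f g"] swap_from_alt[where f = "\<lambda>x y. det7 a x y d e f g"]
      swap_from_alt[where f = "\<lambda>x y. det7 a b x y e f g"] swap_from_alt[where f = "\<lambda>x y. det7 a b c x y f g"]
      swap_from_alt[where f = "\<lambda>x y. det7 a b c d x y g"] swap_from_alt[where f = "\<lambda>x y. det7 a b c d e x y"];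
      simp add: linear_det7 det7_self; fail)+

lemma det7_matrix: "det7 (E *v a) (E *v b) (E *v c) (E *v d) (E *v e) (E *v f) (E *v g) = det E * det7 a b c d e f g"
proof -
  have "v7 (E *v a) (E *v b) (E *v c) (E *v d) (E *v e) (E *v f) (E *v g) = v7 a b c d e f g ** transpose E"
    unfolding vec_eq_iff[where 'b = 7] forall_7
    by (simp add: matrix_matrix_mult_def matrix_vector_mult_def transpose_def vec_eq_iff mult.commute)
  then show ?thesis by (simp add: det7_def det_mul)
qed

text \<open>In a trace over the orthonormal basis a matrix acting on one factor moves to the other
  as its transpose. The longer contractions below repeat this once for each index.\<close>

lemma sum_adjoint:
  fixes B :: "real^'n \<Rightarrow> real^'n \<Rightarrow> real"
  assumes "\<And>y. linear (\<lambda>x. B x y)" "\<And>x. linear (B x)"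
  shows "(\<Sum>i\<in>UNIV. B (E *v axis i 1) (axis i 1)) = (\<Sum>i\<in>UNIV. B (axis i 1) (transpose E *v axis i 1))"
proof -
  have "(\<Sum>i\<in>UNIV. B (E *v axis i 1) (axis i 1)) = (\<Sum>i\<in>UNIV. \<Sum>j\<in>UNIV. E $ j $ i * B (axis j 1) (axis i 1))"
    by (subst linear_sum_axis[OF assms(1)]) (simp add: matrix_axis)
  also have "\<dots> = (\<Sum>j\<in>UNIV. \<Sum>i\<in>UNIV. E $ j $ i * B (axis j 1) (axis i 1))" by (rule sum.swap)
  also have "\<dots> = (\<Sum>j\<in>UNIV. B (axis j 1) (transpose E *v axis j 1))"
    by (subst (2) linear_sum_axis[OF assms(2)]) (simp only: matrix_axis transpose_def vec_lambda_beta)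
  finally show ?thesis .
qed

text \<open>Since the sum is over all ordered quadruples, this is 24 times the Hodge star.\<close>

definition star :: "(real^7 \<Rightarrow> real^7 \<Rightarrow> real^7 \<Rightarrow> real^7 \<Rightarrow> real) \<Rightarrow> real^7 \<Rightarrow> real^7 \<Rightarrow> real^7 \<Rightarrow> real" where
  "star f a b c = (\<Sum>i\<in>UNIV. \<Sum>j\<in>UNIV. \<Sum>k\<in>UNIV. \<Sum>l\<in>UNIV. f (axis i 1) (axis j 1) (axis k 1) (axis l 1) *
     det7 (axis i 1) (axis j 1) (axis k 1) (axis l 1) a b c)"

lemmas det7_simps =
  linear_det7[THEN linear_add] linear_det7[THEN linear_scale, simplified]

lemma alt3_star: "alt3 (star f)"
  unfolding alt3_def star_def
  by (auto simp: det7_simps det7_self sum.distrib sum_distrib_left algebra_simps intro!: linearI)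

lemma star_lin: "star (\<lambda>u v w z. s * f u v w z + t * g u v w z) a b c = s * star f a b c + t * star g a b c"
  unfolding star_def by (simp add: sum.distrib sum_distrib_left algebra_simps)

text \<open>Besides giving equivariance, this shows the star of a pulled-back form to be linear in
  the components of \<open>f\<close>, with coefficients polynomial in \<open>E\<close>; the
  stability of taming uses it in this form.\<close>

lemma star_pb4_sum:
  assumes f: "alt4 f"
  shows "star (pb4 E f) a b c = (\<Sum>i\<in>UNIV. \<Sum>j\<in>UNIV. \<Sum>k\<in>UNIV. \<Sum>l\<in>UNIV. f (axis i 1) (axis j 1) (axis k 1) (axis l 1) *
    det7 (transpose E *v axis i 1) (transpose E *v axis j 1) (transpose E *v axis k 1) (transpose E *v axis l 1) a b c)"
proof -
  let ?e = "\<lambda>i. axis i (1::real) :: real^7"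
  let ?T = "\<lambda>x. transpose E *v x"
  define D where "D x y z w = det7 x y z w a b c" for x y z w
  have lD: "linear (\<lambda>x. D x y z w)" "linear (\<lambda>x. D y x z w)" "linear (\<lambda>x. D y z x w)" "linear (\<lambda>x. D y z w x)"
    for y z w unfolding D_def by (rule linear_det7)+
  note lf = alt4D(1-4)[OF f]
  have "star (pb4 E f) a b c =
    (\<Sum>i\<in>UNIV. \<Sum>j\<in>UNIV. \<Sum>k\<in>UNIV. \<Sum>l\<in>UNIV. f (E *v ?e i) (E *v ?e j) (E *v ?e k) (E *v ?e l) * D (?e i) (?e j) (?e k) (?e l))"
    by (simp add: star_def pb4_def D_def)
  also have "\<dots> = (\<Sum>i\<in>UNIV. \<Sum>j\<in>UNIV. \<Sum>k\<in>UNIV. \<Sum>l\<in>UNIV. f (E *v ?e i) (E *v ?e j) (E *v ?e k) (?e l) * D (?e i) (?e j) (?e k) (?T (?e l)))"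
    by (intro sum.cong refl sum_adjoint[where B = "\<lambda>x y. f (E *v ?e _) (E *v ?e _) (E *v ?e _) x * D (?e _) (?e _) (?e _) y"])
      (auto intro!: linearI simp: linear_add[OF lf(4)] linear_scale[OF lf(4)] linear_add[OF lD(4)] linear_scale[OF lD(4)] algebra_simps)
  also have "\<dots> = (\<Sum>i\<in>UNIV. \<Sum>j\<in>UNIV. \<Sum>k\<in>UNIV. \<Sum>l\<in>UNIV. f (E *v ?e i) (E *v ?e j) (?e k) (?e l) * D (?e i) (?e j) (?T (?e k)) (?T (?e l)))"
    by (intro sum.cong refl sum_adjoint[where B = "\<lambda>x y. \<Sum>l\<in>UNIV. f (E *v ?e _) (E *v ?e _) x (?e l) * D (?e _) (?e _) y (?T (?e l))"])
      (auto intro!: linearI simp: linear_add[OF lf(3)] linear_scale[OF lf(3)] linear_add[OF lD(3)] linear_scale[OF lD(3)] algebra_simps sum.distrib sum_distrib_left)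
  also have "\<dots> = (\<Sum>i\<in>UNIV. \<Sum>j\<in>UNIV. \<Sum>k\<in>UNIV. \<Sum>l\<in>UNIV. f (E *v ?e i) (?e j) (?e k) (?e l) * D (?e i) (?T (?e j)) (?T (?e k)) (?T (?e l)))"
    by (intro sum.cong refl sum_adjoint[where B = "\<lambda>x y. \<Sum>k\<in>UNIV. \<Sum>l\<in>UNIV. f (E *v ?e _) x (?e k) (?e l) * D (?e _) y (?T (?e k)) (?T (?e l))"])
      (auto intro!: linearI simp: linear_add[OF lf(2)] linear_scale[OF lf(2)] linear_add[OF lD(2)] linear_scale[OF lD(2)] algebra_simps sum.distrib sum_distrib_left)
  also have "\<dots> = (\<Sum>i\<in>UNIV. \<Sum>j\<in>UNIV. \<Sum>k\<in>UNIV. \<Sum>l\<in>UNIV. f (?e i) (?e j) (?e k) (?e l) * D (?T (?e i)) (?T (?e j)) (?T (?e k)) (?T (?e l)))"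
    by (intro sum_adjoint[where B = "\<lambda>x y. \<Sum>j\<in>UNIV. \<Sum>k\<in>UNIV. \<Sum>l\<in>UNIV. f x (?e j) (?e k) (?e l) * D y (?T (?e j)) (?T (?e k)) (?T (?e l))"])
      (auto intro!: linearI simp: linear_add[OF lf(1)] linear_scale[OF lf(1)] linear_add[OF lD(1)] linear_scale[OF lD(1)] algebra_simps sum.distrib sum_distrib_left)
  finally show ?thesis unfolding D_def .
qed

text \<open>With the transpose applied to the three free arguments too, all seven rows of the
  determinant are transformed and \<open>det E\<close> comes out. So up to this factor, pull-back of
  4-forms by \<open>E\<close> corresponds under \<open>star\<close> to pull-back of 3-forms by the
  inverse transpose. This is where transposition comes from.\<close>

lemma star_pb4:
  assumes f: "alt4 f"
  shows "star (pb4 E f) (transpose E *v a) (transpose E *v b) (transpose E *v c) = det E * star f a b c"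
  unfolding star_pb4_sum[OF f] det7_matrix det_transpose unfolding star_def by (simp add: sum_distrib_left mult_ac)

text \<open>Only the 24 orderings of the complementary quadruple contribute. Under a transposition
  the form and the determinant change sign together, so all contributions agree.\<close>

lemma star_axis:
  assumes f: "alt4 f" and U: "(UNIV :: 7 set) = {i, j, k, l, p, q, r}"
  shows "star f (axis p 1) (axis q 1) (axis r 1) = 24 * det7 (axis i 1) (axis j 1) (axis k 1) (axis l 1) (axis p 1) (axis q 1) (axis r 1)
    * f (axis i 1) (axis j 1) (axis k 1) (axis l 1)"
proof -
  have "card (set [i, j, k, l, p, q, r]) = length [i, j, k, l, p, q, r]"
    using arg_cong[OF U, of card] by simp
  then have "distinct [i, j, k, l, p, q, r]" by (rule card_distinct)
  then have ne: "i \<noteq> j" "i \<noteq> k" "i \<noteq> l" "i \<noteq> p" "i \<noteq> q" "i \<noteq> r" "j \<noteq> k" "j \<noteq> l" "j \<noteq> p" "j \<noteq> q" "j \<noteq> r"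
    "k \<noteq> l" "k \<noteq> p" "k \<noteq> q" "k \<noteq> r" "l \<noteq> p" "l \<noteq> q" "l \<noteq> r" "p \<noteq> q" "p \<noteq> r" "q \<noteq> r"
    by auto
  have S: "(\<Sum>x\<in>UNIV. g x) = g i + g j + g k + g l + g p + g q + g r" for g :: "7 \<Rightarrow> real"
    unfolding U using ne by simp
  define h where "h a b c d = f (axis a 1) (axis b 1) (axis c 1) (axis d 1) *
    det7 (axis a 1) (axis b 1) (axis c 1) (axis d 1) (axis p 1) (axis q 1) (axis r 1)" for a b c d
  have z: "h a a c d = 0" "h a b a d = 0" "h a b c a = 0" "h a b b d = 0" "h a b c b = 0" "h a b c c = 0"
    "h p b c d = 0" "h q b c d = 0" "h r b c d = 0" "h a p c d = 0" "h a q c d = 0" "h a r c d = 0"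
    "h a b p d = 0" "h a b q d = 0" "h a b r d = 0" "h a b c p = 0" "h a b c q = 0" "h a b c r = 0" for a b c d
    by (simp_all add: h_def alt4_self[OF f] det7_self)
  have sw: "h b a c d = h a b c d" "h a c b d = h a b c d" "h a b d c = h a b c d" for a b c d
  proof -
    show "h b a c d = h a b c d"
      unfolding h_def using alt4_swap(1)[OF f, of "axis b 1" "axis a 1" "axis c 1" "axis d 1"]
        det7_swap(1)[of "axis b 1" "axis a 1" "axis c 1" "axis d 1" "axis p 1" "axis q 1" "axis r 1"] by simp
    show "h a c b d = h a b c d"
      unfolding h_def using alt4_swap(2)[OF f, of "axis a 1" "axis c 1" "axis b 1" "axis d 1"]
        det7_swap(2)[of "axis a 1" "axis c 1" "axis b 1" "axis d 1" "axis p 1" "axis q 1" "axis r 1"] by simp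
    show "h a b d c = h a b c d"
      unfolding h_def using alt4_swap(3)[OF f, of "axis a 1" "axis b 1" "axis d 1" "axis c 1"]
        det7_swap(3)[of "axis a 1" "axis b 1" "axis d 1" "axis c 1" "axis p 1" "axis q 1" "axis r 1"] by simp
  qed
  have "star f (axis p 1) (axis q 1) (axis r 1) = (\<Sum>a\<in>UNIV. \<Sum>b\<in>UNIV. \<Sum>c\<in>UNIV. \<Sum>d\<in>UNIV. h a b c d)"
    by (simp add: star_def h_def)
  also have "\<dots> = 24 * h i j k l"
    by (simp add: S z) (simp add: sw)
  finally show ?thesis by (simp add: h_def)
qed

lemma det7_axes_nonzero:
  assumes U: "(UNIV :: 7 set) = {i, j, k, l, p, q, r}"
  shows "det7 (axis i 1) (axis j 1) (axis k 1) (axis l 1) (axis p 1) (axis q 1) (axis r 1) \<noteq> 0"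
proof -
  let ?A = "v7 (axis i 1) (axis j 1) (axis k 1) (axis l 1) (axis p 1) (axis q 1) (axis r 1) :: real^7^7"
  have "x = 0" if "?A *v x = 0" for x
  proof -
    have "(?A $ m) \<bullet> x = 0" for m
      using arg_cong[OF that, of "\<lambda>v. v $ m"] by (simp add: matrix_vector_mul_component)
    from this[of 0] this[of 1] this[of 2] this[of 3] this[of 4] this[of 5] this[of 6]
    have "\<forall>m\<in>{i, j, k, l, p, q, r}. x $ m = 0" by (simp add: inner_axis')
    then show ?thesis unfolding U[symmetric] by (simp add: vec_eq_iff)
  qed
  then have "invertible ?A"
    unfolding invertible_left_inverse matrix_left_invertible_ker by blast
  then show ?thesis by (simp add: det7_def invertible_det_nz)
qed

lemma star_inject:
  assumes f: "alt4 f" and g: "alt4 g" and eq: "star f = star g"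
  shows "f = g"
proof -
  have e: "f (axis i 1) (axis j 1) (axis k 1) (axis l 1) = g (axis i 1) (axis j 1) (axis k 1) (axis l 1)" for i j k l
  proof (cases "distinct [i, j, k, l]")
    case True
    have "card (UNIV - {i, j, k, l}) = 3"
      using True by (subst card_Diff_subset) auto
    then obtain p q r where pqr: "UNIV - {i, j, k, l} = {p, q, r}"
      by (auto simp: card_Suc_eq numeral_3_eq_3)
    then have "(UNIV :: 7 set) = {i, j, k, l, p, q, r}" by blast
    from star_axis[OF f this] star_axis[OF g this] det7_axes_nonzero[OF this] eq show ?thesis by simp
  next
    case False
    then show ?thesis by (auto simp: alt4_self[OF f] alt4_self[OF g])
  qed
  show ?thesis
  proof (intro ext)
    show "f u v w z = g u v w z" for u v w z
      unfolding alt4_expand[OF f, of u] alt4_expand[OF g, of u] e ..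
  qed
qed

text \<open>The hypothesis turns the transpositions into a terminating rewrite system that sorts the
  axes.\<close>

lemma det7_sort:
  assumes "idx j < idx i"
  shows "det7 (axis i 1) (axis j 1) c d e f g = - det7 (axis j 1) (axis i 1) c d e f g"
    "det7 a (axis i 1) (axis j 1) d e f g = - det7 a (axis j 1) (axis i 1) d e f g"
    "det7 a b (axis i 1) (axis j 1) e f g = - det7 a b (axis j 1) (axis i 1) e f g"
    "det7 a b c (axis i 1) (axis j 1) f g = - det7 a b c (axis j 1) (axis i 1) f g"
    "det7 a b c d (axis i 1) (axis j 1) g = - det7 a b c d (axis j 1) (axis i 1) g"
    "det7 a b c d e (axis i 1) (axis j 1) = - det7 a b c d e (axis j 1) (axis i 1)"
  by (rule det7_swap)+

lemma det7_std: "det7 (axis 0 1) (axis 1 1) (axis 2 1) (axis 3 1) (axis 4 1) (axis 5 1) (axis 6 1) = 1"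
proof -
  have "v7 (axis 0 1) (axis 1 1) (axis 2 1) (axis 3 1) (axis 4 1) (axis 5 1) (axis 6 1) = (mat 1 :: real^7^7)"
    unfolding vec_eq_iff[where 'b = 7] forall_7 by (simp add: mat_def axis_def)
  then show ?thesis by (simp add: det7_def)
qed

lemma star_S4_axis:
  assumes "(UNIV :: 7 set) = {i, j, k, l, p, q, r}"
    and "det7 (axis i 1) (axis j 1) (axis k 1) (axis l 1) (axis p 1) (axis q 1) (axis r 1)
      * S4 (axis i 1) (axis j 1) (axis k 1) (axis l 1) = P3 (axis p 1) (axis q 1) (axis r 1)"
  shows "star S4 (axis p 1) (axis q 1) (axis r 1) = 24 * P3 (axis p 1) (axis q 1) (axis r 1)"
  using star_axis[OF alt4_S4 assms(1)] assms(2) by simp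

text \<open>In dimension 7 the Hodge star is an involution and exchanges the two model forms; 24 is
  the multiplicity built into \<open>star\<close>. Each of the 35 components needs one complementary
  quadruple, listed in front of its triple.\<close>

lemma star_S4: "star S4 = (\<lambda>a b c. 24 * P3 a b c)"
proof (rule alt3_eqI[OF alt3_star])
  show "alt3 (\<lambda>a b c. 24 * P3 a b c)"
    using alt3_lin[OF alt3_P3 alt3_P3, of 24 0] by simp
  have "\<forall>i j k. increasing i j k \<longrightarrow> star S4 (axis i 1) (axis j 1) (axis k 1) = 24 * P3 (axis i 1) (axis j 1) (axis k 1)"
    unfolding increasing_7
    by (intro conjI;
      (rule star_S4_axis[of 3 4 5 6 0 1 2]
        star_S4_axis[of 2 4 5 6 0 1 3]
        star_S4_axis[of 2 3 5 6 0 1 4]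
        star_S4_axis[of 2 3 4 6 0 1 5]
        star_S4_axis[of 2 3 4 5 0 1 6]
        star_S4_axis[of 1 4 5 6 0 2 3]
        star_S4_axis[of 1 3 5 6 0 2 4]
        star_S4_axis[of 1 3 4 6 0 2 5]
        star_S4_axis[of 1 3 4 5 0 2 6]
        star_S4_axis[of 1 2 5 6 0 3 4]
        star_S4_axis[of 1 2 4 6 0 3 5]
        star_S4_axis[of 1 2 4 5 0 3 6]
        star_S4_axis[of 1 2 3 6 0 4 5]
        star_S4_axis[of 1 2 3 5 0 4 6]
        star_S4_axis[of 1 2 3 4 0 5 6]
        star_S4_axis[of 0 4 5 6 1 2 3]
        star_S4_axis[of 0 3 5 6 1 2 4]
        star_S4_axis[of 0 3 4 6 1 2 5]
        star_S4_axis[of 0 3 4 5 1 2 6]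
        star_S4_axis[of 0 2 5 6 1 3 4]
        star_S4_axis[of 0 2 4 6 1 3 5]
        star_S4_axis[of 0 2 4 5 1 3 6]
        star_S4_axis[of 0 2 3 6 1 4 5]
        star_S4_axis[of 0 2 3 5 1 4 6]
        star_S4_axis[of 0 2 3 4 1 5 6]
        star_S4_axis[of 0 1 5 6 2 3 4]
        star_S4_axis[of 0 1 4 6 2 3 5]
        star_S4_axis[of 0 1 4 5 2 3 6]
        star_S4_axis[of 0 1 3 6 2 4 5]
        star_S4_axis[of 0 1 3 5 2 4 6]
        star_S4_axis[of 0 1 3 4 2 5 6]
        star_S4_axis[of 0 1 2 6 3 4 5]
        star_S4_axis[of 0 1 2 5 3 4 6]
        star_S4_axis[of 0 1 2 4 3 5 6]
        star_S4_axis[of 0 1 2 3 4 5 6],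
      (unfold UNIV_7, blast)[1], simp add: det7_sort det7_std, simp add: S4_expand P3_expand dx_4 dx_3 axis_def))
  then show "upper (star S4) = upper (\<lambda>a b c. 24 * P3 a b c)"
    by (simp add: upper_def vec_eq_iff)
qed


section \<open>Stabilizer of the model form and transposition\<close>

text \<open>\<open>qf_frame\<close> for the identity gives \<open>(qf P3 u)^2 = 1\<close> on unit
  vectors. For \<open>G\<close> it then says that \<open>w \<bullet> w = \<bar>det G\<bar>\<close>
  whenever \<open>G *v w\<close> is a unit vector, so \<open>s = sqrt \<bar>det G\<bar>\<close>
  times \<open>G\<close> is an isometry. Comparing determinants gives \<open>s ^ 9 = 1\<close>, with
  exponent 7 from the scaling and 2 from \<open>\<bar>det G\<bar>\<close>.\<close>

lemma pb3_P3_orthogonal: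
  assumes "pb3 G P3 = P3" shows "orthogonal_transformation (\<lambda>x. G *v x)" "\<bar>det G\<bar> = 1"
proof -
  have inv: "invertible G" by (rule pb3_P3_invertible[OF alt3_P3 assms])
  define d where "d = \<bar>det G\<bar>"
  have d: "d > 0" using inv by (simp add: d_def invertible_det_nz)
  define s where "s = sqrt d"
  have s: "s > 0" "s\<^sup>2 = d" using d by (simp_all add: s_def)
  have q1: "(qf P3 u)\<^sup>2 = 1" if "u \<bullet> u = 1" for u
    using qf_frame[OF alt3_P3 pb3_id, of u u] that by simp
  have unit: "norm (s *\<^sub>R (G *v w)) = norm w" if "norm (G *v w) = 1" for w
  proof -
    have "det G ^ 4 = (w \<bullet> w) ^ 4"
      using qf_frame[OF alt3_P3 assms refl, of w] q1[of "G *v w"] that by (simp add: norm_eq_1)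
    then have "d ^ 4 = (w \<bullet> w) ^ 4" by (simp add: d_def)
    then have "s\<^sup>2 = (norm w)\<^sup>2"
      using d by (simp add: s(2) power_eq_iff_eq_base power2_norm_eq_inner)
    then have "s = norm w" using s(1) by (simp add: power_eq_iff_eq_base)
    then show ?thesis using that s(1) by simp
  qed
  have norm: "norm (s *\<^sub>R (G *v w)) = norm w" for w
  proof (cases "G *v w = 0")
    case True
    then have "w = 0"
      using inv unfolding invertible_left_inverse matrix_left_invertible_ker by blast
    then show ?thesis by simp
  next
    case False
    define r where "r = norm (G *v w)"
    have r: "r > 0" using False by (simp add: r_def)
    have "norm (G *v (w /\<^sub>R r)) = 1" using r by (simp add: matrix_vector_mult_scaleR r_def)
    from unit[OF this] show ?thesis using r by (simp add: matrix_vector_mult_scaleR field_simps)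
  qed
  have "orthogonal_transformation (\<lambda>w. (s *\<^sub>R G) *v w)"
    unfolding orthogonal_transformation using norm
    by (auto simp: scaleR_matrix_vector_assoc[symmetric])
  then have "orthogonal_matrix (s *\<^sub>R G)"
    unfolding orthogonal_transformation_matrix by (simp add: matrix_of_matrix_vector_mul)
  then have "\<bar>det (s *\<^sub>R G)\<bar> = 1" using det_orthogonal_matrix by fastforce
  then have "s ^ 7 * d = 1" using s(1) by (simp add: det_scaleR abs_mult d_def power_abs)
  then have "s ^ 9 = 1" unfolding s(2)[symmetric] by (simp add: power_add[symmetric])
  then have s1: "s = 1" using s(1) power_eq_iff_eq_base[of 9 s 1] by simp
  then show "\<bar>det G\<bar> = 1" using s(2) by (simp add: d_def)
  show "orthogonal_transformation (\<lambda>x. G *v x)"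
    using norm unfolding s1 orthogonal_transformation by simp
qed

text \<open>An orthogonal \<open>G\<close> which preserves \<open>P3\<close> preserves the cross product and hence \<open>S4\<close>,
  but \<open>star\<close> is equivariant only up to the factor \<open>det G\<close>.\<close>

lemma pb3_P3_det:
  assumes "pb3 G P3 = P3" shows "det G = 1"
proof -
  have ot: "orthogonal_transformation (\<lambda>x. G *v x)" by (rule pb3_P3_orthogonal[OF assms])
  then have "orthogonal_matrix G"
    unfolding orthogonal_transformation_matrix by (simp add: matrix_of_matrix_vector_mul)
  then have GT: "transpose G ** G = mat 1" "G ** transpose G = mat 1" by (simp_all add: orthogonal_matrix_def)
  have ip: "(G *v x) \<bullet> (G *v y) = x \<bullet> y" for x y
    using ot by (simp add: orthogonal_transformation_def)
  have P: "P3 (G *v u) (G *v v) (G *v w) = P3 u v w" for u v w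
    using assms by (metis pb3_def)
  have cross: "cross (G *v u) (G *v v) = G *v cross u v" for u v
  proof (rule vector_eq_ldot[THEN iffD1, rule_format])
    fix z
    obtain w where z: "z = G *v w" by (metis GT(2) matrix_vector_mul_assoc matrix_vector_mul_lid)
    show "z \<bullet> cross (G *v u) (G *v v) = z \<bullet> (G *v cross u v)"
      by (simp add: z ip inner_cross P)
  qed
  have "pb4 G S4 = S4"
    by (intro ext) (simp add: pb4_def S4_cross ip P cross)
  then have e: "star S4 (transpose G *v a) (transpose G *v b) (transpose G *v c) = det G * star S4 a b c" for a b c
    using star_pb4[OF alt4_S4, of G a b c] by simp
  have "P3 (transpose G *v a) (transpose G *v b) (transpose G *v c) = P3 a b c" for a b c
    using P[of "transpose G *v a" "transpose G *v b" "transpose G *v c"]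
    by (simp only: matrix_vector_mul_assoc GT matrix_vector_mul_lid)
  with e have "P3 a b c = det G * P3 a b c" for a b c
    by (simp add: star_S4)
  moreover have "P3 (axis 1 1) (axis 2 1) (axis 3 1) = 1"
    by (simp add: P3_expand dx_3 axis_def)
  ultimately show ?thesis by (metis mult.right_neutral)
qed

section \<open>Constant sign and transposition\<close>

lemma gram_exists:
  fixes u u' :: "real^7"
  assumes "u \<noteq> 0" "u' \<noteq> 0"
  obtains w where "(u \<bullet> u) * (w \<bullet> w) \<noteq> (u \<bullet> w)\<^sup>2" "(u' \<bullet> u') * (w \<bullet> w) \<noteq> (u' \<bullet> w)\<^sup>2"
proof -
  \<comment> \<open>Dimension 7 leaves room for a vector orthogonal to both \<open>u\<close> and
    \<open>u'\<close>, which serves as a common partner.\<close>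
  have "dim {u, u'} \<le> card {u, u'}" by (rule dim_le_card') simp
  also have "\<dots> \<le> 2" by (simp add: card_insert_if)
  finally have "dim {u, u'} < DIM(real^7)" by simp
  then obtain w where w: "w \<noteq> 0" "\<forall>x\<in>span {u, u'}. orthogonal w x"
    using orthogonal_to_subspace_exists[of "{u, u'}"] by metis
  then have "u \<bullet> w = 0" "u' \<bullet> w = 0"
    by (auto simp: orthogonal_def inner_commute span_base)
  then show ?thesis using that[of w] w(1) assms by simp
qed

text \<open>A nonvanishing function on independent pairs which is quadratic in each argument has constant sign:
  two values of opposite sign at \<open>(u, v)\<close> and \<open>(u, w)\<close> would yield a zero on the segment from
  \<open>v\<close> to \<open>w\<close>, which consists of vectors independent of \<open>u\<close>.\<close>

lemma cross_sign_constant: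
  assumes f: "alt3 f" and nz: "\<And>u v. (u \<bullet> u) * (v \<bullet> v) \<noteq> (u \<bullet> v)\<^sup>2 \<Longrightarrow> f u v (cross u v) \<noteq> 0"
    and uv: "(u \<bullet> u) * (v \<bullet> v) \<noteq> (u \<bullet> v)\<^sup>2" "f u v (cross u v) > 0"
    and uv': "(u' \<bullet> u') * (v' \<bullet> v') \<noteq> (u' \<bullet> v')\<^sup>2"
  shows "f u' v' (cross u' v') > 0"
proof -
  have sym: "f v u (cross v u) = f u v (cross u v)" for u v
    using alt3_swap12[OF f, of v u "cross v u"] by (simp add: cross_swap[of u v] alt3_simps[OF f])
  have gsym: "(v \<bullet> v) * (u \<bullet> u) \<noteq> (v \<bullet> u)\<^sup>2 \<longleftrightarrow> (u \<bullet> u) * (v \<bullet> v) \<noteq> (u \<bullet> v)\<^sup>2" for u v :: "real^7"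
    by (simp add: inner_commute mult.commute)
  have step: "f u w (cross u w) > 0"
    if 1: "(u \<bullet> u) * (v \<bullet> v) \<noteq> (u \<bullet> v)\<^sup>2" "f u v (cross u v) > 0" and 2: "(u \<bullet> u) * (w \<bullet> w) \<noteq> (u \<bullet> w)\<^sup>2" for u v w
  proof (rule ccontr)
    assume "\<not> f u w (cross u w) > 0"
    then have neg: "f u w (cross u w) < 0" using nz[OF 2] by linarith
    define g where "g = (\<lambda>s::real. f u ((1 - s) *\<^sub>R v + s *\<^sub>R w) (cross u ((1 - s) *\<^sub>R v + s *\<^sub>R w)))"
    define B where "B = f u v (cross u w) + f u w (cross u v)"
    have g: "g s = (1 - s)\<^sup>2 * f u v (cross u v) + (1 - s) * s * B + s\<^sup>2 * f u w (cross u w)" for s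
      unfolding g_def B_def by (simp add: alt3_simps[OF f] cross_simps power2_eq_square algebra_simps)
    have "continuous_on {0..1} g" unfolding g by (intro continuous_intros)
    then obtain s where s: "0 \<le> s" "s \<le> 1" "g s = 0"
      using IVT2'[of g 1 0 0] 1(2) neg by (auto simp: g)
    \<comment> \<open>A zero of \<open>g\<close> makes \<open>x\<close> dependent on
      \<open>u\<close> by \<open>nz\<close>. Then \<open>s *\<^sub>R w\<close> and
      \<open>(s - 1) *\<^sub>R v\<close> agree modulo \<open>u\<close>, so the value at
      \<open>w\<close> is a nonnegative multiple of the value at \<open>v\<close>.\<close>
    define x where "x = (1 - s) *\<^sub>R v + s *\<^sub>R w"
    have "(u \<bullet> u) * (x \<bullet> x) = (u \<bullet> x)\<^sup>2"
      using nz[of u x] s(3) by (auto simp: g_def x_def)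
    moreover have u0: "u \<noteq> 0" using 1(1) by auto
    ultimately have cx: "cross u x = 0"
      using inner_cross_cross[of u x x] by (simp add: power2_eq_square)
    have "s \<noteq> 0" using s(3) 1(2) by (auto simp: g)
    have swv: "s *\<^sub>R cross u w = - ((1 - s) *\<^sub>R cross u v)"
      using cx by (simp add: x_def cross_simps eq_neg_iff_add_eq_0 add.commute)
    have "(u \<bullet> u) *\<^sub>R x = (u \<bullet> x) *\<^sub>R u"
      using cross_cross[of u x] cx by (simp add: cross_simps)
    then have "f u ((u \<bullet> u) *\<^sub>R x) z = 0" for z by (simp add: alt3_simps[OF f])
    then have fx: "f u x z = 0" for z using u0 by (simp add: alt3_simps[OF f])
    then have "(1 - s) * f u v z + s * f u w z = 0" for z
      using fx[of z] by (simp add: x_def alt3_simps[OF f])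
    then have eq: "s * f u w z = - ((1 - s) * f u v z)" for z by (simp add: eq_neg_iff_add_eq_0 add.commute)
    have "s * s * f u w (cross u w) = s * f u w (s *\<^sub>R cross u w)" by (simp add: alt3_simps[OF f])
    also have "\<dots> = - (1 - s) * (s * f u w (cross u v))"
      unfolding swv by (simp add: alt3_simps[OF f] algebra_simps)
    also have "\<dots> = (1 - s) * (1 - s) * f u v (cross u v)" unfolding eq by (simp add: algebra_simps)
    finally have "s * s * f u w (cross u w) \<ge> 0" using 1(2) by simp
    moreover have "s * s > 0" using \<open>s \<noteq> 0\<close> s by simp
    ultimately show False using neg by (simp add: zero_le_mult_iff)
  qed
  have "u \<noteq> 0" "u' \<noteq> 0" using uv uv' by auto
  then obtain w where w: "(u \<bullet> u) * (w \<bullet> w) \<noteq> (u \<bullet> w)\<^sup>2" "(u' \<bullet> u') * (w \<bullet> w) \<noteq> (u' \<bullet> w)\<^sup>2"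
    using gram_exists by metis
  have "f w u (cross w u) > 0" using step[OF uv w(1)] by (simp only: sym)
  from step[OF gsym[THEN iffD2, OF w(1)] this gsym[THEN iffD2, OF w(2)]]
  have "f u' w (cross u' w) > 0" by (simp only: sym)
  from step[OF w(2) this uv'] show ?thesis .
qed

lemma sum_P3_cross:
  assumes "alt3 f"
  shows "(\<Sum>i\<in>UNIV. \<Sum>j\<in>UNIV. f (axis i 1) (axis j 1) (cross (axis i 1) (axis j 1))) =
    (\<Sum>i\<in>UNIV. \<Sum>j\<in>UNIV. \<Sum>k\<in>UNIV. P3 (axis i 1) (axis j 1) (axis k 1) * f (axis i 1) (axis j 1) (axis k 1))"
  by (subst linear_sum_axis[OF alt3_linear3(1)[OF assms]]) (simp add: cross_def)

lemma contraction_adjoint: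
  fixes E :: "real^7^7"
  assumes f: "alt3 f" and g: "alt3 g"
  shows "(\<Sum>i\<in>UNIV. \<Sum>j\<in>UNIV. \<Sum>k\<in>UNIV. f (E *v axis i 1) (E *v axis j 1) (E *v axis k 1) * g (axis i 1) (axis j 1) (axis k 1))
    = (\<Sum>i\<in>UNIV. \<Sum>j\<in>UNIV. \<Sum>k\<in>UNIV. f (axis i 1) (axis j 1) (axis k 1) *
        g (transpose E *v axis i 1) (transpose E *v axis j 1) (transpose E *v axis k 1))"
proof -
  let ?e = "\<lambda>i. axis i (1::real) :: real^7"
  let ?T = "\<lambda>x. transpose E *v x"
  have "(\<Sum>i\<in>UNIV. \<Sum>j\<in>UNIV. \<Sum>k\<in>UNIV. f (E *v ?e i) (E *v ?e j) (E *v ?e k) * g (?e i) (?e j) (?e k))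
    = (\<Sum>i\<in>UNIV. \<Sum>j\<in>UNIV. \<Sum>k\<in>UNIV. f (E *v ?e i) (E *v ?e j) (?e k) * g (?e i) (?e j) (?T (?e k)))"
    by (intro sum.cong refl sum_adjoint[where B = "\<lambda>x y. f (E *v ?e _) (E *v ?e _) x * g (?e _) (?e _) y"])
      (auto intro!: linearI simp: alt3_simps[OF f] alt3_simps[OF g] algebra_simps)
  also have "\<dots> = (\<Sum>i\<in>UNIV. \<Sum>j\<in>UNIV. \<Sum>k\<in>UNIV. f (E *v ?e i) (?e j) (?e k) * g (?e i) (?T (?e j)) (?T (?e k)))"
    by (intro sum.cong refl sum_adjoint[where B = "\<lambda>x y. \<Sum>k\<in>UNIV. f (E *v ?e _) x (?e k) * g (?e _) y (?T (?e k))"])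
      (auto intro!: linearI simp: alt3_simps[OF f] alt3_simps[OF g] algebra_simps sum.distrib sum_distrib_left)
  also have "\<dots> = (\<Sum>i\<in>UNIV. \<Sum>j\<in>UNIV. \<Sum>k\<in>UNIV. f (?e i) (?e j) (?e k) * g (?T (?e i)) (?T (?e j)) (?T (?e k)))"
    by (intro sum_adjoint[where B = "\<lambda>x y. \<Sum>j\<in>UNIV. \<Sum>k\<in>UNIV. f x (?e j) (?e k) * g y (?T (?e j)) (?T (?e k))"])
      (auto intro!: linearI simp: alt3_simps[OF f] alt3_simps[OF g] algebra_simps sum.distrib sum_distrib_left)
  finally show ?thesis .
qed

text \<open>If \<open>(E\<^sup>T)\<^sup>*P3\<close> vanished on \<open>a, b, c = a \<times> b\<close>, then with \<open>u = E\<^sup>Ta \<times> E\<^sup>Tb\<close> and \<open>v = E\<^sup>Ta \<times> E\<^sup>Tc\<close> the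
  associative plane of \<open>u, v, u \<times> v\<close> would be orthogonal to \<open>E\<^sup>Ta, E\<^sup>Tb, E\<^sup>Tc\<close>. So \<open>E\<close> would map it into
  the coassociative complement of \<open>a, b, c\<close>, where \<open>P3\<close> vanishes.\<close>

lemma tame3_transpose:
  assumes E: "invertible E" and t: "tame3 (pb3 E P3)"
  shows "tame3 (pb3 (transpose E) P3)"
proof -
  define f where "f = pb3 (transpose E) P3"
  have f: "alt3 f" unfolding f_def by (rule alt3_pb3[OF alt3_P3])
  have tE: "invertible (transpose E)" using E by (simp add: invertible_det_nz)
  note tp = tame3_pos[OF alt3_pb3[OF alt3_P3] t]
  have nz1: "f a b (cross a b) \<noteq> 0" if ab: "a \<bullet> a = 1" "b \<bullet> b = 1" "a \<bullet> b = 0" for a b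
  proof
    assume "f a b (cross a b) = 0"
    define x y z where "x = transpose E *v a" "y = transpose E *v b" "z = transpose E *v cross a b"
    have P: "P3 x y z = 0" using \<open>f a b (cross a b) = 0\<close> by (simp only: f_def pb3_def x_y_z_def)
    define u v where "u = cross x y" "v = cross x z"
    have o: "(E *v w) \<bullet> a = w \<bullet> x" "(E *v w) \<bullet> b = w \<bullet> y" "(E *v w) \<bullet> cross a b = w \<bullet> z" for w
      unfolding x_y_z_def by (metis inner_commute transpose_inner)+
    note po = cross_pair_orth[OF P, folded u_v_def]
    have "P3 (E *v u) (E *v v) (E *v cross u v) = 0"
      by (rule P3_on_coassociative[OF ab]) (simp_all only: o po)
    moreover have "(u \<bullet> u) * (v \<bullet> v) \<noteq> (u \<bullet> v)\<^sup>2"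
    proof -
      have xx: "(x \<bullet> x) * (y \<bullet> y) \<noteq> (x \<bullet> y)\<^sup>2"
        unfolding x_y_z_def by (rule gram_injective[OF tE]) (simp add: ab)
      \<comment> \<open>The combination is the cross product of \<open>x\<close> with
        \<open>s *\<^sub>R y + t *\<^sub>R z\<close>. If it vanishes, that vector is a multiple of
        \<open>x\<close>, and injectivity of the transpose carries the relation back to the
        orthonormal triple of \<open>a\<close>, \<open>b\<close>, \<open>cross a b\<close>.\<close>
      have 0: "s = 0 \<and> t = 0" if "s *\<^sub>R u + t *\<^sub>R v = 0" for s t
      proof -
        have "cross x (s *\<^sub>R y + t *\<^sub>R z) = 0" using that by (simp add: u_v_def cross_simps)
        then have "(x \<bullet> x) *\<^sub>R (s *\<^sub>R y + t *\<^sub>R z) = (x \<bullet> (s *\<^sub>R y + t *\<^sub>R z)) *\<^sub>R x"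
          using cross_cross[of x "s *\<^sub>R y + t *\<^sub>R z"] by (simp add: cross_simps)
        then have "transpose E *v ((x \<bullet> x) *\<^sub>R (s *\<^sub>R b + t *\<^sub>R cross a b) - (x \<bullet> (s *\<^sub>R y + t *\<^sub>R z)) *\<^sub>R a) = 0"
          by (simp add: x_y_z_def matrix_vector_mult_diff_distrib matrix_vector_right_distrib matrix_vector_mult_scaleR
              del: transpose_matrix_vector)
        then have z: "(x \<bullet> x) *\<^sub>R (s *\<^sub>R b + t *\<^sub>R cross a b) - (x \<bullet> (s *\<^sub>R y + t *\<^sub>R z)) *\<^sub>R a = 0"
          using tE unfolding invertible_left_inverse matrix_left_invertible_ker by blast
        have "(x \<bullet> x) * s = 0" "(x \<bullet> x) * t = 0"
          using arg_cong[OF z, of "inner b"] arg_cong[OF z, of "inner (cross a b)"] ab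
          by (simp_all add: inner_diff_right inner_add_right inner_commute inner_cross_cross)
        moreover have "x \<noteq> 0" using xx by auto
        ultimately show ?thesis by simp
      qed
      show ?thesis
      proof
        assume g: "(u \<bullet> u) * (v \<bullet> v) = (u \<bullet> v)\<^sup>2"
        define n where "n = (u \<bullet> u) *\<^sub>R v - (u \<bullet> v) *\<^sub>R u"
        have "n \<bullet> n = (u \<bullet> u) * ((u \<bullet> u) * (v \<bullet> v) - (u \<bullet> v)\<^sup>2)"
          by (simp add: n_def inner_diff_left inner_diff_right inner_commute power2_eq_square algebra_simps)
        then have "n = 0" using g by simp
        then have "u \<bullet> u = 0" using 0[of "- (u \<bullet> v)" "u \<bullet> u"] by (simp add: n_def)
        then show False using 0[of 1 0] by simp
      qed
    qed
    ultimately show False using tp[of u v] by (simp add: pb3_def)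
  qed
  have nz: "f u v (cross u v) \<noteq> 0" if uv: "(u \<bullet> u) * (v \<bullet> v) \<noteq> (u \<bullet> v)\<^sup>2" for u v
  proof -
    obtain a b r s t where *: "a \<bullet> a = 1" "b \<bullet> b = 1" "a \<bullet> b = 0" "u = r *\<^sub>R a" "v = s *\<^sub>R a + t *\<^sub>R b"
      "r > 0" "t > 0"
      using gram_schmidt_2[OF uv] by metis
    have "f u v (cross u v) = r\<^sup>2 * t\<^sup>2 * f a b (cross a b)"
      unfolding * by (simp add: alt3_simps[OF f] cross_simps power2_eq_square algebra_simps)
    then show ?thesis using nz1[OF *(1-3)] *(6,7) by simp
  qed
  let ?e = "\<lambda>i. axis i (1::real) :: real^7"
  define g where "g = pb3 E P3"
  have ga: "alt3 g" unfolding g_def by (rule alt3_pb3[OF alt3_P3])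
  have indep: "(?e i \<bullet> ?e i) * (?e j \<bullet> ?e j) \<noteq> (?e i \<bullet> ?e j)\<^sup>2" if "i \<noteq> j" for i j
    using that by (simp add: inner_axis_axis)
  have gnn: "g (?e i) (?e j) (cross (?e i) (?e j)) \<ge> 0" for i j
    using tp[OF indep[of i j]] by (cases "i = j") (auto simp: g_def cross_simps alt3_simps[OF alt3_pb3[OF alt3_P3]] less_imp_le)
  \<comment> \<open>The sum of \<open>f e\<^sub>i e\<^sub>j (e\<^sub>i \<times> e\<^sub>j)\<close> is a contraction of two copies of \<open>P3\<close> with three of \<open>E\<close>,
    hence symmetric under transposing \<open>E\<close>; this fixes the sign.\<close>
  have "(\<Sum>i\<in>UNIV. \<Sum>j\<in>UNIV. f (?e i) (?e j) (cross (?e i) (?e j))) = (\<Sum>i\<in>UNIV. \<Sum>j\<in>UNIV. g (?e i) (?e j) (cross (?e i) (?e j)))"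
  proof -
    have "(\<Sum>i\<in>UNIV. \<Sum>j\<in>UNIV. f (?e i) (?e j) (cross (?e i) (?e j))) = (\<Sum>i\<in>UNIV. \<Sum>j\<in>UNIV. \<Sum>k\<in>UNIV.
        P3 (?e i) (?e j) (?e k) * P3 (transpose E *v ?e i) (transpose E *v ?e j) (transpose E *v ?e k))"
      unfolding sum_P3_cross[OF f] by (simp only: f_def pb3_def)
    also have "\<dots> = (\<Sum>i\<in>UNIV. \<Sum>j\<in>UNIV. g (?e i) (?e j) (cross (?e i) (?e j)))"
      unfolding sum_P3_cross[OF ga] contraction_adjoint[OF alt3_P3 alt3_P3, of E, symmetric]
      by (simp only: g_def pb3_def mult.commute)
    finally show ?thesis .
  qed
  also have "\<dots> > 0"
  proof -
    have "0 < g (?e 1) (?e 2) (cross (?e 1) (?e 2))"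
      unfolding g_def by (rule tp[OF indep]) simp
    also have "\<dots> \<le> (\<Sum>j\<in>UNIV. g (?e 1) (?e j) (cross (?e 1) (?e j)))"
      by (rule member_le_sum) (auto simp: gnn)
    also have "\<dots> \<le> (\<Sum>i\<in>UNIV. \<Sum>j\<in>UNIV. g (?e i) (?e j) (cross (?e i) (?e j)))"
      by (rule member_le_sum[of 1 UNIV "\<lambda>i. \<Sum>j\<in>UNIV. g (?e i) (?e j) (cross (?e i) (?e j))"]) (auto intro: sum_nonneg gnn)
    finally show ?thesis .
  qed
  finally have "\<not> (\<forall>i j. f (?e i) (?e j) (cross (?e i) (?e j)) \<le> 0)"
    by (meson leD sum_nonpos)
  then obtain i j where ij: "f (?e i) (?e j) (cross (?e i) (?e j)) > 0" by (auto simp: not_le)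
  then have "i \<noteq> j" by (auto simp: cross_simps alt3_simps[OF f])
  show ?thesis
    unfolding tame3_def f_def[symmetric]
    by (auto intro!: cross_sign_constant[OF f nz indep[OF \<open>i \<noteq> j\<close>] ij])
qed

section \<open>Tame 4-forms and their frames\<close>

definition tame4 :: "(real^7 \<Rightarrow> real^7 \<Rightarrow> real^7 \<Rightarrow> real^7 \<Rightarrow> real) \<Rightarrow> bool" where
  "tame4 f \<longleftrightarrow> tame3 (star f)"

lemma tame4_lin:
  assumes "tame4 f" "tame4 g" "s \<ge> 0" "t \<ge> 0" "\<not> (s = 0 \<and> t = 0)"
  shows "tame4 (\<lambda>u v w z. s * f u v w z + t * g u v w z)"
  using tame3_lin[OF assms[unfolded tame4_def]] by (simp add: tame4_def tame3_def star_lin)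

lemma star_frame:
  assumes "alt4 f" "pb4 E f = S4"
  shows "24 * P3 (transpose E *v a) (transpose E *v b) (transpose E *v c) = det E * star f a b c"
  using star_pb4[OF assms(1), of E a b c] by (simp only: assms(2) star_S4)

text \<open>By \<open>star_frame\<close> the form \<open>star f\<close> is a positive multiple of
  the pull-back of \<open>P3\<close> by \<open>transpose E\<close>, and
  \<open>tame3_transpose\<close> replaces the transpose by \<open>E\<close>. This matches taming
  through coassociative planes with taming through associative ones.\<close>

lemma tame4_frame_iff:
  assumes f: "alt4 f" and E: "pb4 E f = S4" "det E > 0"
  shows "tame4 f \<longleftrightarrow> tame3 (pb3 E P3)"
proof -
  have inv: "invertible E" "invertible (transpose E)" using E(2) by (simp_all add: invertible_det_nz)
  have "star f a b c = 24 / det E * pb3 (transpose E) P3 a b c" for a b c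
    unfolding pb3_def using star_frame[OF f E(1), of a b c] E(2) by (simp add: field_simps del: transpose_matrix_vector)
  then have "tame4 f \<longleftrightarrow> tame3 (pb3 (transpose E) P3)"
    unfolding tame4_def tame3_def using E(2) by (simp add: zero_less_mult_iff zero_less_divide_iff)
  also have "\<dots> \<longleftrightarrow> tame3 (pb3 E P3)"
    using tame3_transpose[OF inv(1)] tame3_transpose[OF inv(2)] by (auto simp: transpose_transpose)
  finally show ?thesis .
qed

lemma tame4_frame:
  assumes f: "alt4 f" "tame4 f"
  shows "\<exists>E. det E > 0 \<and> pb4 E f = S4"
proof -
  obtain A where A: "det A > 0" "pb3 A (star f) = P3"
    using tame3_frame[OF alt3_star] f(2) unfolding tame4_def by blast
  have inv: "invertible A" using A(1) by (simp add: invertible_det_nz)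
  then obtain B where B: "A ** B = mat 1" "B ** A = mat 1" unfolding invertible_def by blast
  \<comment> \<open>With \<open>E\<close> equal to \<open>s\<close> times the transpose of
    \<open>B\<close>, equivariance yields \<open>star (pb4 E f) = s ^ 4 * det B * P3\<close>, and
    the factor has to be 24.\<close>
  define s where "s = root 4 (24 * det A)"
  have s: "s > 0" "s ^ 4 = 24 * det A" using A(1) by (simp_all add: s_def)
  define E where "E = s *\<^sub>R transpose B"
  have tE: "transpose E *v x = s *\<^sub>R (B *v x)" for x
  proof -
    have "transpose E = s *\<^sub>R B" by (simp add: E_def transpose_def vec_eq_iff)
    then show ?thesis by (simp only: scaleR_matrix_vector_assoc)
  qed
  have BA: "B *v (A *v x) = x" for x by (simp only: matrix_vector_mul_assoc B matrix_vector_mul_lid)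
  have detB: "det A * det B = 1" by (metis B(1) det_I det_mul)
  then have dB: "det B > 0" using A(1) by (metis zero_less_mult_pos zero_less_one)
  have dE: "det E = s ^ 7 * det B" by (simp add: E_def det_scaleR)
  have "star (pb4 E f) = star S4"
  proof (intro ext)
    fix a b c
    have "s ^ 3 * star (pb4 E f) a b c = star (pb4 E f) (s *\<^sub>R a) (s *\<^sub>R b) (s *\<^sub>R c)"
      by (simp add: alt3_simps[OF alt3_star] power3_eq_cube)
    also have "\<dots> = star (pb4 E f) (transpose E *v (A *v a)) (transpose E *v (A *v b)) (transpose E *v (A *v c))"
      by (simp only: tE BA)
    also have "\<dots> = det E * star f (A *v a) (A *v b) (A *v c)" by (rule star_pb4[OF f(1)])
    also have "star f (A *v a) (A *v b) (A *v c) = P3 a b c" using A(2) by (metis pb3_def)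
    also have "det E = s ^ 3 * (s ^ 4 * det B)" by (simp add: dE power_add[symmetric] flip: mult.assoc)
    also have "s ^ 4 * det B = 24" using detB s(2) by simp
    finally show "star (pb4 E f) a b c = star S4 a b c" using s(1) by (simp add: star_S4)
  qed
  then have "pb4 E f = S4" by (rule star_inject[OF alt4_pb4[OF f(1)] alt4_S4])
  moreover have "det E > 0" using dE dB s(1) by simp
  ultimately show ?thesis by blast
qed

lemma pb4_S4_invertible:
  assumes f: "alt4 f" and E: "pb4 E f = S4" shows "invertible E"
proof -
  have "w = 0" if "E *v w = 0" for w
  proof -
    have "f 0 u v z = 0" for u v z using alt4_simps(5)[OF f, of 0] by simp
    then have z: "S4 w u v z = 0" for u v z
      using that unfolding E[symmetric] pb4_def by simp
    have "S4 w (axis 5 1) (axis 6 1) (axis 0 1) = w $ 4" "S4 w (axis 4 1) (axis 6 1) (axis 0 1) = - w $ 5"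
      "S4 w (axis 4 1) (axis 5 1) (axis 0 1) = w $ 6" "S4 w (axis 4 1) (axis 5 1) (axis 6 1) = - w $ 0"
      "S4 w (axis 3 1) (axis 6 1) (axis 0 1) = w $ 2" "S4 w (axis 2 1) (axis 6 1) (axis 0 1) = - w $ 3"
      "S4 w (axis 3 1) (axis 5 1) (axis 0 1) = w $ 1"
      by (simp_all add: S4_expand dx_4 dx_3 axis_def)
    then show ?thesis unfolding vec_eq_iff forall_7 by (simp add: z)
  qed
  then show ?thesis
    unfolding invertible_left_inverse matrix_left_invertible_ker by blast
qed

text \<open>The degree is even while the dimension is odd: negation preserves 4-forms and, by
  \<open>det_minus_7\<close>, reverses orientation. So adapted frames of a 4-form occur in both
  orientations.\<close>

lemma pb4_minus:
  assumes "alt4 f" shows "pb4 (- E) f = pb4 E f"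
proof -
  have "(- E) *v x = - (E *v x)" for x
    by (simp add: matrix_vector_mult_def vec_eq_iff sum_negf)
  then show ?thesis
    by (intro ext) (simp add: pb4_def linear_neg[OF alt4D(1)[OF assms]] linear_neg[OF alt4D(2)[OF assms]]
        linear_neg[OF alt4D(3)[OF assms]] linear_neg[OF alt4D(4)[OF assms]])
qed

lemma det_minus_7: "det (- E :: real^7^7) = - det E"
  using det_scaleR[of "-1" E] by simp

text \<open>Transfers bounds from 3-forms to 4-forms. The inverse transpose of \<open>E\<close> is
  adapted to the dual 3-form up to scale. The scale \<open>r\<close> must satisfy
  \<open>r ^ 3 = det E\<close>, which gives \<open>det F = r ^ 7 / det E = r ^ 4\<close>.\<close>

lemma frames4_rescaled:
  assumes f: "alt4 f" and E: "pb4 E f = S4" "det E > 0"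
  defines "h \<equiv> (\<lambda>a b c. star f a b c / 24)"
  shows "\<exists>F. pb3 F h = P3 \<and> invertible F \<and> (\<exists>r>0. det F = r ^ 4 \<and> (\<forall>u. F *v (transpose E *v u) = r *\<^sub>R u))"
proof -
  define r where "r = root 3 (det E)"
  have r: "r > 0" "r ^ 3 = det E" using E(2) by (simp_all add: r_def)
  have "invertible (transpose E)" using E(2) by (simp add: invertible_det_nz)
  then obtain G where G: "transpose E ** G = mat 1" "G ** transpose E = mat 1" unfolding invertible_def by blast
  have EG: "transpose E *v (G *v x) = x" "G *v (transpose E *v x) = x" for x
    by (simp_all only: matrix_vector_mul_assoc G matrix_vector_mul_lid)
  define F where "F = r *\<^sub>R G"
  have F: "F *v x = r *\<^sub>R (G *v x)" for x by (simp add: F_def scaleR_matrix_vector_assoc)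
  have chi: "alt3 h" unfolding h_def using alt3_lin[OF alt3_star alt3_star, of "1/24" f 0] by simp
  have P: "pb3 F h = P3"
  proof (intro ext)
    fix a b c
    have "pb3 F h a b c = det E * h (G *v a) (G *v b) (G *v c)"
      by (simp add: pb3_def F alt3_simps[OF chi] r(2)[symmetric] power3_eq_cube)
    also have "\<dots> = P3 a b c"
      using star_frame[OF f E(1), of "G *v a" "G *v b" "G *v c"] unfolding EG by (simp add: h_def)
    finally show "pb3 F h a b c = P3 a b c" .
  qed
  have "det E * det G = 1" using arg_cong[OF G(1), of det] by (simp add: det_mul)
  then have "r ^ 4 = r ^ 4 * (det E * det G)" by simp
  also have "\<dots> = det F" unfolding r(2)[symmetric] F_def det_scaleR by (simp add: power_add[symmetric] flip: mult.assoc)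
  finally have "det F = r ^ 4" by simp
  moreover have "F *v (transpose E *v u) = r *\<^sub>R u" for u by (simp only: F EG)
  ultimately show ?thesis
    using P pb3_P3_invertible[OF chi P] r(1) by blast
qed

text \<open>The frames \<open>F\<close> of the dual 3-forms and their inverses are bounded by
  \<open>frames_bounded\<close>. As \<open>det F = r ^ 4\<close>, this bounds \<open>r\<close>, and
  \<open>transpose E\<close> is \<open>r\<close> times the inverse of \<open>F\<close>. Negative
  determinants are reduced to positive ones by \<open>pb4_minus\<close>.\<close>

lemma compact_frames4:
  fixes f :: "'p::heine_borel \<Rightarrow> real^7 \<Rightarrow> real^7 \<Rightarrow> real^7 \<Rightarrow> real^7 \<Rightarrow> real"
  assumes K: "compact K" and alt: "\<And>p. p \<in> K \<Longrightarrow> alt4 (f p)" and fr: "\<And>p. p \<in> K \<Longrightarrow> \<exists>E. pb4 E (f p) = S4"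
    and cont: "\<And>i j k l. continuous_on K (\<lambda>p. f p (axis i 1) (axis j 1) (axis k 1) (axis l 1))"
  shows "compact {(p, E). p \<in> K \<and> pb4 E (f p) = S4}"
proof -
  define h where "h = (\<lambda>p a b c. star (f p) a b c / 24)"
  have chi: "alt3 (h p)" for p unfolding h_def using alt3_lin[OF alt3_star alt3_star, of "1/24" "f p" 0] by simp
  have pos: "\<exists>E'. pb4 E' (f p) = S4 \<and> det E' > 0 \<and> (E' = E \<or> E' = - E)" if "p \<in> K" "pb4 E (f p) = S4" for p E
  proof -
    have "det E \<noteq> 0" using pb4_S4_invertible[OF alt[OF that(1)] that(2)] by (simp add: invertible_det_nz)
    moreover have "pb4 (- E) (f p) = S4" using pb4_minus[OF alt[OF that(1)]] that(2) by simp
    ultimately show ?thesis using that(2) by (cases "det E > 0") (auto simp: det_minus_7)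
  qed
  have "\<exists>R>0. \<forall>p\<in>K. \<forall>E w. pb3 E (h p) = P3 \<longrightarrow> norm (E *v w) \<le> R * norm w \<and> norm w \<le> R * norm (E *v w)"
  proof (rule frames_bounded[OF K chi])
    fix p assume p: "p \<in> K"
    obtain E where E: "pb4 E (f p) = S4" "det E > 0" using pos fr p by blast
    from frames4_rescaled[OF alt[OF p] E] show "nondeg3 (h p)"
      unfolding h_def using nondeg3_pb3 by blast
  next
    show "continuous_on K (\<lambda>p. h p (axis i 1) (axis j 1) (axis k 1))" for i j k
      unfolding h_def star_def by (intro continuous_intros cont) simp
  qed
  then obtain R where R: "R > 0" "\<And>p E w. p \<in> K \<Longrightarrow> pb3 E (h p) = P3 \<Longrightarrow> norm (E *v w) \<le> R * norm w"
    "\<And>p E w. p \<in> K \<Longrightarrow> pb3 E (h p) = P3 \<Longrightarrow> norm w \<le> R * norm (E *v w)" by blast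
  define Q where "Q = max 1 (fact 7 * R ^ 7)"
  have entries: "\<bar>E $ i $ j\<bar> \<le> R * Q" if p: "p \<in> K" and E: "pb4 E (f p) = S4" "det E > 0" for p E i j
  proof -
    obtain F r where F: "pb3 F (h p) = P3" and r: "r > 0" "det F = r ^ 4" "\<And>u. F *v (transpose E *v u) = r *\<^sub>R u"
      using frames4_rescaled[OF alt[OF p] E] unfolding h_def by blast
    have "\<bar>F $ i $ j\<bar> \<le> R" for i j
      using R(2)[OF p F, of "axis j 1"] component_le_norm_cart[of "F *v axis j 1" i]
      by (simp add: matrix_axis norm_axis_1)
    then have "r ^ 4 \<le> fact 7 * R ^ 7" using abs_det_le[of F R] r by simp
    then have "r \<le> Q"
      unfolding Q_def using power_le_scaled[of r 4 "fact 7 * R ^ 7" 1] r(1) by simp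
    moreover have "norm (transpose E *v axis i 1) \<le> R * norm (F *v (transpose E *v axis i 1))"
      by (rule R(3)[OF p F])
    then have "norm (transpose E *v axis i 1) \<le> R * r"
      unfolding r(3) using r(1) by (simp add: norm_axis_1)
    ultimately have "norm (transpose E *v axis i 1) \<le> R * Q"
      using R(1) by (meson mult_left_mono order_trans less_imp_le)
    moreover have "(transpose E *v axis i 1) $ j = E $ i $ j"
      by (simp only: matrix_axis transpose_def vec_lambda_beta)
    ultimately show ?thesis using component_le_norm_cart[of "transpose E *v axis i 1" j] by simp
  qed
  define B where "B = 7 * (7 * (R * Q))"
  have B: "norm E \<le> B" if pE: "p \<in> K" "pb4 E (f p) = S4" for p E
  proof -
    obtain E' where E': "pb4 E' (f p) = S4" "det E' > 0" "E' = E \<or> E' = - E" using pos[OF pE] by blast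
    have "norm E' \<le> B" using norm_matrix_le[of E' "R * Q"] entries[OF pE(1) E'(1,2)] by (simp add: B_def)
    then show ?thesis using E'(3) by auto
  qed
  define g where "g = (\<lambda>(i, j, k, l) (p, E :: real^7^7). \<Sum>a\<in>UNIV. \<Sum>b\<in>UNIV. \<Sum>c\<in>UNIV. \<Sum>d\<in>UNIV.
      (E *v axis i 1) $ a * ((E *v axis j 1) $ b * ((E *v axis k 1) $ c * ((E *v axis l 1) $ d *
        f p (axis a 1) (axis b 1) (axis c 1) (axis d 1)))))"
  define S where "S = (\<lambda>(i, j, k, l). S4 (axis i 1) (axis j 1) (axis k 1) (axis l 1))"
  define Z where "Z = K \<times> cball (0 :: real^7^7) B"
  have g: "g (i, j, k, l) (p, E) = pb4 E (f p) (axis i 1) (axis j 1) (axis k 1) (axis l 1)" if "p \<in> K" for i j k l p E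
    unfolding g_def pb4_def case_prod_conv by (rule alt4_expand[OF alt[OF that], symmetric])
  have "compact {x \<in> Z. \<forall>i. g i x = S i}"
  proof (rule compact_Collect_eq)
    show "compact Z" by (simp add: Z_def K compact_Times)
    have c: "continuous_on Z (\<lambda>x. f (fst x) (axis a 1) (axis b 1) (axis c 1) (axis d 1))" for a b c d
      by (rule continuous_on_compose2[OF cont continuous_on_fst[OF continuous_on_id]]) (auto simp: Z_def)
    show "continuous_on Z (g i)" for i
      unfolding g_def case_prod_unfold by (intro continuous_intros c)
  qed
  also have "{x \<in> Z. \<forall>i. g i x = S i} = {(p, E). p \<in> K \<and> pb4 E (f p) = S4}"
  proof -
    have eq: "pb4 E (f p) = S4 \<longleftrightarrow> (\<forall>i. g i (p, E) = S i)" if p: "p \<in> K" for p E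
    proof
      assume *: "\<forall>i. g i (p, E) = S i"
      have e: "pb4 E (f p) (axis i 1) (axis j 1) (axis k 1) (axis l 1) = S4 (axis i 1) (axis j 1) (axis k 1) (axis l 1)" for i j k l
        using *[rule_format, of "(i, j, k, l)"] by (simp add: g[OF p] S_def)
      show "pb4 E (f p) = S4"
      proof (intro ext)
        show "pb4 E (f p) u v w z = S4 u v w z" for u v w z
          unfolding alt4_expand[OF alt4_pb4[OF alt[OF p]], of E u] alt4_expand[OF alt4_S4, of u] e ..
      qed
    qed (auto simp: g[OF p] S_def)
    show ?thesis using B eq by (auto simp: Z_def)
  qed
  finally show ?thesis .
qed


section \<open>Smooth functions, charts and frames\<close>

lemma frechet_derivative_eqI: "(f has_derivative f') (at x) \<Longrightarrow> frechet_derivative f (at x) = f'"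
  by (metis frechet_derivative_at)

lemma frechet_derivative_cong_open:
  assumes "open S" "x \<in> S" "\<And>y. y \<in> S \<Longrightarrow> f y = g y" "f differentiable (at x)"
  shows "g differentiable (at x)" "frechet_derivative g (at x) = frechet_derivative f (at x)"
proof -
  have "(f has_derivative frechet_derivative f (at x)) (at x)"
    using assms(4) by (simp add: frechet_derivative_works)
  then have "(g has_derivative frechet_derivative f (at x)) (at x)"
    using assms(1-3) by (rule has_derivative_transform_within_open)
  then show "g differentiable (at x)" "frechet_derivative g (at x) = frechet_derivative f (at x)"
    by (auto simp: differentiable_def frechet_derivative_eqI)
qed

text \<open>Openness of \<open>S\<close> makes derivatives at its points depend on the values in
  \<open>S\<close> alone, so the induction can pass to derivatives.\<close>

lemma ck_on_cong:
  assumes "open S" "\<And>x. x \<in> S \<Longrightarrow> f x = g x" "ck_on n S f"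
  shows "ck_on n S g"
  using assms(2,3)
proof (induction n arbitrary: f g)
  case 0
  then show ?case using continuous_on_eq[of S f g] by simp
next
  case (Suc n)
  note fd = frechet_derivative_cong_open[OF assms(1) _ Suc.prems(1)]
  have d: "f differentiable (at x)" if "x \<in> S" for x using Suc.prems(2) that by simp
  show ?case
  proof (simp, intro conjI ballI allI)
    show "g differentiable (at x)" if "x \<in> S" for x using fd(1)[OF that] d[OF that] by simp
    show "ck_on n S (\<lambda>x. frechet_derivative g (at x) v)" for v
    proof (rule Suc.IH[rotated])
      show "ck_on n S (\<lambda>x. frechet_derivative f (at x) v)" using Suc.prems(2) by simp
      show "frechet_derivative f (at x) v = frechet_derivative g (at x) v" if "x \<in> S" for x
        using fd(2)[OF that] d[OF that] by simp
    qed
  qed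
qed

lemma has_derivative_lin:
  assumes "f differentiable (at x)" "g differentiable (at x)"
  shows "((\<lambda>x. s *\<^sub>R f x + t *\<^sub>R g x) has_derivative
    (\<lambda>v. s *\<^sub>R frechet_derivative f (at x) v + t *\<^sub>R frechet_derivative g (at x) v)) (at x)"
  using assms unfolding frechet_derivative_works
  by (intro has_derivative_add has_derivative_scaleR_right)

lemma ck_on_lin:
  assumes "open S" "ck_on n S f" "ck_on n S g"
  shows "ck_on n S (\<lambda>x. s *\<^sub>R f x + t *\<^sub>R g x)"
  using assms(2,3)
proof (induction n arbitrary: f g)
  case 0
  then show ?case by (auto intro!: continuous_intros)
next
  case (Suc n)
  have d: "f differentiable (at x)" "g differentiable (at x)" if "x \<in> S" for x using Suc.prems that by auto
  show ?case
  proof (simp, intro conjI ballI allI)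
    show "(\<lambda>x. s *\<^sub>R f x + t *\<^sub>R g x) differentiable (at x)" if "x \<in> S" for x
      using has_derivative_lin[OF d[OF that]] differentiable_def by blast
    show "ck_on n S (\<lambda>x. frechet_derivative (\<lambda>x. s *\<^sub>R f x + t *\<^sub>R g x) (at x) v)" for v
    proof (rule ck_on_cong[OF assms(1)])
      show "ck_on n S (\<lambda>x. s *\<^sub>R frechet_derivative f (at x) v + t *\<^sub>R frechet_derivative g (at x) v)"
        using Suc by auto
      show "s *\<^sub>R frechet_derivative f (at x) v + t *\<^sub>R frechet_derivative g (at x) v =
        frechet_derivative (\<lambda>x. s *\<^sub>R f x + t *\<^sub>R g x) (at x) v" if "x \<in> S" for x
        by (simp add: frechet_derivative_eqI[OF has_derivative_lin[OF d[OF that]]])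
    qed
  qed
qed

lemma smooth_on_lin:
  "open S \<Longrightarrow> smooth_on S f \<Longrightarrow> smooth_on S g \<Longrightarrow> smooth_on S (\<lambda>x. s *\<^sub>R f x + t *\<^sub>R g x)"
  unfolding smooth_on_def using ck_on_lin by blast

lemma smooth_on_continuous_on: "smooth_on S f \<Longrightarrow> continuous_on S f"
  unfolding smooth_on_def by (metis ck_on.simps(1))

lemma smooth_on_differentiable: "smooth_on S f \<Longrightarrow> x \<in> S \<Longrightarrow> f differentiable (at x)"
  unfolding smooth_on_def by (metis ck_on.simps(2))

lemma ck_on_const: "ck_on n S (\<lambda>x. c)"
proof (induction n arbitrary: c)
  case (Suc n)
  have "frechet_derivative (\<lambda>x. c) (at x) = (\<lambda>v. 0)" for x
    by (rule frechet_derivative_eqI) simp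
  then show ?case using Suc by simp
qed simp

lemma smooth_on_const: "smooth_on S (\<lambda>x. c)"
  unfolding smooth_on_def using ck_on_const by blast

section \<open>Charts and transition maps\<close>

lemma atlas_homeo:
  assumes "smooth_atlas A" "c \<in> A"
  shows "open (fst c)" "open (snd c ` fst c)" "homeomorphism (fst c) (snd c ` fst c) (snd c) (chart_inv c)"
  using assms unfolding smooth_atlas_def by auto

lemma chart_inv_chart:
  assumes "smooth_atlas A" "c \<in> A" "x \<in> fst c"
  shows "chart_inv c (snd c x) = x"
  using atlas_homeo(3)[OF assms(1,2)] assms(3) by (simp add: homeomorphism_def)

lemma atlas_chart: "smooth_atlas A \<Longrightarrow> \<exists>c\<in>A. x \<in> fst c"
  unfolding smooth_atlas_def by blast

lemma open_chart_image:
  assumes "smooth_atlas A" "c \<in> A" "open U" "U \<subseteq> fst c"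
  shows "open (snd c ` U)"
proof -
  note h = atlas_homeo[OF assms(1,2)]
  have "openin (top_of_set (fst c)) U" using assms(3,4) h(1) by (simp add: openin_open_eq)
  then have "openin (top_of_set (snd c ` fst c)) (snd c ` U)"
    by (rule homeomorphism_imp_open_map[OF h(3)])
  then show ?thesis using h(2) by (simp add: openin_open_eq)
qed

lemma transition_chart:
  assumes "smooth_atlas A" "c \<in> A" "x \<in> fst c"
  shows "transition c c' (snd c x) = snd c' x"
  using chart_inv_chart[OF assms] by (simp add: transition_def)

lemma transition_has_derivative:
  assumes "smooth_atlas A" "c \<in> A" "c' \<in> A" "x \<in> fst c" "x \<in> fst c'"
  shows "(transition c c' has_derivative frechet_derivative (transition c c') (at (snd c x))) (at (snd c x))"
proof -
  have "smooth_on (snd c ` (fst c \<inter> fst c')) (transition c c')"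
    using assms unfolding smooth_atlas_def by blast
  then have "transition c c' differentiable (at (snd c x))"
    by (rule smooth_on_differentiable) (use assms in auto)
  then show ?thesis by (simp add: frechet_derivative_works)
qed

lemma linear_transition_derivative:
  assumes "smooth_atlas A" "c \<in> A" "c' \<in> A" "x \<in> fst c" "x \<in> fst c'"
  shows "linear (frechet_derivative (transition c c') (at (snd c x)))"
  using transition_has_derivative[OF assms] by (rule has_derivative_linear)

text \<open>The chain rule; the maps agree on the image of the triple overlap, which has to be open
  for their derivatives to agree.\<close>

lemma transition_cocycle:
  assumes A: "smooth_atlas A" and c: "c \<in> A" "c' \<in> A" "c'' \<in> A" and x: "x \<in> fst c" "x \<in> fst c'" "x \<in> fst c''"
  shows "frechet_derivative (transition c c'') (at (snd c x)) w =
    frechet_derivative (transition c' c'') (at (snd c' x)) (frechet_derivative (transition c c') (at (snd c x)) w)"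
proof -
  let ?U = "fst c \<inter> fst c' \<inter> fst c''"
  have "open ?U" by (intro open_Int atlas_homeo(1)[OF A] c)
  then have U: "open (snd c ` ?U)" by (rule open_chart_image[OF A c(1)]) auto
  have "(transition c' c'' has_derivative frechet_derivative (transition c' c'') (at (snd c' x))) (at (transition c c' (snd c x)))"
    unfolding transition_chart[OF A c(1) x(1)] by (rule transition_has_derivative[OF A c(2,3) x(2,3)])
  then have "(transition c' c'' \<circ> transition c c' has_derivative
      frechet_derivative (transition c' c'') (at (snd c' x)) \<circ> frechet_derivative (transition c c') (at (snd c x))) (at (snd c x))"
    by (rule diff_chain_at[OF transition_has_derivative[OF A c(1,2) x(1,2)]])
  then have "(transition c c'' has_derivative
      frechet_derivative (transition c' c'') (at (snd c' x)) \<circ> frechet_derivative (transition c c') (at (snd c x))) (at (snd c x))"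
  proof (rule has_derivative_transform_within_open[OF _ U])
    show "snd c x \<in> snd c ` ?U" using x by auto
    show "(transition c' c'' \<circ> transition c c') y = transition c c'' y" if "y \<in> snd c ` ?U" for y
      using that by (auto simp: transition_chart[OF A c(1)] transition_chart[OF A c(2)])
  qed
  from frechet_derivative_eqI[OF this] show ?thesis by simp
qed

lemma transition_self:
  assumes A: "smooth_atlas A" and c: "c \<in> A" "x \<in> fst c"
  shows "frechet_derivative (transition c c) (at (snd c x)) w = w"
proof -
  have "(transition c c has_derivative (\<lambda>w. w)) (at (snd c x))"
  proof (rule has_derivative_transform_within_open[OF has_derivative_ident atlas_homeo(2)[OF A c(1)]])
    show "snd c x \<in> snd c ` fst c" using c by auto
    show "y = transition c c y" if "y \<in> snd c ` fst c" for y
      using that by (auto simp: transition_chart[OF A c(1)])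
  qed
  from frechet_derivative_eqI[OF this] show ?thesis by simp
qed

text \<open>The inverse map reads off the coordinate vector in \<open>c\<close>, which determines a
  tangent vector; \<open>transition_cocycle\<close> makes the image family compatible.\<close>

lemma coord_frame_in_frames:
  assumes A: "smooth_atlas A" and c: "c \<in> A" "x \<in> fst c"
  shows "coord_frame A c x \<in> frames A x"
proof -
  let ?e = "coord_frame A c x"
  have ev: "?e w c' = frechet_derivative (transition c c') (at (snd c x)) w" if "c' \<in> A" "x \<in> fst c'" for w c'
    using that by (simp only: coord_frame_def simp_thms if_True)
  have e0: "?e w c' = 0" if "\<not> (c' \<in> A \<and> x \<in> fst c')" for w c'
    using that by (simp only: coord_frame_def if_False)
  have "?e w \<in> tangent A x" for w
    unfolding tangent_def
  proof (intro CollectI conjI allI ballI impI)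
    fix c' c'' assume c': "c' \<in> A" "c'' \<in> A" "x \<in> fst c' \<and> x \<in> fst c''"
    then show "?e w c'' = frechet_derivative (transition c' c'') (at (snd c' x)) (?e w c')"
      using transition_cocycle[OF A c(1) c'(1,2) c(2)] by (simp only: ev)
  qed (rule e0)
  moreover have "?e w c = w" for w
    unfolding coord_frame_def using transition_self[OF A c] c by simp
  then have "inj ?e" by (metis injI)
  moreover have "v = ?e (v c)" if v: "v \<in> tangent A x" for v
  proof
    fix c'
    show "v c' = ?e (v c) c'"
    proof (cases "c' \<in> A \<and> x \<in> fst c'")
      case True
      then have "v c' = frechet_derivative (transition c c') (at (snd c x)) (v c)"
        using v c unfolding tangent_def by blast
      then show ?thesis using True by (simp only: ev)
    next
      case False
      then have "v c' = 0" using v unfolding tangent_def by blast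
      then show ?thesis using e0[OF False, of "v c"] by (rule trans[OF _ sym])
    qed
  qed
  ultimately have "bij_betw ?e UNIV (tangent A x)"
    unfolding bij_betw_def by (auto intro: inj_on_subset)
  moreover have "?e (a *\<^sub>R u + b *\<^sub>R v) = tlin a (?e u) b (?e v)" for a u b v
  proof
    fix c'
    show "?e (a *\<^sub>R u + b *\<^sub>R v) c' = tlin a (?e u) b (?e v) c'"
    proof (cases "c' \<in> A \<and> x \<in> fst c'")
      case True
      then have l: "linear (frechet_derivative (transition c c') (at (snd c x)))"
        using linear_transition_derivative[OF A c(1) _ c(2)] by blast
      show ?thesis using True by (simp only: ev tlin_def linear_add[OF l] linear_scale[OF l])
    next
      case False
      show ?thesis unfolding e0[OF False] tlin_def by simp
    qed
  qed
  ultimately show ?thesis by (simp add: frames_def)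
qed

section \<open>Frames and their orientation classes\<close>

lemma framesD:
  assumes "e \<in> frames A x"
  shows "inj e" "range e = tangent A x" "e (a *\<^sub>R u + b *\<^sub>R v) = tlin a (e u) b (e v)" "inv e (e w) = w"
    "v' \<in> tangent A x \<Longrightarrow> e (inv e v') = v'" "e w \<in> tangent A x"
proof -
  show "inj e" "range e = tangent A x" "e (a *\<^sub>R u + b *\<^sub>R v) = tlin a (e u) b (e v)"
    using assms by (auto simp: frames_def bij_betw_def)
  then show "inv e (e w) = w" "v' \<in> tangent A x \<Longrightarrow> e (inv e v') = v'" "e w \<in> tangent A x"
    by (auto simp: f_inv_into_f)
qed

text \<open>Two linear isomorphisms onto the same space differ by an automorphism of the model. The
  last conclusion ties its matrix to the one in \<open>same_orient\<close>.\<close>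

lemma frames_matrix:
  assumes e: "e \<in> frames A x" and e': "e' \<in> frames A x"
  obtains E where "invertible E" "e' = (\<lambda>w. e (E *v w))" "matrix (inv e \<circ> e') = E"
proof -
  note D = framesD[OF e] and D' = framesD[OF e']
  have lin: "linear (inv g \<circ> h)" if g: "g \<in> frames A x" and h: "h \<in> frames A x" for g h
  proof -
    note G = framesD[OF g] and H = framesD[OF h]
    have *: "inv g (h (a *\<^sub>R u + b *\<^sub>R v)) = a *\<^sub>R inv g (h u) + b *\<^sub>R inv g (h v)" for a u b v
    proof -
      have "g (a *\<^sub>R inv g (h u) + b *\<^sub>R inv g (h v)) = h (a *\<^sub>R u + b *\<^sub>R v)"
        by (simp add: G(3) H(3) G(5)[OF H(6)])
      then show ?thesis by (metis G(4))
    qed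
    show ?thesis
      using *[of 1 _ 1] *[of _ _ 0] by (intro linearI) simp_all
  qed
  define E where "E = matrix (inv e \<circ> e')"
  define E' where "E' = matrix (inv e' \<circ> e)"
  have E: "E *v w = inv e (e' w)" for w using matrix_works[of "inv e \<circ> e'" w] lin[OF e e'] by (simp add: E_def linear_matrix_vector_mul_eq)
  have E': "E' *v w = inv e' (e w)" for w using matrix_works[of "inv e' \<circ> e" w] lin[OF e' e] by (simp add: E'_def linear_matrix_vector_mul_eq)
  have "E *v (E' *v w) = w" "E' *v (E *v w) = w" for w
    using D'(5)[OF D(6)] D(5)[OF D'(6)] by (simp_all add: E E' D(4) D'(4))
  then have "E ** E' = mat 1" "E' ** E = mat 1"
    unfolding matrix_eq by (simp_all flip: matrix_vector_mul_assoc)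
  then have "invertible E" unfolding invertible_def by blast
  moreover have "e' = (\<lambda>w. e (E *v w))" using D(5)[OF D'(6)] by (simp add: E)
  ultimately show ?thesis by (rule that[OF _ _ E_def[symmetric]])
qed

lemma frames_compose:
  assumes e: "e \<in> frames A x" and E: "invertible E"
  shows "(\<lambda>w. e (E *v w)) \<in> frames A x" "matrix (inv e \<circ> (\<lambda>w. e (E *v w))) = E"
proof -
  note D = framesD[OF e]
  obtain F where F: "E ** F = mat 1" "F ** E = mat 1" using E unfolding invertible_def by blast
  have "bij ((*v) E)"
    by (rule bij_betwI[of _ _ _ "(*v) F"]) (auto simp: matrix_vector_mul_assoc F)
  moreover have "bij_betw e UNIV (tangent A x)" using e by (simp add: frames_def)
  ultimately have "bij_betw (\<lambda>w. e (E *v w)) UNIV (tangent A x)"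
    using bij_betw_trans[of "(*v) E" UNIV UNIV e] by (simp add: comp_def)
  then show "(\<lambda>w. e (E *v w)) \<in> frames A x"
    using D(3) by (auto simp: frames_def matrix_vector_right_distrib matrix_vector_mult_scaleR)
  have "inv e \<circ> (\<lambda>w. e (E *v w)) = (*v) E" by (auto simp: D(4))
  then show "matrix (inv e \<circ> (\<lambda>w. e (E *v w))) = E" by (simp add: matrix_of_matrix_vector_mul)
qed

lemma same_orient_compose:
  assumes e: "e \<in> frames A x" and E: "invertible E"
  shows "same_orient e (\<lambda>w. e (E *v w)) \<longleftrightarrow> det E > 0"
  using frames_compose(2)[OF assms] by (simp add: same_orient_def)

lemma same_orient_trans:
  assumes "e \<in> frames A x" "e' \<in> frames A x" "e'' \<in> frames A x"
  shows "same_orient e e" "same_orient e e' \<Longrightarrow> same_orient e' e"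
    "same_orient e e' \<Longrightarrow> same_orient e' e'' \<Longrightarrow> same_orient e e''"
proof -
  obtain E where E: "invertible E" "e' = (\<lambda>w. e (E *v w))" using frames_matrix[OF assms(1,2)] by metis
  obtain F where F: "E ** F = mat 1" "F ** E = mat 1" using E unfolding invertible_def by blast
  have iF: "invertible F" using F unfolding invertible_def by blast
  obtain G where G: "invertible G" "e'' = (\<lambda>w. e' (G *v w))" using frames_matrix[OF assms(2,3)] by metis
  have "e = (\<lambda>w. e (mat 1 *v w))" by simp
  then show "same_orient e e" using same_orient_compose[OF assms(1), of "mat 1"]
    by (simp add: invertible_det_nz)
  have "e = (\<lambda>w. e' (F *v w))" by (simp add: E(2) matrix_vector_mul_assoc F)
  then have 1: "same_orient e' e \<longleftrightarrow> det F > 0" using same_orient_compose[OF assms(2) iF] by simp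
  have 2: "same_orient e e' \<longleftrightarrow> det E > 0" using same_orient_compose[OF assms(1) E(1)] E(2) by simp
  have "det E * det F = 1" by (metis F(1) det_I det_mul)
  then show "same_orient e e' \<Longrightarrow> same_orient e' e"
    unfolding 1 2 by (metis zero_less_mult_pos zero_less_one)
  have 3: "same_orient e' e'' \<longleftrightarrow> det G > 0" using same_orient_compose[OF assms(2) G(1)] G(2) by simp
  have "e'' = (\<lambda>w. e ((E ** G) *v w))" by (simp add: G(2) E(2) matrix_vector_mul_assoc)
  moreover have "invertible (E ** G)" using E(1) G(1) by (rule invertible_mult)
  ultimately have 4: "same_orient e e'' \<longleftrightarrow> det (E ** G) > 0" using same_orient_compose[OF assms(1)] by simp
  show "same_orient e e' \<Longrightarrow> same_orient e' e'' \<Longrightarrow> same_orient e e''"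
    unfolding 2 3 4 by (simp add: det_mul)
qed


section \<open>Associative planes and taming\<close>

definition form3 :: "(real^7 \<Rightarrow> 'a tvec) \<Rightarrow> ('a tvec list \<Rightarrow> real) \<Rightarrow> real^7 \<Rightarrow> real^7 \<Rightarrow> real^7 \<Rightarrow> real" where
  "form3 e \<alpha> u v w = \<alpha> [e u, e v, e w]"

definition form4 :: "(real^7 \<Rightarrow> 'a tvec) \<Rightarrow> ('a tvec list \<Rightarrow> real) \<Rightarrow> real^7 \<Rightarrow> real^7 \<Rightarrow> real^7 \<Rightarrow> real^7 \<Rightarrow> real" where
  "form4 e \<alpha> u v w z = \<alpha> [e u, e v, e w, e z]"

lemma form3_compose: "form3 (\<lambda>w. e (E *v w)) \<alpha> = pb3 E (form3 e \<alpha>)"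
  by (simp add: form3_def pb3_def fun_eq_iff)

lemma form4_compose: "form4 (\<lambda>w. e (E *v w)) \<alpha> = pb4 E (form4 e \<alpha>)"
  by (simp add: form4_def pb4_def fun_eq_iff)

lemma linear_from_lin:
  fixes f :: "'v::real_vector \<Rightarrow> real"
  assumes "\<And>a u b v. f (a *\<^sub>R u + b *\<^sub>R v) = a * f u + b * f v"
  shows "linear f"
  using assms[of 1 _ 1] assms[of _ _ 0] by (intro linearI) simp_all

lemma alt_form_atD:
  assumes "alt_form_at A k x \<alpha>"
  shows "\<not> (length vs = k \<and> set vs \<subseteq> tangent A x) \<Longrightarrow> \<alpha> vs = 0"
    "length vs = k \<Longrightarrow> set vs \<subseteq> tangent A x \<Longrightarrow> i < k \<Longrightarrow> u \<in> tangent A x \<Longrightarrow> w \<in> tangent A x \<Longrightarrow>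
      \<alpha> (vs[i := tlin a u b w]) = a * \<alpha> (vs[i := u]) + b * \<alpha> (vs[i := w])"
    "length vs = k \<Longrightarrow> i < k \<Longrightarrow> j < k \<Longrightarrow> i \<noteq> j \<Longrightarrow> vs ! i = vs ! j \<Longrightarrow> \<alpha> vs = 0"
  using assms unfolding alt_form_at_def by blast+

lemma alt3_form3:
  assumes e: "e \<in> frames A x" and a: "alt_form_at A 3 x \<alpha>"
  shows "alt3 (form3 e \<alpha>)"
proof -
  note D = framesD[OF e]
  have t: "set [e u, e v, e w] \<subseteq> tangent A x" for u v w using D(6) by auto
  show ?thesis
    unfolding alt3_def
  proof (intro conjI allI)
    show "linear (\<lambda>u. form3 e \<alpha> u v w)" for v w
      by (intro linear_from_lin) (use alt_form_atD(2)[OF a _ t[of 0 v w], of 0] D(3,6) in \<open>simp add: form3_def\<close>)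
    show "linear (\<lambda>v. form3 e \<alpha> u v w)" for u w
      by (intro linear_from_lin) (use alt_form_atD(2)[OF a _ t[of u 0 w], of 1] D(3,6) in \<open>simp add: form3_def\<close>)
    show "linear (form3 e \<alpha> u v)" for u v
      by (intro linear_from_lin) (use alt_form_atD(2)[OF a _ t[of u v 0], of 2] D(3,6) in \<open>simp add: form3_def\<close>)
    show "form3 e \<alpha> u u v = 0" for u v
      unfolding form3_def by (rule alt_form_atD(3)[OF a, of _ 0 1]) simp_all
    show "form3 e \<alpha> u v v = 0" for u v
      unfolding form3_def by (rule alt_form_atD(3)[OF a, of _ 1 2]) simp_all
  qed
qed

lemma alt4_form4:
  assumes e: "e \<in> frames A x" and a: "alt_form_at A 4 x \<alpha>"
  shows "alt4 (form4 e \<alpha>)"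
proof -
  note D = framesD[OF e]
  have t: "set [e u, e v, e w, e z] \<subseteq> tangent A x" for u v w z using D(6) by auto
  show ?thesis
    unfolding alt4_def
  proof (intro conjI allI)
    show "linear (\<lambda>u. form4 e \<alpha> u v w z)" for v w z
      by (intro linear_from_lin) (use alt_form_atD(2)[OF a _ t[of 0 v w z], of 0] D(3,6) in \<open>simp add: form4_def\<close>)
    show "linear (\<lambda>v. form4 e \<alpha> u v w z)" for u w z
      by (intro linear_from_lin) (use alt_form_atD(2)[OF a _ t[of u 0 w z], of 1] D(3,6) in \<open>simp add: form4_def\<close>)
    show "linear (\<lambda>w. form4 e \<alpha> u v w z)" for u v z
      by (intro linear_from_lin) (use alt_form_atD(2)[OF a _ t[of u v 0 z], of 2] D(3,6) in \<open>simp add: form4_def\<close>)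
    show "linear (form4 e \<alpha> u v w)" for u v w
      by (intro linear_from_lin) (use alt_form_atD(2)[OF a _ t[of u v w 0], of 3] D(3,6) in \<open>simp add: form4_def\<close>)
    show "form4 e \<alpha> u u v w = 0" for u v w
      unfolding form4_def by (rule alt_form_atD(3)[OF a, of _ 0 1]) simp_all
    show "form4 e \<alpha> u v v w = 0" for u v w
      unfolding form4_def by (rule alt_form_atD(3)[OF a, of _ 1 2]) simp_all
    show "form4 e \<alpha> u v w w = 0" for u v w
      unfolding form4_def by (rule alt_form_atD(3)[OF a, of _ 2 3]) simp_all
  qed
qed

lemma length_3: "length xs = 3 \<longleftrightarrow> (\<exists>u v w. xs = [u, v, w])"
  by (auto simp: numeral_3_eq_3 length_Suc_conv)

lemma all_less_3: "(\<forall>i<3::nat. Q i) \<longleftrightarrow> Q 0 \<and> Q 1 \<and> Q 2"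
  by (auto simp: numeral_3_eq_3 numeral_2_eq_2 All_less_Suc)

lemma list_eq_3: "length us = 3 \<and> us ! 0 = a \<and> us ! 1 = b \<and> us ! 2 = c \<longleftrightarrow> us = [a, b, c]"
  by (auto simp: length_3)

lemma length_4: "length xs = 4 \<longleftrightarrow> (\<exists>u v w z. xs = [u, v, w, z])"
proof -
  have 4: "(4::nat) = Suc (Suc (Suc (Suc 0)))" by simp
  show ?thesis unfolding 4 by (auto simp: length_Suc_conv)
qed

lemma pullback_phi0:
  assumes "alt_form_at A 3 x \<alpha>"
  shows "pullback e \<alpha> = phi0 \<longleftrightarrow> form3 e \<alpha> = P3"
proof
  assume "pullback e \<alpha> = phi0"
  then have "\<alpha> (map e ws) = phi0 ws" for ws by (metis pullback_def)
  from this[of "[_, _, _]"] show "form3 e \<alpha> = P3" by (simp add: form3_def P3_def fun_eq_iff)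
next
  assume *: "form3 e \<alpha> = P3"
  show "pullback e \<alpha> = phi0"
  proof
    fix ws :: "(real^7) list"
    show "pullback e \<alpha> ws = phi0 ws"
    proof (cases "length ws = 3")
      case True
      then obtain u v w where "ws = [u, v, w]" by (auto simp: length_3)
      then show ?thesis using fun_cong[OF fun_cong[OF fun_cong[OF *]], of u v w]
        by (simp add: pullback_def form3_def P3_def)
    next
      case False
      then have "phi0 ws = 0" by (simp add: phi0_def dx_def)
      moreover have "\<alpha> (map e ws) = 0" by (rule alt_form_atD(1)[OF assms]) (simp add: False)
      ultimately show ?thesis by (simp add: pullback_def)
    qed
  qed
qed

lemma pullback_star_phi0:
  assumes "alt_form_at A 4 x \<alpha>"
  shows "pullback e \<alpha> = star_phi0 \<longleftrightarrow> form4 e \<alpha> = S4"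
proof
  assume "pullback e \<alpha> = star_phi0"
  then have "\<alpha> (map e ws) = star_phi0 ws" for ws by (metis pullback_def)
  from this[of "[_, _, _, _]"] show "form4 e \<alpha> = S4" by (simp add: form4_def S4_def fun_eq_iff)
next
  assume *: "form4 e \<alpha> = S4"
  show "pullback e \<alpha> = star_phi0"
  proof
    fix ws :: "(real^7) list"
    show "pullback e \<alpha> ws = star_phi0 ws"
    proof (cases "length ws = 4")
      case True
      then obtain u v w z where "ws = [u, v, w, z]" by (auto simp: length_4)
      then show ?thesis using fun_cong[OF fun_cong[OF fun_cong[OF fun_cong[OF *]]], of u v w z]
        by (simp add: pullback_def form4_def S4_def)
    next
      case False
      then have "star_phi0 ws = 0" by (simp add: star_phi0_def dx_def)
      moreover have "\<alpha> (map e ws) = 0" by (rule alt_form_atD(1)[OF assms]) (simp add: False)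
      ultimately show ?thesis by (simp add: pullback_def)
    qed
  qed
qed

section \<open>Oriented 3-planes read in a frame\<close>

abbreviation comb3 :: "(nat \<Rightarrow> real) \<Rightarrow> 'v::real_vector \<Rightarrow> 'v \<Rightarrow> 'v \<Rightarrow> 'v" where
  "comb3 a u v w \<equiv> a 0 *\<^sub>R u + a 1 *\<^sub>R v + a 2 *\<^sub>R w"

abbreviation plane3 :: "(real^7 \<Rightarrow> 'a tvec) \<Rightarrow> real^7 \<Rightarrow> real^7 \<Rightarrow> real^7 \<Rightarrow> 'a tvec list set" where
  "plane3 e u v w \<equiv> {[e (comb3 (M 0) u v w), e (comb3 (M 1) u v w), e (comb3 (M 2) u v w)] | M. ndet 3 M > 0}"

lemma tcomb_frame:
  assumes "e \<in> frames A x"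
  shows "tcomb a [e u, e v, e w] = e (comb3 a u v w)"
proof -
  note D = framesD(3)[OF assms]
  have "e (comb3 a u v w) = tlin 1 (tlin (a 0) (e u) (a 1) (e v)) (a 2) (e w)"
    using D[of 1 "a 0 *\<^sub>R u + a 1 *\<^sub>R v" "a 2" w] D[of "a 0" u "a 1" v] by simp
  then show ?thesis
    by (simp add: tcomb_def tlin_def fun_eq_iff eval_nat_numeral)
qed

lemma alt3_det:
  assumes f: "alt3 f"
  shows "f (comb3 (M 0) u v w) (comb3 (M 1) u v w)
    (comb3 (M 2) u v w) = ndet 3 M * f u v w"
proof -
  have "f u w v = - f u v w" "f v u w = - f u v w" "f w v u = - f u v w" "f v w u = f u v w" "f w u v = f u v w"
    using alt3_swap23[OF f, of u w v] alt3_swap12[OF f, of v u w] alt3_swap13[OF f, of w v u]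
      alt3_swap12[OF f, of v w u] alt3_swap12[OF f, of w u v] by auto
  then show ?thesis
    by (simp add: alt3_simps[OF f] alt3_self13[OF f] ndet_3) (simp add: algebra_simps)
qed

lemma gram_schmidt_3:
  fixes w0 w1 w2 :: "'a::real_inner"
  assumes indep: "\<And>a b c. a *\<^sub>R w0 + b *\<^sub>R w1 + c *\<^sub>R w2 = 0 \<Longrightarrow> a = 0 \<and> b = 0 \<and> c = 0"
  obtains y0 y1 y2 r s t p q m where "y0 \<bullet> y0 = 1" "y1 \<bullet> y1 = 1" "y2 \<bullet> y2 = 1" "y0 \<bullet> y1 = 0" "y0 \<bullet> y2 = 0" "y1 \<bullet> y2 = 0"
    "w0 = r *\<^sub>R y0" "w1 = s *\<^sub>R y0 + t *\<^sub>R y1" "w2 = p *\<^sub>R y0 + q *\<^sub>R y1 + m *\<^sub>R y2" "r > 0" "t > 0" "m > 0"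
proof -
  have "(w0 \<bullet> w0) * (w1 \<bullet> w1) \<noteq> (w0 \<bullet> w1)\<^sup>2"
  proof
    assume g: "(w0 \<bullet> w0) * (w1 \<bullet> w1) = (w0 \<bullet> w1)\<^sup>2"
    define n where "n = (w0 \<bullet> w0) *\<^sub>R w1 - (w0 \<bullet> w1) *\<^sub>R w0"
    have "n \<bullet> n = (w0 \<bullet> w0) * ((w0 \<bullet> w0) * (w1 \<bullet> w1) - (w0 \<bullet> w1)\<^sup>2)"
      by (simp add: n_def inner_diff_left inner_diff_right inner_commute power2_eq_square algebra_simps)
    then have "n = 0" using g by simp
    then have "w0 \<bullet> w0 = 0" using indep[of "- (w0 \<bullet> w1)" "w0 \<bullet> w0" 0] by (simp add: n_def)
    then show False using indep[of 1 0 0] by simp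
  qed
  then obtain y0 y1 r s t where 1: "y0 \<bullet> y0 = 1" "y1 \<bullet> y1 = 1" "y0 \<bullet> y1 = 0" "w0 = r *\<^sub>R y0" "w1 = s *\<^sub>R y0 + t *\<^sub>R y1" "r > 0" "t > 0"
    by (rule gram_schmidt_2)
  define p q where "p = y0 \<bullet> w2" "q = y1 \<bullet> w2"
  define n where "n = w2 - p *\<^sub>R y0 - q *\<^sub>R y1"
  have n: "y0 \<bullet> n = 0" "y1 \<bullet> n = 0"
    using 1 by (simp_all add: n_def p_q_def inner_diff_right inner_commute)
  have "n \<noteq> 0"
  proof
    assume n0: "n = 0"
    have y: "y0 = (1 / r) *\<^sub>R w0" "y1 = (1 / t) *\<^sub>R w1 - (s / (r * t)) *\<^sub>R w0"
      using 1(4-7) by (simp_all add: scaleR_add_right scaleR_diff_right)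
    \<comment> \<open>Obtained by expressing \<open>y0\<close> and \<open>y1\<close> through
      \<open>w0\<close> and \<open>w1\<close>; the coefficient 1 of \<open>w2\<close> contradicts
      independence.\<close>
    have "(q * s / (r * t) - p / r) *\<^sub>R w0 + (- q / t) *\<^sub>R w1 + 1 *\<^sub>R w2 = n"
      unfolding n_def y by (simp add: algebra_simps scaleR_diff_right)
    then show False using indep n0 by fastforce
  qed
  define m where "m = norm n"
  define y2 where "y2 = n /\<^sub>R m"
  have m: "m > 0" using \<open>n \<noteq> 0\<close> by (simp add: m_def)
  have mm: "m * m = n \<bullet> n" by (simp add: m_def power2_norm_eq_inner[symmetric] power2_eq_square)
  have "y2 \<bullet> y2 = 1" using m by (simp add: y2_def mm[symmetric] field_simps)
  moreover have "y0 \<bullet> y2 = 0" "y1 \<bullet> y2 = 0" by (simp_all add: y2_def n)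
  moreover have "w2 = p *\<^sub>R y0 + q *\<^sub>R y1 + m *\<^sub>R y2" using m by (simp add: y2_def n_def)
  ultimately show ?thesis using that 1 m by blast
qed

text \<open>The square of the determinant is the Gram determinant of the rows, which are orthonormal
  here, and positivity selects the root. Naming the Gram entries leaves a polynomial identity to
  check before they are specialised.\<close>

lemma ndet_3_orthonormal:
  assumes "M 0 0 * M 0 0 + M 0 1 * M 0 1 + M 0 2 * M 0 2 = 1" "M 1 0 * M 1 0 + M 1 1 * M 1 1 + M 1 2 * M 1 2 = 1"
    "M 2 0 * M 2 0 + M 2 1 * M 2 1 + M 2 2 * M 2 2 = 1" "M 0 0 * M 1 0 + M 0 1 * M 1 1 + M 0 2 * M 1 2 = 0"
    "M 0 0 * M 2 0 + M 0 1 * M 2 1 + M 0 2 * M 2 2 = 0" "M 1 0 * M 2 0 + M 1 1 * M 2 1 + M 1 2 * M 2 2 = 0"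
    and "ndet 3 M > 0"
  shows "ndet 3 M = 1"
proof -
  have gram: "(ndet 3 M)\<^sup>2 = g00 * (g11 * g22 - g12 * g12) - g01 * (g01 * g22 - g12 * g02) + g02 * (g01 * g12 - g11 * g02)"
    if "g00 = M 0 0 * M 0 0 + M 0 1 * M 0 1 + M 0 2 * M 0 2" "g11 = M 1 0 * M 1 0 + M 1 1 * M 1 1 + M 1 2 * M 1 2"
      "g22 = M 2 0 * M 2 0 + M 2 1 * M 2 1 + M 2 2 * M 2 2" "g01 = M 0 0 * M 1 0 + M 0 1 * M 1 1 + M 0 2 * M 1 2"
      "g02 = M 0 0 * M 2 0 + M 0 1 * M 2 1 + M 0 2 * M 2 2" "g12 = M 1 0 * M 2 0 + M 1 1 * M 2 1 + M 1 2 * M 2 2"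
    for g00 g11 g22 g01 g02 g12
    unfolding ndet_3 that by (simp add: power2_eq_square algebra_simps)
  have "(ndet 3 M)\<^sup>2 = 1"
    using gram[OF assms(1)[symmetric] assms(2)[symmetric] assms(3)[symmetric] assms(4)[symmetric] assms(5)[symmetric] assms(6)[symmetric]] by simp
  then show ?thesis using assms(7) by (simp add: power2_eq_1_iff)
qed

lemma oriented_planes_frame:
  assumes e: "e \<in> frames A x"
  shows "V \<in> oriented_planes A 3 x \<longleftrightarrow> (\<exists>w0 w1 w2.
    (\<forall>a b c. a *\<^sub>R w0 + b *\<^sub>R w1 + c *\<^sub>R w2 = 0 \<longrightarrow> a = 0 \<and> b = 0 \<and> c = 0) \<and>
    V = plane3 e w0 w1 w2)"
proof -
  note D = framesD[OF e]
  have e0: "e w = (\<lambda>c. 0) \<longleftrightarrow> w = 0" for w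
  proof -
    have "e 0 = (\<lambda>c. 0)" using D(3)[of 0 0 0 0] by (simp add: tlin_def)
    then show ?thesis using D(1) by (metis injD)
  qed
  have V: "{us. length us = 3 \<and> (\<exists>M. (\<forall>i<3. us ! i = tcomb (M i) [e w0, e w1, e w2]) \<and> ndet 3 M > 0)} =
    plane3 e w0 w1 w2" for w0 w1 w2
  proof -
    have *: "{us. length us = 3 \<and> (\<exists>M. (us ! 0 = a M \<and> us ! 1 = b M \<and> us ! 2 = c M) \<and> Q M)} = {[a M, b M, c M] | M. Q M}"
      for a b c :: "(nat \<Rightarrow> nat \<Rightarrow> real) \<Rightarrow> 'a tvec" and Q
      unfolding list_eq_3[symmetric] by blast
    show ?thesis unfolding tcomb_frame[OF e] all_less_3 by (rule *)
  qed
  have I: "(\<forall>a. tcomb a [e w0, e w1, e w2] = (\<lambda>c. 0) \<longrightarrow> (\<forall>i<3. a i = 0)) \<longleftrightarrow>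
    (\<forall>a b c. a *\<^sub>R w0 + b *\<^sub>R w1 + c *\<^sub>R w2 = 0 \<longrightarrow> a = 0 \<and> b = 0 \<and> c = 0)" for w0 w1 w2
  proof -
    have "(\<forall>a::nat \<Rightarrow> real. Q (a 0) (a 1) (a 2)) \<longleftrightarrow> (\<forall>a b c. Q a b c)" for Q
    proof
      assume *: "\<forall>a::nat \<Rightarrow> real. Q (a 0) (a 1) (a 2)"
      show "\<forall>a b c. Q a b c"
      proof (intro allI)
        show "Q a b c" for a b c
          using *[rule_format, of "\<lambda>i. if i = 0 then a else if i = 1 then b else c"] by simp
      qed
    qed simp
    from this[of "\<lambda>a b c. a *\<^sub>R w0 + b *\<^sub>R w1 + c *\<^sub>R w2 = 0 \<longrightarrow> a = 0 \<and> b = 0 \<and> c = 0"]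
    show ?thesis unfolding tcomb_frame[OF e] e0 all_less_3 .
  qed
  have S: "length vs = 3 \<and> set vs \<subseteq> tangent A x \<longleftrightarrow> (\<exists>w0 w1 w2. vs = [e w0, e w1, e w2])" for vs
  proof
    assume *: "length vs = 3 \<and> set vs \<subseteq> tangent A x"
    then obtain a b c where "vs = [a, b, c]" by (auto simp: length_3)
    then show "\<exists>w0 w1 w2. vs = [e w0, e w1, e w2]" using * D(2) by (auto simp: image_iff)
  qed (use D(6) in auto)
  have "V \<in> oriented_planes A 3 x \<longleftrightarrow> (\<exists>vs. (length vs = 3 \<and> set vs \<subseteq> tangent A x) \<and>
     (\<forall>a. tcomb a vs = (\<lambda>c. 0) \<longrightarrow> (\<forall>i<3. a i = 0)) \<and>
     V = {us. length us = 3 \<and> (\<exists>M. (\<forall>i<3. us ! i = tcomb (M i) vs) \<and> ndet 3 M > 0)})"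
    unfolding oriented_planes_def by blast
  also have "\<dots> \<longleftrightarrow> (\<exists>w0 w1 w2. (\<forall>a. tcomb a [e w0, e w1, e w2] = (\<lambda>c. 0) \<longrightarrow> (\<forall>i<3. a i = 0)) \<and>
     V = {us. length us = 3 \<and> (\<exists>M. (\<forall>i<3. us ! i = tcomb (M i) [e w0, e w1, e w2]) \<and> ndet 3 M > 0)})"
    unfolding S by blast
  finally show ?thesis unfolding V I .
qed

text \<open>The frame is the one picked by \<open>SOME\<close>, since \<open>g2_metric\<close> and
  \<open>g2_form3\<close> are computed in it. In this frame the oriented orthonormal bases of an
  associative plane are the triples \<open>y0\<close>, \<open>y1\<close>,
  \<open>cross y0 y1\<close>.\<close>

lemma planes_tame3:
  assumes e: "e \<in> frames A x" "e = (SOME e. e \<in> P x)" and a: "alt_form_at A 3 x \<alpha>"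
  shows "(\<forall>V\<in>oriented_planes A 3 x. associative P x V \<longrightarrow> positive_on_plane V \<alpha>) \<longleftrightarrow> tame3 (form3 e \<alpha>)"
proof -
  note D = framesD[OF e(1)]
  note f = alt3_form3[OF e(1) a]
  have met: "g2_metric P x (e u) (e v) = u \<bullet> v" for u v
    unfolding g2_metric_def e(2)[symmetric] Let_def by (simp add: D(4))
  have frm: "g2_form3 P x [e u, e v, e w] = P3 u v w" for u v w
    unfolding g2_form3_def e(2)[symmetric] Let_def by (simp add: D(4) P3_def)
  have orth: "orthonormal (g2_metric P x) [e u, e v, e w] \<longleftrightarrow>
      u \<bullet> u = 1 \<and> v \<bullet> v = 1 \<and> w \<bullet> w = 1 \<and> u \<bullet> v = 0 \<and> u \<bullet> w = 0 \<and> v \<bullet> w = 0" for u v w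
    unfolding orthonormal_def by (auto simp: met all_less_3[unfolded numeral_3_eq_3] inner_commute)
  show ?thesis
  proof
    assume L: "\<forall>V\<in>oriented_planes A 3 x. associative P x V \<longrightarrow> positive_on_plane V \<alpha>"
    show "tame3 (form3 e \<alpha>)"
      unfolding tame3_def
    proof (intro allI impI, elim conjE)
      fix u v :: "real^7" assume uv: "u \<bullet> u = 1" "v \<bullet> v = 1" "u \<bullet> v = 0"
      define w where "w = cross u v"
      have w: "w \<bullet> w = 1" "u \<bullet> w = 0" "v \<bullet> w = 0" "P3 u v w = 1"
        using uv by (simp_all add: w_def inner_cross_cross P3_cross_self)
      have ip: "(p *\<^sub>R u + q *\<^sub>R v + r *\<^sub>R w) \<bullet> (p' *\<^sub>R u + q' *\<^sub>R v + r' *\<^sub>R w) = p * p' + q * q' + r * r'" for p q r p' q' r'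
        using uv w by (simp add: inner_add_left inner_add_right inner_commute)
      define V where "V = plane3 e u v w"
      have "p = 0 \<and> q = 0 \<and> r = 0" if "p *\<^sub>R u + q *\<^sub>R v + r *\<^sub>R w = 0" for p q r
      proof -
        have "p * p + q * q + r * r = 0" using ip[of p q r p q r] that by simp
        then show ?thesis by (smt (verit) zero_le_square mult_eq_0_iff)
      qed
      then have "V \<in> oriented_planes A 3 x"
        unfolding oriented_planes_frame[OF e(1)] V_def by blast
      moreover have "associative P x V"
        unfolding associative_def is_volume_form_def
      proof (intro ballI impI)
        fix us assume "us \<in> V" and o: "orthonormal (g2_metric P x) us"
        then obtain M where us: "us = [e (comb3 (M 0) u v w), e (comb3 (M 1) u v w),
          e (comb3 (M 2) u v w)]" and M: "ndet 3 M > 0"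
          unfolding V_def by blast
        \<comment> \<open>The matrix relates two orthonormal bases and is therefore
          orthogonal.\<close>
        have "ndet 3 M = 1"
          using o unfolding us orth ip by (intro ndet_3_orthonormal) (use M in auto)
        then show "g2_form3 P x us = 1"
          unfolding us frm alt3_det[OF alt3_P3] using w(4) by simp
      qed
      ultimately have "positive_on_plane V \<alpha>" using L by blast
      moreover have "[e u, e v, e w] \<in> V"
        unfolding V_def
        by (rule CollectI, rule exI[of _ "\<lambda>i j. if i = j then 1 else 0"]) (simp add: ndet_3)
      ultimately show "0 < form3 e \<alpha> u v (cross u v)"
        unfolding positive_on_plane_def form3_def w_def by blast
    qed
  next
    assume t: "tame3 (form3 e \<alpha>)"
    show "\<forall>V\<in>oriented_planes A 3 x. associative P x V \<longrightarrow> positive_on_plane V \<alpha>"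
    proof (intro ballI impI)
      fix V assume Vp: "V \<in> oriented_planes A 3 x" and ass: "associative P x V"
      obtain w0 w1 w2 where ind0: "\<forall>a b c. a *\<^sub>R w0 + b *\<^sub>R w1 + c *\<^sub>R w2 = 0 \<longrightarrow> a = 0 \<and> b = 0 \<and> c = 0"
        and V: "V = plane3 e w0 w1 w2"
        using iffD1[OF oriented_planes_frame[OF e(1)] Vp] by (elim exE conjE)
      have ind: "a = 0 \<and> b = 0 \<and> c = 0" if "a *\<^sub>R w0 + b *\<^sub>R w1 + c *\<^sub>R w2 = 0" for a b c
        using ind0 that by blast
      obtain y0 y1 y2 r s t' p q m where y: "y0 \<bullet> y0 = 1" "y1 \<bullet> y1 = 1" "y2 \<bullet> y2 = 1" "y0 \<bullet> y1 = 0" "y0 \<bullet> y2 = 0" "y1 \<bullet> y2 = 0"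
        and w: "w0 = r *\<^sub>R y0" "w1 = s *\<^sub>R y0 + t' *\<^sub>R y1" "w2 = p *\<^sub>R y0 + q *\<^sub>R y1 + m *\<^sub>R y2" and pos: "r > 0" "t' > 0" "m > 0"
        by (rule gram_schmidt_3[OF ind])
      \<comment> \<open>The inverse of the triangular change of basis from
        \<open>gram_schmidt_3\<close>. Its diagonal is positive, so the new basis is
        oriented.\<close>
      define N :: "nat \<Rightarrow> nat \<Rightarrow> real" where "N = (\<lambda>i j. if i = 0 then (if j = 0 then 1 / r else 0)
        else if i = 1 then (if j = 0 then - s / (r * t') else if j = 1 then 1 / t' else 0)
        else (if j = 0 then (q * s / t' - p) / (r * m) else if j = 1 then - q / (t' * m) else 1 / m))"
      have N: "ndet 3 N > 0" using pos by (simp add: ndet_3 N_def)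
      have yN: "comb3 (N 0) w0 w1 w2 = y0" "comb3 (N 1) w0 w1 w2 = y1"
        "comb3 (N 2) w0 w1 w2 = y2"
      proof -
        show "comb3 (N 0) w0 w1 w2 = y0" using pos by (simp add: N_def w)
        show "comb3 (N 1) w0 w1 w2 = y1"
          using pos by (simp add: N_def w scaleR_add_right scaleR_left_distrib[symmetric])
        have "comb3 (N 2) w0 w1 w2 =
          (N 2 0 * r + N 2 1 * s + N 2 2 * p) *\<^sub>R y0 + (N 2 1 * t' + N 2 2 * q) *\<^sub>R y1 + (N 2 2 * m) *\<^sub>R y2"
          unfolding w by (simp add: algebra_simps)
        also have "N 2 0 * r + N 2 1 * s + N 2 2 * p = 0" using pos by (simp add: N_def field_simps)
        also have "N 2 1 * t' + N 2 2 * q = 0" using pos by (simp add: N_def field_simps)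
        also have "N 2 2 * m = 1" using pos by (simp add: N_def)
        finally show "comb3 (N 2) w0 w1 w2 = y2" by simp
      qed
      \<comment> \<open>The condition \<open>associative\<close> speaks about orthonormal bases in
        \<open>V\<close>; exhibiting one makes it usable.\<close>
      have "[e y0, e y1, e y2] \<in> V"
        unfolding V by (rule CollectI, rule exI[of _ N]) (simp only: yN N simp_thms)
      then have "P3 y0 y1 y2 = 1"
        using ass orth[of y0 y1 y2] y unfolding associative_def is_volume_form_def by (metis frm)
      then have cr: "cross y0 y1 \<bullet> y2 = 1" by (simp add: cross_inner)
      \<comment> \<open>Expands to 1 - 2 + 1: both vectors have length 1, and their inner product is
        1.\<close>
      have "(y2 - cross y0 y1) \<bullet> (y2 - cross y0 y1) = 0"
        using cr y by (simp add: inner_diff_left inner_diff_right inner_cross_cross inner_commute)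
      then have "y2 = cross y0 y1" by simp
      then have posy: "form3 e \<alpha> y0 y1 y2 > 0" using t y unfolding tame3_def by blast
      have "form3 e \<alpha> y0 y1 y2 = ndet 3 N * form3 e \<alpha> w0 w1 w2"
        using alt3_det[OF f, of N w0 w1 w2] unfolding yN .
      then have posw: "form3 e \<alpha> w0 w1 w2 > 0" using posy N by (simp add: zero_less_mult_iff)
      show "positive_on_plane V \<alpha>"
        unfolding positive_on_plane_def
      proof
        fix us assume "us \<in> V"
        then obtain M where us: "us = [e (comb3 (M 0) w0 w1 w2), e (comb3 (M 1) w0 w1 w2),
          e (comb3 (M 2) w0 w1 w2)]" and M: "ndet 3 M > 0"
          unfolding V by blast
        have "\<alpha> us = ndet 3 M * form3 e \<alpha> w0 w1 w2"
          using alt3_det[OF f, of M w0 w1 w2] unfolding us form3_def .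
        then show "\<alpha> us > 0" using M posw by simp
      qed
    qed
  qed
qed

section \<open>Taming in terms of adapted frames\<close>

lemma smooth_forms_alt: "\<omega> \<in> smooth_forms A k \<Longrightarrow> alt_form_at A k x (\<omega> x)"
  unfolding smooth_forms_def by blast

lemma closed_forms_smooth: "\<omega> \<in> closed_forms A k \<Longrightarrow> \<omega> \<in> smooth_forms A k"
  unfolding closed_forms_def by blast

lemma g2_of3_iff:
  assumes "\<phi> \<in> smooth_forms A 3"
  shows "e \<in> g2_of3 A \<phi> x \<longleftrightarrow> e \<in> frames A x \<and> form3 e (\<phi> x) = P3"
  using pullback_phi0[OF smooth_forms_alt[OF assms]] by (simp add: g2_of3_def)

lemma g2_of4_iff:
  assumes "\<psi> \<in> smooth_forms A 4"
  shows "e \<in> g2_of4 ori \<psi> x \<longleftrightarrow> e \<in> ori x \<and> form4 e (\<psi> x) = S4"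
  using pullback_star_phi0[OF smooth_forms_alt[OF assms]] by (simp add: g2_of4_def)

lemma positive3_iff:
  "positive3 A \<phi> \<longleftrightarrow> \<phi> \<in> smooth_forms A 3 \<and> (\<forall>x. \<exists>e\<in>frames A x. form3 e (\<phi> x) = P3)"
proof (cases "\<phi> \<in> smooth_forms A 3")
  case True
  then show ?thesis by (simp add: positive3_def pullback_phi0[OF smooth_forms_alt[OF True]])
qed (simp add: positive3_def)

lemma positive4_iff:
  "positive4 A \<psi> \<longleftrightarrow> \<psi> \<in> smooth_forms A 4 \<and> (\<forall>x. \<exists>e\<in>frames A x. form4 e (\<psi> x) = S4)"
proof (cases "\<psi> \<in> smooth_forms A 4")
  case True
  then show ?thesis by (simp add: positive4_def pullback_star_phi0[OF smooth_forms_alt[OF True]])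
qed (simp add: positive4_def)

lemma positive3D: "positive3 A \<phi> \<Longrightarrow> \<exists>e\<in>frames A x. form3 e (\<phi> x) = P3"
  by (simp add: positive3_iff)

lemma positive4D: "positive4 A \<psi> \<Longrightarrow> \<exists>e\<in>frames A x. form4 e (\<psi> x) = S4"
  by (simp add: positive4_iff)

text \<open>The matrix between the two frames stabilises \<open>P3\<close> and so has determinant 1.
  This is why a positive 3-form induces an orientation.\<close>

lemma g2_frames_same_orient:
  assumes "e \<in> frames A x" "e' \<in> frames A x" "form3 e \<alpha> = P3" "form3 e' \<alpha> = P3"
  shows "same_orient e e'"
proof -
  obtain E where E: "invertible E" "e' = (\<lambda>w. e (E *v w))" using frames_matrix[OF assms(1,2)] by metis
  have "pb3 E P3 = P3" using assms(3,4) by (simp add: E(2) form3_compose)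
  then have "det E = 1" by (rule pb3_P3_det)
  then show ?thesis using same_orient_compose[OF assms(1) E(1)] E(2) by simp
qed

lemma g2_orientation_of3:
  assumes "\<phi> \<in> smooth_forms A 3" "e \<in> g2_of3 A \<phi> x"
  shows "g2_orientation A (g2_of3 A \<phi>) x = {e' \<in> frames A x. same_orient e e'}"
proof -
  have e: "e \<in> frames A x" "form3 e (\<phi> x) = P3" using assms(2) g2_of3_iff[OF assms(1)] by auto
  have "same_orient e e'" if "e1 \<in> g2_of3 A \<phi> x" "same_orient e1 e'" "e' \<in> frames A x" for e1 e'
  proof -
    have e1: "e1 \<in> frames A x" "form3 e1 (\<phi> x) = P3" using that(1) g2_of3_iff[OF assms(1)] by auto
    show ?thesis
      using g2_frames_same_orient[OF e(1) e1(1) e(2) e1(2)] same_orient_trans(3)[OF e(1) e1(1) that(3)] that(2) by blast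
  qed
  then show ?thesis unfolding g2_orientation_def using assms(2) by blast
qed

text \<open>Relative to \<open>e\<close>, the frame \<open>e'\<close> is the matrix of
  \<open>tame4_frame_iff\<close>. The left side depends on \<open>\<beta>\<close> through a frame
  adapted to it; the right side is a family of linear inequalities for
  \<open>\<beta>\<close>.\<close>

lemma tame3_iff_tame4:
  assumes e: "e \<in> frames A x" "form3 e \<alpha> = P3" and e': "e' \<in> frames A x" "form4 e' \<beta> = S4"
    and \<beta>: "alt_form_at A 4 x \<beta>" and so: "same_orient e e'"
  shows "tame3 (form3 e' \<alpha>) \<longleftrightarrow> tame4 (form4 e \<beta>)"
proof -
  obtain E where E: "invertible E" "e' = (\<lambda>w. e (E *v w))" using frames_matrix[OF e(1) e'(1)] by metis
  have "det E > 0" using so same_orient_compose[OF e(1) E(1)] E(2) by simp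
  moreover have "pb4 E (form4 e \<beta>) = S4" using e'(2) by (simp add: E(2) form4_compose)
  ultimately show ?thesis
    using tame4_frame_iff[OF alt4_form4[OF e(1) \<beta>]] by (simp add: E(2) form3_compose e(2))
qed

text \<open>A frame of the wrong orientation is replaced by its negative. The last conclusion
  records this for a later comparison of signs.\<close>

lemma oriented_frame4:
  assumes e: "e \<in> frames A x" "form4 e \<beta> = S4" and \<beta>: "alt_form_at A 4 x \<beta>" and e0: "e0 \<in> frames A x"
  obtains e' where "e' \<in> frames A x" "form4 e' \<beta> = S4" "same_orient e0 e'" "e' = e \<or> e' = (\<lambda>w. e (- w))"
proof -
  obtain E where E: "invertible E" "e = (\<lambda>w. e0 (E *v w))" using frames_matrix[OF e0 e(1)] by metis
  have det: "det E \<noteq> 0" using E(1) by (simp add: invertible_det_nz)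
  have pE: "pb4 E (form4 e0 \<beta>) = S4" using e(2) by (simp add: E(2) form4_compose)
  show ?thesis
  proof (cases "det E > 0")
    case True
    then show ?thesis using that[of e] e same_orient_compose[OF e0 E(1)] E(2) by simp
  next
    case False
    have iE: "invertible (- E)" using det by (simp add: invertible_det_nz det_minus_7)
    have "(- E) *v w = E *v (- w)" for w
      by (simp add: matrix_vector_mult_def vec_eq_iff sum_negf)
    then have eq: "(\<lambda>w. e0 ((- E) *v w)) = (\<lambda>w. e (- w))" by (simp add: E(2))
    show ?thesis
    proof (rule that[of "\<lambda>w. e0 ((- E) *v w)"])
      show "(\<lambda>w. e0 ((- E) *v w)) \<in> frames A x" by (rule frames_compose(1)[OF e0 iE])
      show "form4 (\<lambda>w. e0 ((- E) *v w)) \<beta> = S4"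
        unfolding form4_compose using pb4_minus[OF alt4_form4[OF e0 \<beta>]] pE by simp
      show "same_orient e0 (\<lambda>w. e0 ((- E) *v w))"
        using same_orient_compose[OF e0 iE] False det by (simp add: det_minus_7)
    qed (simp add: eq)
  qed
qed

text \<open>The right side is a convex condition at each point. Positivity of \<open>\<psi>\<close>,
  with an adapted frame of the right orientation, is recovered from tameness by
  \<open>tame4_frame\<close>.\<close>

lemma TA_cone4_iff:
  assumes \<phi>: "\<phi> \<in> closed_forms A 3" "positive3 A \<phi>"
  shows "\<psi> \<in> TA_cone4 A \<phi> \<longleftrightarrow> \<psi> \<in> closed_forms A 4 \<and> (\<forall>x. \<forall>e\<in>g2_of3 A \<phi> x. tame4 (form4 e (\<psi> x)))"
proof -
  define o' where "o' = g2_orientation A (g2_of3 A \<phi>)"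
  have s\<phi>: "\<phi> \<in> smooth_forms A 3" using \<phi>(1) by (rule closed_forms_smooth)
  note iff3 = g2_of3_iff[OF s\<phi>]
  have o': "e' \<in> o' x \<longleftrightarrow> e' \<in> frames A x \<and> same_orient e e'" if "e \<in> g2_of3 A \<phi> x" for e e' x
    using g2_orientation_of3[OF s\<phi> that] by (simp add: o'_def)
  \<comment> \<open>Nonemptiness ensures that the choice inside \<open>g2_metric\<close> and
    \<open>g2_form3\<close> is an adapted frame.\<close>
  have planes: "(\<forall>V\<in>oriented_planes A 3 x. associative (g2_of4 o' \<psi>) x V \<longrightarrow> positive_on_plane V (\<phi> x))
      \<longleftrightarrow> tame4 (form4 e (\<psi> x))"
    if \<psi>: "\<psi> \<in> smooth_forms A 4" and e: "e \<in> g2_of3 A \<phi> x" and ne: "g2_of4 o' \<psi> x \<noteq> {}" for e x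
  proof -
    define e' where "e' = (SOME e. e \<in> g2_of4 o' \<psi> x)"
    have "e' \<in> g2_of4 o' \<psi> x" unfolding e'_def using ne by (simp add: some_in_eq)
    then have e': "e' \<in> frames A x" "same_orient e e'" "form4 e' (\<psi> x) = S4"
      using g2_of4_iff[OF \<psi>] o'[OF e] by auto
    show ?thesis
      using planes_tame3[where P = "g2_of4 o' \<psi>", OF e'(1) e'_def smooth_forms_alt[OF s\<phi>]]
        tame3_iff_tame4[OF _ _ e'(1,3) smooth_forms_alt[OF \<psi>] e'(2)] e iff3 by blast
  qed
  show ?thesis
  proof
    assume "\<psi> \<in> TA_cone4 A \<phi>"
    then have \<psi>: "\<psi> \<in> closed_forms A 4" "positive4 A \<psi>" and
      V: "\<And>x. \<forall>V\<in>oriented_planes A 3 x. associative (g2_of4 o' \<psi>) x V \<longrightarrow> positive_on_plane V (\<phi> x)"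
      unfolding TA_cone4_def TA_G2_def o'_def by auto
    have s\<psi>: "\<psi> \<in> smooth_forms A 4" using \<psi>(1) by (rule closed_forms_smooth)
    have "tame4 (form4 e (\<psi> x))" if e: "e \<in> g2_of3 A \<phi> x" for e x
    proof -
      have ef: "e \<in> frames A x" using e iff3 by blast
      obtain e1 where e1: "e1 \<in> frames A x" "form4 e1 (\<psi> x) = S4" using positive4D[OF \<psi>(2), of x] by blast
      obtain e2 where "e2 \<in> frames A x" "form4 e2 (\<psi> x) = S4" "same_orient e e2"
        using oriented_frame4[OF e1 smooth_forms_alt[OF s\<psi>] ef] by metis
      then have "e2 \<in> g2_of4 o' \<psi> x" using g2_of4_iff[OF s\<psi>] o'[OF e] by blast
      then show ?thesis using planes[OF s\<psi> e] V by blast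
    qed
    then show "\<psi> \<in> closed_forms A 4 \<and> (\<forall>x. \<forall>e\<in>g2_of3 A \<phi> x. tame4 (form4 e (\<psi> x)))" using \<psi>(1) by blast
  next
    assume R: "\<psi> \<in> closed_forms A 4 \<and> (\<forall>x. \<forall>e\<in>g2_of3 A \<phi> x. tame4 (form4 e (\<psi> x)))"
    then have s\<psi>: "\<psi> \<in> smooth_forms A 4" using closed_forms_smooth by blast
    have *: "g2_of4 o' \<psi> x \<noteq> {} \<and> (\<forall>V\<in>oriented_planes A 3 x. associative (g2_of4 o' \<psi>) x V \<longrightarrow> positive_on_plane V (\<phi> x))
        \<and> (\<exists>e\<in>frames A x. form4 e (\<psi> x) = S4)" for x
    proof -
      obtain e where e: "e \<in> g2_of3 A \<phi> x" using positive3D[OF \<phi>(2), of x] iff3 by blast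
      then have ef: "e \<in> frames A x" using iff3 by blast
      have t: "tame4 (form4 e (\<psi> x))" using R e by blast
      obtain E where E: "det E > 0" "pb4 E (form4 e (\<psi> x)) = S4"
        using tame4_frame[OF alt4_form4[OF ef smooth_forms_alt[OF s\<psi>]] t] by blast
      have iE: "invertible E" using E(1) by (simp add: invertible_det_nz)
      let ?e' = "\<lambda>w. e (E *v w)"
      have e': "?e' \<in> frames A x" "form4 ?e' (\<psi> x) = S4" "same_orient e ?e'"
        using frames_compose(1)[OF ef iE] E same_orient_compose[OF ef iE] by (simp_all add: form4_compose)
      then have "?e' \<in> g2_of4 o' \<psi> x" using g2_of4_iff[OF s\<psi>] o'[OF e] by blast
      then have ne: "g2_of4 o' \<psi> x \<noteq> {}" by blast
      then show ?thesis using planes[OF s\<psi> e ne] t e' by blast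
    qed
    have "positive4 A \<psi>" unfolding positive4_iff using s\<psi> * by blast
    then show "\<psi> \<in> TA_cone4 A \<phi>"
      unfolding TA_cone4_def TA_G2_def o'_def[symmetric] using R s\<psi> \<phi> * by blast
  qed
qed

text \<open>For the converse, \<open>tame3_frame\<close> produces frames adapted to
  \<open>\<phi>\<close> that lie in \<open>ori\<close>, so positivity and the prescribed orientation
  come together.\<close>

lemma TA_cone3_iff:
  assumes ori: "orientation A ori" and \<psi>: "\<psi> \<in> closed_forms A 4" "positive4 A \<psi>"
  shows "\<phi> \<in> TA_cone3 A ori \<psi> \<longleftrightarrow> \<phi> \<in> closed_forms A 3 \<and> (\<forall>x. \<forall>e\<in>g2_of4 ori \<psi> x. tame3 (form3 e (\<phi> x)))"
proof -
  have s\<psi>: "\<psi> \<in> smooth_forms A 4" using \<psi>(1) by (rule closed_forms_smooth)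
  note iff4 = g2_of4_iff[OF s\<psi>]
  have ori1: "\<exists>e\<in>frames A x. ori x = {e' \<in> frames A x. same_orient e e'}" for x
    using ori unfolding orientation_def by blast
  have oriI: "e' \<in> ori x" if "e \<in> ori x" "e' \<in> frames A x" "same_orient e e'" for e e' x
  proof -
    obtain e0 where e0: "e0 \<in> frames A x" "ori x = {e' \<in> frames A x. same_orient e0 e'}" using ori1 by blast
    then have *: "e \<in> frames A x" "same_orient e0 e" using that(1) by auto
    have "same_orient e0 e'" using same_orient_trans(3)[OF e0(1) *(1) that(2) *(2) that(3)] .
    then show ?thesis using e0(2) that(2) by simp
  qed
  have oriD: "e \<in> frames A x" "same_orient e e'" if "e \<in> ori x" "e' \<in> ori x" for e e' x
  proof -
    obtain e0 where e0: "e0 \<in> frames A x" "ori x = {e' \<in> frames A x. same_orient e0 e'}" using ori1 by blast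
    then have *: "e \<in> frames A x" "e' \<in> frames A x" "same_orient e0 e" "same_orient e0 e'" using that by auto
    show "e \<in> frames A x" by (rule *)
    show "same_orient e e'"
      by (rule same_orient_trans(3)[OF *(1) e0(1) *(2) same_orient_trans(2)[OF e0(1) *(1) *(1) *(3)] *(4)])
  qed
  have ne: "g2_of4 ori \<psi> x \<noteq> {}" for x
  proof -
    obtain e0 where e0: "e0 \<in> frames A x" "ori x = {e' \<in> frames A x. same_orient e0 e'}" using ori1 by blast
    obtain e1 where e1: "e1 \<in> frames A x" "form4 e1 (\<psi> x) = S4" using positive4D[OF \<psi>(2), of x] by blast
    obtain e2 where "e2 \<in> frames A x" "form4 e2 (\<psi> x) = S4" "same_orient e0 e2"
      using oriented_frame4[OF e1 smooth_forms_alt[OF s\<psi>] e0(1)] by metis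
    then show ?thesis using iff4 e0(2) by blast
  qed
  define e' where "e' = (\<lambda>x. SOME e. e \<in> g2_of4 ori \<psi> x)"
  have e'g: "e' x \<in> g2_of4 ori \<psi> x" for x unfolding e'_def using ne by (simp add: some_in_eq)
  have e'o: "e' x \<in> ori x" and e'S: "form4 (e' x) (\<psi> x) = S4" for x using e'g iff4 by auto
  have e'f: "e' x \<in> frames A x" for x using oriD(1)[OF e'o e'o] .
  have planes: "(\<forall>V\<in>oriented_planes A 3 x. associative (g2_of4 ori \<psi>) x V \<longrightarrow> positive_on_plane V (\<phi> x))
      \<longleftrightarrow> tame3 (form3 (e' x) (\<phi> x))" if "\<phi> \<in> smooth_forms A 3" for x
    by (rule planes_tame3[where P = "g2_of4 ori \<psi>", OF e'f _ smooth_forms_alt[OF that]]) (simp add: e'_def)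
  show ?thesis
  proof
    assume "\<phi> \<in> TA_cone3 A ori \<psi>"
    then have \<phi>: "\<phi> \<in> closed_forms A 3" "positive3 A \<phi>" "g2_orientation A (g2_of3 A \<phi>) = ori" and
      V: "\<And>x. \<forall>V\<in>oriented_planes A 3 x. associative (g2_of4 ori \<psi>) x V \<longrightarrow> positive_on_plane V (\<phi> x)"
      unfolding TA_cone3_def TA_G2_def by auto
    have s\<phi>: "\<phi> \<in> smooth_forms A 3" using \<phi>(1) by (rule closed_forms_smooth)
    have "tame3 (form3 e (\<phi> x))" if e: "e \<in> g2_of4 ori \<psi> x" for e x
    proof -
      obtain e0 where e0: "e0 \<in> g2_of3 A \<phi> x" "e0 \<in> frames A x" "form3 e0 (\<phi> x) = P3"
        using positive3D[OF \<phi>(2), of x] g2_of3_iff[OF s\<phi>] by blast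
      have so: "same_orient e0 e1" if "e1 \<in> ori x" for e1
        using that g2_orientation_of3[OF s\<phi> e0(1)] \<phi>(3) by auto
      have eo: "e \<in> ori x" "form4 e (\<psi> x) = S4" using e iff4 by auto
      have ef: "e \<in> frames A x" using oriD(1)[OF eo(1) eo(1)] .
      \<comment> \<open>The plane condition gives tameness in the chosen frame \<open>e' x\<close>
        only. Comparing both \<open>e' x\<close> and \<open>e\<close> with the same 4-form in the
        frame \<open>e0\<close> extends it to every adapted frame.\<close>
      note eq = tame3_iff_tame4[OF e0(2,3) _ _ smooth_forms_alt[OF s\<psi>] so]
      have "tame3 (form3 (e' x) (\<phi> x))" using planes[OF s\<phi>] V by blast
      then show ?thesis using eq[OF e'f e'S e'o] eq[OF ef eo(2) eo(1)] by blast
    qed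
    then show "\<phi> \<in> closed_forms A 3 \<and> (\<forall>x. \<forall>e\<in>g2_of4 ori \<psi> x. tame3 (form3 e (\<phi> x)))" using \<phi>(1) by blast
  next
    assume R: "\<phi> \<in> closed_forms A 3 \<and> (\<forall>x. \<forall>e\<in>g2_of4 ori \<psi> x. tame3 (form3 e (\<phi> x)))"
    then have s\<phi>: "\<phi> \<in> smooth_forms A 3" using closed_forms_smooth by blast
    have t: "tame3 (form3 (e' x) (\<phi> x))" for x using R e'g by blast
    have fr: "\<exists>e. e \<in> frames A x \<and> form3 e (\<phi> x) = P3 \<and> e \<in> ori x" for x
    proof -
      obtain E where E: "det E > 0" "pb3 E (form3 (e' x) (\<phi> x)) = P3"
        using tame3_frame[OF alt3_form3[OF e'f smooth_forms_alt[OF s\<phi>]] t] by blast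
      have iE: "invertible E" using E(1) by (simp add: invertible_det_nz)
      let ?e = "\<lambda>w. e' x (E *v w)"
      have "?e \<in> frames A x" "form3 ?e (\<phi> x) = P3" "same_orient (e' x) ?e"
        using frames_compose(1)[OF e'f iE] E same_orient_compose[OF e'f iE] by (simp_all add: form3_compose)
      then show ?thesis using oriI[OF e'o] by blast
    qed
    have "g2_orientation A (g2_of3 A \<phi>) x = ori x" for x
    proof -
      obtain e where e: "e \<in> frames A x" "form3 e (\<phi> x) = P3" "e \<in> ori x" using fr by blast
      then have "g2_orientation A (g2_of3 A \<phi>) x = {e' \<in> frames A x. same_orient e e'}"
        using g2_orientation_of3[OF s\<phi>] g2_of3_iff[OF s\<phi>] by blast
      also have "\<dots> = ori x" using oriI[OF e(3)] oriD e(3) by blast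
      finally show ?thesis .
    qed
    then have o: "g2_orientation A (g2_of3 A \<phi>) = ori" by blast
    have "positive3 A \<phi>" unfolding positive3_iff using s\<phi> fr by blast
    then show "\<phi> \<in> TA_cone3 A ori \<psi>"
      unfolding TA_cone3_def TA_G2_def mem_Collect_eq o using R s\<phi> \<psi> planes[OF s\<phi>] t by blast
  qed
qed


section \<open>Closed forms and cohomology\<close>

lemma alt_form_at_lin:
  fixes \<alpha> \<beta> :: "'a tvec list \<Rightarrow> real"
  assumes "alt_form_at A k x \<alpha>" "alt_form_at A k x \<beta>"
  shows "alt_form_at A k x (\<lambda>vs. s * \<alpha> vs + t * \<beta> vs)"
  unfolding alt_form_at_def
proof (intro conjI allI impI)
  fix vs :: "'a tvec list" assume "\<not> (length vs = k \<and> set vs \<subseteq> tangent A x)"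
  then show "s * \<alpha> vs + t * \<beta> vs = 0" using assms[THEN alt_form_atD(1)] by simp
next
  fix vs :: "'a tvec list" and i a u b w
  assume *: "length vs = k \<and> set vs \<subseteq> tangent A x \<and> i < k \<and> u \<in> tangent A x \<and> w \<in> tangent A x"
  have "\<alpha> (vs[i := tlin a u b w]) = a * \<alpha> (vs[i := u]) + b * \<alpha> (vs[i := w])"
    "\<beta> (vs[i := tlin a u b w]) = a * \<beta> (vs[i := u]) + b * \<beta> (vs[i := w])"
    using alt_form_atD(2)[OF assms(1)] alt_form_atD(2)[OF assms(2)] * by auto
  then show "s * \<alpha> (vs[i := tlin a u b w]) + t * \<beta> (vs[i := tlin a u b w]) =
      a * (s * \<alpha> (vs[i := u]) + t * \<beta> (vs[i := u])) + b * (s * \<alpha> (vs[i := w]) + t * \<beta> (vs[i := w]))"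
    by (simp add: algebra_simps)
next
  fix vs :: "'a tvec list" and i j
  assume "length vs = k \<and> i < k \<and> j < k \<and> i \<noteq> j \<and> vs ! i = vs ! j"
  then have "\<alpha> vs = 0" "\<beta> vs = 0"
    using alt_form_atD(3)[OF assms(1), of vs i j] alt_form_atD(3)[OF assms(2), of vs i j] by auto
  then show "s * \<alpha> vs + t * \<beta> vs = 0" by simp
qed

lemma local_rep_lin: "local_rep A c (form_lin s \<alpha> t \<beta>) y ws = s * local_rep A c \<alpha> y ws + t * local_rep A c \<beta> y ws"
  by (simp add: local_rep_def form_lin_def Let_def)

lemma smooth_forms_local:
  "\<omega> \<in> smooth_forms A k \<Longrightarrow> c \<in> A \<Longrightarrow> length ws = k \<Longrightarrow> smooth_on (snd c ` fst c) (\<lambda>y. local_rep A c \<omega> y ws)"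
  unfolding smooth_forms_def by blast

lemma smooth_forms_lin:
  assumes A: "smooth_atlas A" and "\<alpha> \<in> smooth_forms A k" "\<beta> \<in> smooth_forms A k"
  shows "form_lin s \<alpha> t \<beta> \<in> smooth_forms A k"
proof -
  have "alt_form_at A k x (form_lin s \<alpha> t \<beta> x)" for x
    unfolding form_lin_def using assms(2,3)[THEN smooth_forms_alt] by (rule alt_form_at_lin)
  moreover have "smooth_on (snd c ` fst c) (\<lambda>y. local_rep A c (form_lin s \<alpha> t \<beta>) y ws)" if "c \<in> A" "length ws = k" for c ws
    unfolding local_rep_lin using smooth_on_lin[OF atlas_homeo(2)[OF A that(1)] smooth_forms_local[OF assms(2) that] smooth_forms_local[OF assms(3) that]]
    by simp
  ultimately show ?thesis unfolding smooth_forms_def by blast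
qed

lemma ext_d_lin:
  assumes A: "smooth_atlas A" and \<alpha>: "\<alpha> \<in> smooth_forms A k" and \<beta>: "\<beta> \<in> smooth_forms A k"
  shows "ext_d A k (form_lin s \<alpha> t \<beta>) = form_lin s (ext_d A k \<alpha>) t (ext_d A k \<beta>)"
proof (intro ext)
  fix x vs
  show "ext_d A k (form_lin s \<alpha> t \<beta>) x vs = form_lin s (ext_d A k \<alpha>) t (ext_d A k \<beta>) x vs"
  proof (cases "length vs = Suc k \<and> set vs \<subseteq> tangent A x")
    case True
    define c where "c = (SOME c. c \<in> A \<and> x \<in> fst c)"
    have c: "c \<in> A" "x \<in> fst c"
      using someI_ex[of "\<lambda>c. c \<in> A \<and> x \<in> fst c"] atlas_chart[OF A, of x] unfolding c_def by blast+
    define ws where "ws = map (\<lambda>v. v c) vs"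
    have len: "length ws = Suc k" using True by (simp add: ws_def)
    have "eucl_d (local_rep A c (form_lin s \<alpha> t \<beta>)) (snd c x) ws =
      s * eucl_d (local_rep A c \<alpha>) (snd c x) ws + t * eucl_d (local_rep A c \<beta>) (snd c x) ws"
      unfolding eucl_d_def sum_distrib_left sum.distrib[symmetric]
    proof (rule sum.cong[OF refl])
      fix j assume j: "j \<in> {..<length ws}"
      define us where "us = take j ws @ drop (Suc j) ws"
      have us: "length us = k" using j len by (simp add: us_def)
      have d: "(\<lambda>z. local_rep A c \<gamma> z us) differentiable (at (snd c x))" if "\<gamma> \<in> smooth_forms A k" for \<gamma>
        by (rule smooth_on_differentiable[OF smooth_forms_local[OF that c(1) us]]) (use c(2) in auto)
      have "frechet_derivative (\<lambda>z. local_rep A c (form_lin s \<alpha> t \<beta>) z us) (at (snd c x)) v =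
        s * frechet_derivative (\<lambda>z. local_rep A c \<alpha> z us) (at (snd c x)) v +
        t * frechet_derivative (\<lambda>z. local_rep A c \<beta> z us) (at (snd c x)) v" for v
        unfolding local_rep_lin
        using fun_cong[OF frechet_derivative_eqI[OF has_derivative_lin[OF d[OF \<alpha>] d[OF \<beta>], of s t]], of v] by simp
      then show "(- 1) ^ j * frechet_derivative (\<lambda>z. local_rep A c (form_lin s \<alpha> t \<beta>) z (take j ws @ drop (Suc j) ws)) (at (snd c x)) (ws ! j) =
        s * ((- 1) ^ j * frechet_derivative (\<lambda>z. local_rep A c \<alpha> z (take j ws @ drop (Suc j) ws)) (at (snd c x)) (ws ! j)) +
        t * ((- 1) ^ j * frechet_derivative (\<lambda>z. local_rep A c \<beta> z (take j ws @ drop (Suc j) ws)) (at (snd c x)) (ws ! j))"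
        unfolding us_def[symmetric] by (simp add: algebra_simps)
    qed
    then show ?thesis
      using True by (simp add: ext_d_def form_lin_def Let_def c_def[symmetric] ws_def)
  qed (auto simp: ext_d_def form_lin_def)
qed

lemma closed_forms_lin:
  assumes "smooth_atlas A" "\<alpha> \<in> closed_forms A k" "\<beta> \<in> closed_forms A k"
  shows "form_lin s \<alpha> t \<beta> \<in> closed_forms A k"
proof -
  have "form_lin s \<alpha> t \<beta> \<in> smooth_forms A k"
    using assms by (intro smooth_forms_lin closed_forms_smooth)
  moreover have "ext_d A k (form_lin s \<alpha> t \<beta>) = (\<lambda>x vs. 0)"
    using assms(2,3) unfolding ext_d_lin[OF assms(1) closed_forms_smooth[OF assms(2)] closed_forms_smooth[OF assms(3)]]
    by (simp add: closed_forms_def form_lin_def)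
  ultimately show ?thesis unfolding closed_forms_def by blast
qed

lemma zero_smooth_form: "(\<lambda>x vs. 0) \<in> smooth_forms A k"
  unfolding smooth_forms_def alt_form_at_def local_rep_def Let_def by (auto intro: smooth_on_const)

lemma ext_d_zero: "ext_d A k (\<lambda>x vs. 0) = (\<lambda>x vs. 0)"
proof -
  have "frechet_derivative (\<lambda>z. 0 :: real) (at y) = (\<lambda>v. 0)" for y :: "real^7"
    by (rule frechet_derivative_eqI) simp
  then show ?thesis by (auto simp: ext_d_def eucl_d_def local_rep_def Let_def fun_eq_iff)
qed

lemma zero_closed_form: "(\<lambda>x vs. 0) \<in> closed_forms A k"
  unfolding closed_forms_def using zero_smooth_form ext_d_zero by blast

lemma form_comb_closed:
  assumes "smooth_atlas A" "\<forall>i<n. \<omega> i \<in> closed_forms A k"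
  shows "form_comb n t \<omega> \<in> closed_forms A k"
  using assms(2)
proof (induction n)
  case 0
  then show ?case using zero_closed_form by (simp add: form_comb_def)
next
  case (Suc n)
  have "form_comb (Suc n) t \<omega> = form_lin 1 (form_comb n t \<omega>) (t n) (\<omega> n)"
    by (simp add: form_comb_def form_lin_def fun_eq_iff)
  then show ?case using Suc by (auto intro: closed_forms_lin[OF assms(1)])
qed

section \<open>De Rham classes\<close>

lemma dR_rel_iff:
  "(\<alpha>, \<beta>) \<in> dR_rel A k \<longleftrightarrow> \<alpha> \<in> closed_forms A k \<and> \<beta> \<in> closed_forms A k \<and>
     (\<exists>\<xi>\<in>smooth_forms A (k - 1). form_lin 1 \<alpha> (- 1) \<beta> = ext_d A (k - 1) \<xi>)"
  by (simp add: dR_rel_def)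

lemma dR_rel_lin:
  assumes A: "smooth_atlas A" and "(\<alpha>, \<alpha>') \<in> dR_rel A k" "(\<beta>, \<beta>') \<in> dR_rel A k"
  shows "(form_lin s \<alpha> t \<beta>, form_lin s \<alpha>' t \<beta>') \<in> dR_rel A k"
proof -
  obtain \<xi> \<eta> where x: "\<xi> \<in> smooth_forms A (k - 1)" "form_lin 1 \<alpha> (- 1) \<alpha>' = ext_d A (k - 1) \<xi>"
    and e: "\<eta> \<in> smooth_forms A (k - 1)" "form_lin 1 \<beta> (- 1) \<beta>' = ext_d A (k - 1) \<eta>"
    using assms(2,3) unfolding dR_rel_iff by blast
  have "form_lin 1 (form_lin s \<alpha> t \<beta>) (- 1) (form_lin s \<alpha>' t \<beta>') =
    form_lin s (form_lin 1 \<alpha> (- 1) \<alpha>') t (form_lin 1 \<beta> (- 1) \<beta>')"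
    by (simp add: form_lin_def algebra_simps)
  also have "\<dots> = ext_d A (k - 1) (form_lin s \<xi> t \<eta>)"
    using ext_d_lin[OF A x(1) e(1)] x(2) e(2) by simp
  finally show ?thesis
    using assms(2,3) smooth_forms_lin[OF A x(1) e(1)] closed_forms_lin[OF A] unfolding dR_rel_iff by blast
qed

lemma dR_rel_refl: "\<alpha> \<in> closed_forms A k \<Longrightarrow> (\<alpha>, \<alpha>) \<in> dR_rel A k"
  unfolding dR_rel_iff using zero_smooth_form[of A "k - 1"] ext_d_zero[of A "k - 1"]
  by (auto simp: form_lin_def intro!: bexI[of _ "\<lambda>x vs. 0"])

text \<open>The relation sees only the difference of two closed forms. Symmetry and transitivity
  follow by finding linear combinations of related pairs with the required difference.\<close>

lemma dR_rel_diff: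
  assumes "form_lin 1 \<alpha> (- 1) \<beta> = form_lin 1 \<alpha>' (- 1) \<beta>'" "(\<alpha>, \<beta>) \<in> dR_rel A k" "\<alpha>' \<in> closed_forms A k" "\<beta>' \<in> closed_forms A k"
  shows "(\<alpha>', \<beta>') \<in> dR_rel A k"
  using assms unfolding dR_rel_iff by simp

lemma dR_rel_sym:
  assumes A: "smooth_atlas A" and r: "(\<alpha>, \<beta>) \<in> dR_rel A k"
  shows "(\<beta>, \<alpha>) \<in> dR_rel A k"
proof (rule dR_rel_diff)
  have c: "\<alpha> \<in> closed_forms A k" "\<beta> \<in> closed_forms A k" using r unfolding dR_rel_iff by auto
  show "(form_lin (- 1) \<alpha> 0 \<alpha>, form_lin (- 1) \<beta> 0 \<alpha>) \<in> dR_rel A k"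
    by (rule dR_rel_lin[OF A r dR_rel_refl[OF c(1)]])
  show "\<beta> \<in> closed_forms A k" "\<alpha> \<in> closed_forms A k" by (rule c)+
qed (simp add: form_lin_def)

lemma dR_rel_trans:
  assumes A: "smooth_atlas A" and r: "(\<alpha>, \<beta>) \<in> dR_rel A k" "(\<beta>, \<gamma>) \<in> dR_rel A k"
  shows "(\<alpha>, \<gamma>) \<in> dR_rel A k"
proof (rule dR_rel_diff)
  show "(form_lin 1 \<alpha> 1 \<beta>, form_lin 1 \<beta> 1 \<gamma>) \<in> dR_rel A k" by (rule dR_rel_lin[OF A r])
  show "\<alpha> \<in> closed_forms A k" "\<gamma> \<in> closed_forms A k" using r unfolding dR_rel_iff by auto
qed (simp add: form_lin_def)

lemma dR_class_eq_iff:
  assumes A: "smooth_atlas A" and "\<alpha> \<in> closed_forms A k" "\<beta> \<in> closed_forms A k"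
  shows "dR_class A k \<alpha> = dR_class A k \<beta> \<longleftrightarrow> (\<alpha>, \<beta>) \<in> dR_rel A k"
proof
  assume "dR_class A k \<alpha> = dR_class A k \<beta>"
  moreover have "\<beta> \<in> dR_class A k \<beta>" using dR_rel_refl[OF assms(3)] by (simp add: dR_class_def)
  ultimately show "(\<alpha>, \<beta>) \<in> dR_rel A k" by (auto simp: dR_class_def)
next
  assume r: "(\<alpha>, \<beta>) \<in> dR_rel A k"
  show "dR_class A k \<alpha> = dR_class A k \<beta>"
    unfolding dR_class_def
    using dR_rel_trans[OF A r] dR_rel_trans[OF A dR_rel_sym[OF A r]] by auto
qed

section \<open>Open cones from pointwise conditions\<close>

lemma finite_chart_cover:
  fixes A :: "'a::topological_space chart set"
  assumes A: "smooth_atlas A" and cpt: "compact (UNIV :: 'a set)"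
  obtains N where "finite N" "N \<noteq> {}" "\<And>c K. (c, K) \<in> N \<Longrightarrow> c \<in> A \<and> compact K \<and> K \<subseteq> snd c ` fst c"
    "\<And>x. \<exists>(c, K)\<in>N. x \<in> fst c \<and> snd c x \<in> K"
proof -
  have "\<exists>c r. c \<in> A \<and> x \<in> fst c \<and> r > 0 \<and> cball (snd c x) r \<subseteq> snd c ` fst c" for x
  proof -
    obtain c where c: "c \<in> A" "x \<in> fst c" using atlas_chart[OF A] by blast
    then show ?thesis using atlas_homeo(2)[OF A c(1)] open_contains_cball by blast
  qed
  then obtain c r where cr: "\<And>x. c x \<in> A" "\<And>x. x \<in> fst (c x)" "\<And>x. r x > 0" "\<And>x. cball (snd (c x) x) (r x) \<subseteq> snd (c x) ` fst (c x)"
    by metis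
  \<comment> \<open>The open balls provide the cover, the closed balls the compact sets on which
    components are compared.\<close>
  define U where "U x = fst (c x) \<inter> snd (c x) -` ball (snd (c x) x) (r x)" for x
  have opU: "open (U x)" for x
  proof -
    have "continuous_on (fst (c x)) (snd (c x))" using atlas_homeo(3)[OF A cr(1)] by (simp add: homeomorphism_def)
    then show ?thesis
      unfolding U_def using atlas_homeo(1)[OF A cr(1)] by (intro continuous_open_preimage) auto
  qed
  have "x \<in> U x" for x using cr(2,3) by (simp add: U_def)
  then have cov: "(UNIV :: 'a set) \<subseteq> (\<Union>x\<in>UNIV. U x)" by blast
  obtain D where D: "finite D" "(UNIV :: 'a set) \<subseteq> (\<Union>x\<in>D. U x)"
    by (rule compactE_image[OF cpt _ cov]) (rule opU)
  show ?thesis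
  proof (rule that[of "(\<lambda>x. (c x, cball (snd (c x) x) (r x))) ` D"])
    show "\<exists>(c, K)\<in>(\<lambda>x. (c x, cball (snd (c x) x) (r x))) ` D. x \<in> fst c \<and> snd c x \<in> K" for x
    proof -
      obtain z where "z \<in> D" "x \<in> U z" using D(2) by blast
      then show ?thesis by (force simp: U_def)
    qed
    show "c' \<in> A \<and> compact K \<and> K \<subseteq> snd c' ` fst c'" if cK: "(c', K) \<in> (\<lambda>x. (c x, cball (snd (c x) x) (r x))) ` D" for c' K
    proof -
      obtain x where "c' = c x" "K = cball (snd (c x) x) (r x)" using cK by blast
      then show ?thesis using cr(1,4) by simp
    qed
  qed (use D in auto)
qed

lemma bounded_local_rep:
  assumes "\<omega> \<in> smooth_forms A k" "c \<in> A" "compact K" "K \<subseteq> snd c ` fst c" "length ws = k"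
  obtains b where "\<And>y. y \<in> K \<Longrightarrow> \<bar>local_rep A c \<omega> y ws\<bar> \<le> b"
proof -
  have "continuous_on K (\<lambda>y. local_rep A c \<omega> y ws)"
    using smooth_on_continuous_on[OF smooth_forms_local[OF assms(1,2,5)]] assms(4) continuous_on_subset by blast
  then have "bounded ((\<lambda>y. local_rep A c \<omega> y ws) ` K)"
    using assms(3) compact_continuous_image compact_imp_bounded by blast
  then show ?thesis using that unfolding bounded_iff by auto
qed

text \<open>The common passage from linear algebra to the cones of 3-forms and of 4-forms. In
  \<open>stable\<close>, closeness is uniform closeness of components on one compact set in one
  chart.\<close>

lemma open_cone_of_pointwise_condition:
  fixes A :: "'a::topological_space chart set" and T :: "'a \<Rightarrow> ('a tvec list \<Rightarrow> real) \<Rightarrow> bool"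
  assumes A: "smooth_atlas A" and cpt: "compact (UNIV :: 'a set)"
    and C: "\<And>\<omega>. \<omega> \<in> C \<longleftrightarrow> \<omega> \<in> closed_forms A k \<and> (\<forall>x. T x (\<omega> x))"
    and cone: "\<And>x \<alpha> \<beta> s t. alt_form_at A k x \<alpha> \<Longrightarrow> alt_form_at A k x \<beta> \<Longrightarrow> T x \<alpha> \<Longrightarrow> T x \<beta> \<Longrightarrow> s \<ge> 0 \<Longrightarrow> t \<ge> 0 \<Longrightarrow>
      \<not> (s = 0 \<and> t = 0) \<Longrightarrow> T x (\<lambda>vs. s * \<alpha> vs + t * \<beta> vs)"
    and stable: "\<And>\<omega> c K. \<omega> \<in> C \<Longrightarrow> c \<in> A \<Longrightarrow> compact K \<Longrightarrow> K \<subseteq> snd c ` fst c \<Longrightarrow> \<exists>\<epsilon>>0. \<forall>\<omega>'\<in>closed_forms A k.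
      (\<forall>y\<in>K. \<forall>ws. length ws = k \<and> set ws \<subseteq> Basis \<longrightarrow> \<bar>local_rep A c \<omega>' y ws - local_rep A c \<omega> y ws\<bar> < \<epsilon>) \<longrightarrow>
      (\<forall>y\<in>K. T (chart_inv c y) (\<omega>' (chart_inv c y)))"
  shows "openin (closed_forms_topology A k) C \<and> form_cone C \<and> openin (dR_quotient_topology A k) (dR_class A k ` C) \<and>
    openin (dR_linear_topology A k) (dR_class A k ` C) \<and> dR_cone A k (dR_class A k ` C)"
proof -
  obtain N where N: "finite N" "N \<noteq> {}" "\<And>c K. (c, K) \<in> N \<Longrightarrow> c \<in> A \<and> compact K \<and> K \<subseteq> snd c ` fst c"
    "\<And>x. \<exists>(c, K)\<in>N. x \<in> fst c \<and> snd c x \<in> K"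
    by (rule finite_chart_cover[OF A cpt], rule that; assumption)
  define close where "close \<epsilon> \<omega>' \<omega> \<longleftrightarrow> (\<forall>(c, K)\<in>N. \<forall>y\<in>K. \<forall>ws. length ws = k \<and> set ws \<subseteq> Basis \<longrightarrow>
      \<bar>local_rep A c \<omega>' y ws - local_rep A c \<omega> y ws\<bar> < \<epsilon>)" for \<epsilon> \<omega>' \<omega>
  have closeI: "close \<epsilon> \<omega>' \<omega>" if "\<And>c K y ws. (c, K) \<in> N \<Longrightarrow> y \<in> K \<Longrightarrow> length ws = k \<Longrightarrow> set ws \<subseteq> Basis \<Longrightarrow>
      \<bar>local_rep A c \<omega>' y ws - local_rep A c \<omega> y ws\<bar> < \<epsilon>" for \<epsilon> \<omega>' \<omega>
    unfolding close_def using that by blast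
  have nbhd: "\<exists>\<epsilon>>0. \<forall>\<omega>'\<in>closed_forms A k. close \<epsilon> \<omega>' \<omega> \<longrightarrow> \<omega>' \<in> C" if \<omega>: "\<omega> \<in> C" for \<omega>
  proof -
    have "\<exists>\<epsilon>>0. \<forall>\<omega>'\<in>closed_forms A k. close \<epsilon> \<omega>' \<omega> \<longrightarrow> (\<forall>y\<in>snd p. T (chart_inv (fst p) y) (\<omega>' (chart_inv (fst p) y)))"
      if pN: "p \<in> N" for p
    proof -
      obtain c K where p: "p = (c, K)" by (cases p)
      have cK: "c \<in> A" "compact K" "K \<subseteq> snd c ` fst c" using N(3)[of c K] pN p by auto
      obtain \<epsilon> where \<epsilon>: "\<epsilon> > 0" and st: "\<forall>\<omega>'\<in>closed_forms A k.
        (\<forall>y\<in>K. \<forall>ws. length ws = k \<and> set ws \<subseteq> Basis \<longrightarrow> \<bar>local_rep A c \<omega>' y ws - local_rep A c \<omega> y ws\<bar> < \<epsilon>) \<longrightarrow>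
        (\<forall>y\<in>K. T (chart_inv c y) (\<omega>' (chart_inv c y)))"
        using stable[OF \<omega> cK] by (elim exE conjE)
      have "\<forall>\<omega>'\<in>closed_forms A k. close \<epsilon> \<omega>' \<omega> \<longrightarrow> (\<forall>y\<in>snd p. T (chart_inv (fst p) y) (\<omega>' (chart_inv (fst p) y)))"
      proof (intro ballI impI)
        fix \<omega>' y assume \<omega>': "\<omega>' \<in> closed_forms A k" "close \<epsilon> \<omega>' \<omega>" and y: "y \<in> snd p"
        have "\<forall>y\<in>K. \<forall>ws. length ws = k \<and> set ws \<subseteq> Basis \<longrightarrow> \<bar>local_rep A c \<omega>' y ws - local_rep A c \<omega> y ws\<bar> < \<epsilon>"
          using bspec[OF \<omega>'(2)[unfolded close_def] pN] unfolding p by simp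
        then show "T (chart_inv (fst p) y) (\<omega>' (chart_inv (fst p) y))"
          using st \<omega>'(1) y unfolding p by simp
      qed
      then show ?thesis using \<epsilon> by blast
    qed
    then obtain e where e: "\<And>p. p \<in> N \<Longrightarrow> e p > 0" "\<And>p \<omega>'. p \<in> N \<Longrightarrow> \<omega>' \<in> closed_forms A k \<Longrightarrow> close (e p) \<omega>' \<omega> \<Longrightarrow>
       (\<forall>y\<in>snd p. T (chart_inv (fst p) y) (\<omega>' (chart_inv (fst p) y)))" by metis
    \<comment> \<open>Finitely many compact sets cover the manifold, so one radius serves for all of
      them.\<close>
    define \<epsilon> where "\<epsilon> = Min (e ` N)"
    have \<epsilon>: "\<epsilon> > 0" "\<And>p. p \<in> N \<Longrightarrow> \<epsilon> \<le> e p" using N(1,2) e(1) by (auto simp: \<epsilon>_def)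
    have "\<omega>' \<in> C" if \<omega>': "\<omega>' \<in> closed_forms A k" "close \<epsilon> \<omega>' \<omega>" for \<omega>'
    proof -
      have "T x (\<omega>' x)" for x
      proof -
        obtain c K where p: "(c, K) \<in> N" "x \<in> fst c" "snd c x \<in> K" using N(4) by blast
        have "close (e (c, K)) \<omega>' \<omega>"
          using \<omega>'(2) \<epsilon>(2)[OF p(1)] unfolding close_def by fastforce
        from e(2)[OF p(1) \<omega>'(1) this] p(3) have "T (chart_inv c (snd c x)) (\<omega>' (chart_inv c (snd c x)))" by simp
        then show ?thesis using chart_inv_chart[OF A _ p(2)] N(3)[OF p(1)] by simp
      qed
      then show ?thesis using C \<omega>'(1) by blast
    qed
    then show ?thesis using \<epsilon>(1) by blast
  qed
  have open_close: "\<exists>W. openin (cinf_topology A k) W \<and> \<omega> \<in> W \<and> (\<forall>\<omega>'\<in>W. close \<epsilon> \<omega>' \<omega>)"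
    if \<omega>: "\<omega> \<in> smooth_forms A k" and \<epsilon>: "\<epsilon> > 0" for \<omega> \<epsilon>
  proof (intro exI conjI ballI)
    \<comment> \<open>Balls of order 0 are open in the smooth topology, and finitely many of them
      control the components everywhere.\<close>
    let ?W = "\<Inter>p\<in>N. cinf_ball A k \<omega> (fst p) (snd p) 0 \<epsilon>"
    show "openin (cinf_topology A k) ?W"
    proof (rule openin_Inter)
      show "openin (cinf_topology A k) X" if X: "X \<in> (\<lambda>p. cinf_ball A k \<omega> (fst p) (snd p) 0 \<epsilon>) ` N" for X
        unfolding cinf_topology_def
      proof (rule topology_generated_by_Basis)
        obtain c K where "(c, K) \<in> N" "X = cinf_ball A k \<omega> c K 0 \<epsilon>" using X by auto
        then show "X \<in> {cinf_ball A k \<omega> c K m \<epsilon> |\<omega> c K m \<epsilon>. \<omega> \<in> smooth_forms A k \<and> c \<in> A \<and> compact K \<and> K \<subseteq> snd c ` fst c \<and> 0 < \<epsilon>}"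
          using N(3) \<omega> \<epsilon> by blast
      qed
    qed (use N in auto)
    show "\<omega> \<in> ?W" using \<omega> \<epsilon> by (auto simp: cinf_ball_def)
    show "close \<epsilon> \<omega>' \<omega>" if "\<omega>' \<in> ?W" for \<omega>'
    proof (rule closeI)
      fix c K y and ws :: "(real^7) list"
      assume *: "(c, K) \<in> N" "y \<in> K" "length ws = k" "set ws \<subseteq> Basis"
      then have "\<omega>' \<in> cinf_ball A k \<omega> c K 0 \<epsilon>" using that by fastforce
      then have all: "\<forall>y\<in>K. \<forall>ws ds. length ws = k \<and> set ws \<subseteq> Basis \<and> length ds \<le> 0 \<and> set ds \<subseteq> Basis \<longrightarrow>
          \<bar>iter_deriv (\<lambda>z. local_rep A c \<omega>' z ws - local_rep A c \<omega> z ws) ds y\<bar> < \<epsilon>"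
        unfolding cinf_ball_def mem_Collect_eq by (rule conjunct2)
      show "\<bar>local_rep A c \<omega>' y ws - local_rep A c \<omega> y ws\<bar> < \<epsilon>"
        using all[rule_format, of y ws "[]"] * by simp
    qed
  qed
  have sm: "\<omega> \<in> smooth_forms A k" if "\<omega> \<in> closed_forms A k" for \<omega> using that by (rule closed_forms_smooth)
  have closed_open: "openin (closed_forms_topology A k) S"
    if S: "S \<subseteq> closed_forms A k" and n: "\<And>\<omega>. \<omega> \<in> S \<Longrightarrow> \<exists>\<epsilon>>0. \<forall>\<omega>'\<in>closed_forms A k. close \<epsilon> \<omega>' \<omega> \<longrightarrow> \<omega>' \<in> S" for S
  proof (subst openin_subopen, rule ballI)
    fix \<omega> assume \<omega>: "\<omega> \<in> S"
    obtain \<epsilon> where \<epsilon>: "\<epsilon> > 0" "\<forall>\<omega>'\<in>closed_forms A k. close \<epsilon> \<omega>' \<omega> \<longrightarrow> \<omega>' \<in> S" using n[OF \<omega>] by blast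
    obtain W where W: "openin (cinf_topology A k) W" "\<omega> \<in> W" "\<forall>\<omega>'\<in>W. close \<epsilon> \<omega>' \<omega>"
      using open_close[OF sm \<epsilon>(1)] S \<omega> by blast
    have "openin (closed_forms_topology A k) (W \<inter> closed_forms A k)"
      unfolding closed_forms_topology_def openin_subtopology using W(1) by blast
    then show "\<exists>V. openin (closed_forms_topology A k) V \<and> \<omega> \<in> V \<and> V \<subseteq> S"
      using W \<epsilon>(2) S \<omega> by blast
  qed
  have Cc: "C \<subseteq> closed_forms A k" using C by blast
  have 1: "openin (closed_forms_topology A k) C"
    using Cc nbhd by (rule closed_open)
  have 2: "form_cone C"
    unfolding form_cone_def
  proof (intro ballI allI impI, elim conjE)
    fix a b s t assume ab: "a \<in> C" "b \<in> C" and st: "(0::real) \<le> s" "(0::real) \<le> t" "\<not> (s = 0 \<and> t = 0)"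
    have "T x (form_lin s a t b x)" for x
      unfolding form_lin_def using ab C st by (intro cone) (auto intro: smooth_forms_alt[OF sm])
    then show "form_lin s a t b \<in> C" using closed_forms_lin[OF A] ab C by blast
  qed
  have cls: "dR_class A k \<omega> \<in> dR_class A k ` C \<longleftrightarrow> (\<exists>\<phi>\<in>C. (\<omega>, \<phi>) \<in> dR_rel A k)" if "\<omega> \<in> closed_forms A k" for \<omega>
    using dR_class_eq_iff[OF A that] Cc by (auto simp: image_iff)
  have sub: "dR_class A k ` C \<subseteq> dR_cohomology A k"
    unfolding dR_cohomology_def dR_class_def using Cc by (auto intro: quotientI)
  have shift: "\<exists>\<phi>\<in>C. (\<omega>', \<phi>) \<in> dR_rel A k"
    if "(\<omega>, \<phi>) \<in> dR_rel A k" "\<omega>' \<in> closed_forms A k" "close \<epsilon> \<omega>' \<omega>"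
      "\<forall>\<phi>'\<in>closed_forms A k. close \<epsilon> \<phi>' \<phi> \<longrightarrow> \<phi>' \<in> C" for \<omega> \<omega>' \<phi> \<epsilon>
  proof -
    have cl: "\<omega> \<in> closed_forms A k" "\<phi> \<in> closed_forms A k" using that(1) unfolding dR_rel_iff by auto
    \<comment> \<open>Subtracting the fixed exact form makes \<open>\<phi>'\<close> cohomologous to
      \<open>\<omega>'\<close>, while it differs from \<open>\<phi>\<close> exactly as
      \<open>\<omega>'\<close> differs from \<open>\<omega>\<close>.\<close>
    define \<phi>' where "\<phi>' = form_lin 1 \<omega>' (- 1) (form_lin 1 \<omega> (- 1) \<phi>)"
    have c': "\<phi>' \<in> closed_forms A k" unfolding \<phi>'_def by (intro closed_forms_lin[OF A] cl that(2))
    have "local_rep A c \<phi>' y ws - local_rep A c \<phi> y ws = local_rep A c \<omega>' y ws - local_rep A c \<omega> y ws" for c y ws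
      by (simp add: \<phi>'_def local_rep_lin)
    then have "close \<epsilon> \<phi>' \<phi>" using that(3) by (simp add: close_def)
    then have "\<phi>' \<in> C" using that(4) c' by blast
    moreover have "(\<omega>', \<phi>') \<in> dR_rel A k"
      by (rule dR_rel_diff[OF _ that(1,2) c']) (simp add: \<phi>'_def form_lin_def)
    ultimately show ?thesis by blast
  qed
  have 3: "openin (dR_quotient_topology A k) (dR_class A k ` C)"
    unfolding openin_dR_quotient_topology
  proof (intro conjI sub closed_open)
    fix \<omega> assume "\<omega> \<in> {\<omega> \<in> closed_forms A k. dR_class A k \<omega> \<in> dR_class A k ` C}"
    then obtain \<phi> where \<phi>: "\<phi> \<in> C" "(\<omega>, \<phi>) \<in> dR_rel A k" using cls by blast
    obtain \<epsilon> where \<epsilon>: "\<epsilon> > 0" "\<forall>\<phi>'\<in>closed_forms A k. close \<epsilon> \<phi>' \<phi> \<longrightarrow> \<phi>' \<in> C" using nbhd[OF \<phi>(1)] by blast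
    then show "\<exists>\<epsilon>>0. \<forall>\<omega>'\<in>closed_forms A k. close \<epsilon> \<omega>' \<omega> \<longrightarrow> \<omega>' \<in> {\<omega> \<in> closed_forms A k. dR_class A k \<omega> \<in> dR_class A k ` C}"
      using shift[OF \<phi>(2)] cls by blast
  qed auto
  have 4: "openin (dR_linear_topology A k) (dR_class A k ` C)"
    unfolding openin_dR_linear_topology
  proof (intro conjI sub allI impI)
    fix n and \<omega> :: "nat \<Rightarrow> 'a form" assume \<omega>: "\<forall>i<n. \<omega> i \<in> closed_forms A k"
    have fc: "form_comb n t \<omega> \<in> closed_forms A k" for t by (rule form_comb_closed[OF A \<omega>])
    show "open {t :: nat \<Rightarrow> real. dR_class A k (form_comb n t \<omega>) \<in> dR_class A k ` C}"
    proof (subst open_subopen, rule ballI)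
      fix t0 assume "t0 \<in> {t :: nat \<Rightarrow> real. dR_class A k (form_comb n t \<omega>) \<in> dR_class A k ` C}"
      then obtain \<phi> where \<phi>: "\<phi> \<in> C" "(form_comb n t0 \<omega>, \<phi>) \<in> dR_rel A k" using cls[OF fc] by blast
      obtain \<epsilon> where \<epsilon>: "\<epsilon> > 0" "\<forall>\<phi>'\<in>closed_forms A k. close \<epsilon> \<phi>' \<phi> \<longrightarrow> \<phi>' \<in> C" using nbhd[OF \<phi>(1)] by blast
      define L where "L = {ws :: (real^7) list. set ws \<subseteq> Basis \<and> length ws = k}"
      have L: "finite L" unfolding L_def by (rule finite_lists_length_eq) simp
      define I where "I = {..<n} \<times> N \<times> L"
      have "\<exists>b. \<forall>y\<in>snd (fst (snd q)). \<bar>local_rep A (fst (fst (snd q))) (\<omega> (fst q)) y (snd (snd q))\<bar> \<le> b" if "q \<in> I" for q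
      proof -
        obtain i c K ws where q: "q = (i, (c, K), ws)" by (metis prod.collapse)
        have "i < n" "(c, K) \<in> N" "length ws = k" using that by (auto simp: q I_def L_def)
        then show ?thesis using bounded_local_rep[OF sm, of "\<omega> i" c K ws] \<omega> N(3) unfolding q by (metis fst_conv snd_conv)
      qed
      then obtain b where b: "\<And>q y. q \<in> I \<Longrightarrow> y \<in> snd (fst (snd q)) \<Longrightarrow>
        \<bar>local_rep A (fst (fst (snd q))) (\<omega> (fst q)) y (snd (snd q))\<bar> \<le> b q" by metis
      define B where "B = (\<Sum>q\<in>I. \<bar>b q\<bar>)"
      have I: "finite I" using N(1) L by (simp add: I_def)
      have B: "\<bar>local_rep A c (\<omega> i) y ws\<bar> \<le> B" if "i < n" "(c, K) \<in> N" "y \<in> K" "length ws = k" "set ws \<subseteq> Basis" for i c K y ws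
      proof -
        have q: "(i, (c, K), ws) \<in> I" using that by (simp add: I_def L_def)
        have "\<bar>local_rep A c (\<omega> i) y ws\<bar> \<le> b (i, (c, K), ws)" using b[OF q] that(3) by simp
        also have "\<dots> \<le> \<bar>b (i, (c, K), ws)\<bar>" by simp
        also have "\<dots> \<le> B" unfolding B_def by (rule member_le_sum[OF q]) (auto simp: I)
        finally show ?thesis .
      qed
      have B0: "B \<ge> 0" by (simp add: B_def sum_nonneg)
      \<comment> \<open>Changing each of \<open>n\<close> coefficients by less than \<open>d\<close>
        alters a component bounded by \<open>B\<close> by less than \<open>\<epsilon>\<close>. The
        summand 1 keeps the denominator positive and the estimate strict.\<close>
      define d where "d = \<epsilon> / (real n * B + 1)"
      have nB: "real n * B + 1 > 0" using B0 by (simp add: add_nonneg_pos)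
      then have d: "d > 0" using \<epsilon>(1) by (simp add: d_def)
      define V where "V = (\<Inter>i\<in>{..<n}. {t :: nat \<Rightarrow> real. \<bar>t i - t0 i\<bar> < d})"
      have "open {t :: nat \<Rightarrow> real. \<bar>t i - t0 i\<bar> < d}" for i
        by (intro open_Collect_less continuous_intros continuous_on_product_coordinates)
      then have "open V" unfolding V_def by (intro open_INT) auto
      moreover have "t0 \<in> V" using d by (simp add: V_def)
      moreover have "dR_class A k (form_comb n t \<omega>) \<in> dR_class A k ` C" if "t \<in> V" for t
      proof -
        have "close \<epsilon> (form_comb n t \<omega>) (form_comb n t0 \<omega>)"
        proof (rule closeI)
          fix c K y and ws :: "(real^7) list"
          assume *: "(c, K) \<in> N" "y \<in> K" "length ws = k" "set ws \<subseteq> Basis"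
          have "\<bar>local_rep A c (form_comb n t \<omega>) y ws - local_rep A c (form_comb n t0 \<omega>) y ws\<bar>
            = \<bar>\<Sum>i<n. (t i - t0 i) * local_rep A c (\<omega> i) y ws\<bar>"
            by (simp add: local_rep_def form_comb_def Let_def sum_subtractf algebra_simps)
          also have "\<dots> \<le> (\<Sum>i<n. \<bar>(t i - t0 i) * local_rep A c (\<omega> i) y ws\<bar>)" by (rule sum_abs)
          also have "\<dots> \<le> (\<Sum>i<n. d * B)"
          proof (rule sum_mono)
            fix i assume "i \<in> {..<n}"
            then show "\<bar>(t i - t0 i) * local_rep A c (\<omega> i) y ws\<bar> \<le> d * B"
              unfolding abs_mult using that B[of i c K y ws] * d by (intro mult_mono) (auto simp: V_def less_imp_le)
          qed
          also have "\<dots> = d * (real n * B)" by simp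
          also have "\<dots> < d * (real n * B + 1)" using d by simp
          also have "\<dots> = \<epsilon>" using nB by (simp add: d_def)
          finally show "\<bar>local_rep A c (form_comb n t \<omega>) y ws - local_rep A c (form_comb n t0 \<omega>) y ws\<bar> < \<epsilon>" .
        qed
        then show ?thesis using shift[OF \<phi>(2) fc _ \<epsilon>(2)] cls[OF fc] by blast
      qed
      ultimately show "\<exists>V. open V \<and> t0 \<in> V \<and> V \<subseteq> {t :: nat \<Rightarrow> real. dR_class A k (form_comb n t \<omega>) \<in> dR_class A k ` C}"
        by blast
    qed
  qed
  have 5: "dR_cone A k (dR_class A k ` C)"
    unfolding dR_cone_def
  proof (intro ballI allI impI)
    fix a b s t assume a: "a \<in> dR_class A k ` C" and b: "b \<in> dR_class A k ` C"
      and st: "(0::real) \<le> s \<and> (0::real) \<le> t \<and> \<not> (s = 0 \<and> t = 0)"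
    obtain \<alpha> \<beta> where \<alpha>: "\<alpha> \<in> C" "a = dR_class A k \<alpha>" and \<beta>: "\<beta> \<in> C" "b = dR_class A k \<beta>" using a b by blast
    have l: "form_lin s \<alpha> t \<beta> \<in> C" using 2 \<alpha> \<beta> st unfolding form_cone_def by blast
    \<comment> \<open>\<open>dR_lin\<close> is a union over representatives; all of them yield the
      same class, so the union is that class.\<close>
    have "dR_class A k (form_lin s \<alpha>' t \<beta>') = dR_class A k (form_lin s \<alpha> t \<beta>)" if "\<alpha>' \<in> a" "\<beta>' \<in> b" for \<alpha>' \<beta>'
    proof -
      have r: "(\<alpha>, \<alpha>') \<in> dR_rel A k" "(\<beta>, \<beta>') \<in> dR_rel A k" using that \<alpha>(2) \<beta>(2) by (auto simp: dR_class_def)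
      have r': "(form_lin s \<alpha> t \<beta>, form_lin s \<alpha>' t \<beta>') \<in> dR_rel A k" by (rule dR_rel_lin[OF A r])
      then have "form_lin s \<alpha> t \<beta> \<in> closed_forms A k" "form_lin s \<alpha>' t \<beta>' \<in> closed_forms A k" unfolding dR_rel_iff by auto
      then show ?thesis using dR_class_eq_iff[OF A] r' by metis
    qed
    moreover have "\<alpha> \<in> a" "\<beta> \<in> b"
      using dR_rel_refl \<alpha> \<beta> Cc by (auto simp: dR_class_def)
    ultimately have "dR_lin A k s a t b = dR_class A k (form_lin s \<alpha> t \<beta>)"
      unfolding dR_lin_def by blast
    then show "dR_lin A k s a t b \<in> dR_class A k ` C" using l by blast
  qed
  show ?thesis using 1 2 3 4 5 by blast
qed


section \<open>Stability of taming\<close>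

text \<open>On a compact set the pairing is bounded away from 0 and the coefficients are bounded.
  The conclusion compares signs by a product, since the frames of a 4-form occur in both
  orientations and produce both signs.\<close>

lemma pairing_sign_stable:
  fixes u g :: "'j \<Rightarrow> 'z::metric_space \<Rightarrow> real"
  assumes Z: "compact Z" and J: "finite J" and u: "\<And>j. j \<in> J \<Longrightarrow> continuous_on Z (u j)" and g: "\<And>j. j \<in> J \<Longrightarrow> continuous_on Z (g j)"
    and nz: "\<And>z. z \<in> Z \<Longrightarrow> (\<Sum>j\<in>J. u j z * g j z) \<noteq> 0"
  shows "\<exists>\<epsilon>>0. \<forall>z\<in>Z. \<forall>u'. (\<forall>j\<in>J. \<bar>u' j - u j z\<bar> < \<epsilon>) \<longrightarrow> (\<Sum>j\<in>J. u j z * g j z) * (\<Sum>j\<in>J. u' j * g j z) > 0"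
proof (cases "Z = {}")
  case True
  then show ?thesis by (intro exI[of _ 1]) simp
next
  case False
  define h where "h z = \<bar>\<Sum>j\<in>J. u j z * g j z\<bar>" for z
  define G where "G z = (\<Sum>j\<in>J. \<bar>g j z\<bar>)" for z
  have "continuous_on Z h" unfolding h_def by (intro continuous_intros u g)
  then obtain z0 where z0: "z0 \<in> Z" "\<And>z. z \<in> Z \<Longrightarrow> h z0 \<le> h z"
    using continuous_attains_inf[OF Z False] by blast
  have "continuous_on Z G" unfolding G_def by (intro continuous_intros g)
  then obtain z1 where z1: "z1 \<in> Z" "\<And>z. z \<in> Z \<Longrightarrow> G z \<le> G z1"
    using continuous_attains_sup[OF Z False] by blast
  have m: "h z0 > 0" using nz[OF z0(1)] by (simp add: h_def)
  have G0: "G z \<ge> 0" for z by (simp add: G_def sum_nonneg)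
  define \<epsilon> where "\<epsilon> = h z0 / (G z1 + 1)"
  have \<epsilon>: "\<epsilon> > 0" using m G0[of z1] by (simp add: \<epsilon>_def add_nonneg_pos)
  have "(\<Sum>j\<in>J. u j z * g j z) * (\<Sum>j\<in>J. u' j * g j z) > 0" if z: "z \<in> Z" and u': "\<forall>j\<in>J. \<bar>u' j - u j z\<bar> < \<epsilon>" for z u'
  proof -
    have "\<bar>(\<Sum>j\<in>J. u' j * g j z) - (\<Sum>j\<in>J. u j z * g j z)\<bar> = \<bar>\<Sum>j\<in>J. (u' j - u j z) * g j z\<bar>"
      by (simp add: sum_subtractf algebra_simps)
    also have "\<dots> \<le> (\<Sum>j\<in>J. \<bar>(u' j - u j z) * g j z\<bar>)" by (rule sum_abs)
    also have "\<dots> \<le> (\<Sum>j\<in>J. \<epsilon> * \<bar>g j z\<bar>)"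
      unfolding abs_mult using u' by (intro sum_mono mult_right_mono) (auto simp: less_imp_le)
    also have "\<dots> = \<epsilon> * G z" by (simp add: G_def sum_distrib_left)
    also have "\<dots> \<le> \<epsilon> * G z1" using z1(2)[OF z] \<epsilon> by (intro mult_left_mono) auto
    also have "\<dots> < \<epsilon> * (G z1 + 1)" using \<epsilon> by simp
    also have "\<dots> = h z0" using G0[of z1] by (simp add: \<epsilon>_def add_nonneg_eq_0_iff)
    also have "\<dots> \<le> \<bar>\<Sum>j\<in>J. u j z * g j z\<bar>" using z0(2)[OF z] by (simp add: h_def)
    finally show ?thesis
      by (auto simp: zero_less_mult_iff abs_if split: if_splits)
  qed
  then show ?thesis using \<epsilon> by blast
qed

section \<open>Taming as a sign condition on a compact set\<close>

abbreviation orthonormal_pairs :: "((real^7) \<times> (real^7)) set" where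
  "orthonormal_pairs \<equiv> {(a, b). a \<bullet> a = 1 \<and> b \<bullet> b = 1 \<and> a \<bullet> b = 0}"

lemma compact_orthonormal_pairs: "compact orthonormal_pairs"
proof -
  have "closed {x :: (real^7) \<times> (real^7). fst x \<bullet> snd x = 0}"
    by (intro closed_Collect_eq continuous_intros)
  then have "compact ((sphere 0 1 \<times> sphere 0 1) \<inter> {x :: (real^7) \<times> (real^7). fst x \<bullet> snd x = 0})"
    by (intro compact_Int_closed compact_Times compact_sphere)
  also have "\<dots> = orthonormal_pairs" by (auto simp: norm_eq_1)
  finally show ?thesis .
qed

lemma continuous_on_cross [continuous_intros]:
  "continuous_on S f \<Longrightarrow> continuous_on S g \<Longrightarrow> continuous_on S (\<lambda>x. cross (f x) (g x))"
  by (rule bounded_bilinear.continuous_on[OF bounded_bilinear_cross])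

lemma continuous_on_det7 [continuous_intros]:
  assumes "continuous_on S a" "continuous_on S b" "continuous_on S c" "continuous_on S d"
    "continuous_on S e" "continuous_on S f" "continuous_on S g"
  shows "continuous_on S (\<lambda>x. det7 (a x) (b x) (c x) (d x) (e x) (f x) (g x))"
  unfolding det7_def
proof (rule continuous_on_det)
  have "\<forall>i. continuous_on S (\<lambda>x. v7 (a x) (b x) (c x) (d x) (e x) (f x) (g x) $ i $ j)" for j
    unfolding forall_7 v7_nth using assms by (intro conjI continuous_intros)
  then show "continuous_on S (\<lambda>x. v7 (a x) (b x) (c x) (d x) (e x) (f x) (g x) $ i $ j)" for i j by blast
qed

lemma continuous_on_transpose [continuous_intros]:
  fixes A :: "'a::topological_space \<Rightarrow> real^'n^'m"
  shows "continuous_on S A \<Longrightarrow> continuous_on S (\<lambda>x. transpose (A x))"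
  unfolding transpose_def by (intro continuous_intros)

lemma frame_at_chart:
  assumes "smooth_atlas A" "c \<in> A" "y \<in> snd c ` fst c"
  shows "coord_frame A c (chart_inv c y) \<in> frames A (chart_inv c y)"
proof -
  obtain x where x: "x \<in> fst c" "y = snd c x" using assms(3) by blast
  show ?thesis using coord_frame_in_frames[OF assms(1,2) x(1)] chart_inv_chart[OF assms(1,2) x(1)] x(2) by simp
qed

lemma local_rep_form3: "local_rep A c \<omega> y [u, v, w] = form3 (coord_frame A c (chart_inv c y)) (\<omega> (chart_inv c y)) u v w"
  by (simp add: local_rep_def form3_def Let_def)

lemma local_rep_form4: "local_rep A c \<omega> y [u, v, w, z] = form4 (coord_frame A c (chart_inv c y)) (\<omega> (chart_inv c y)) u v w z"
  by (simp add: local_rep_def form4_def Let_def)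

lemma continuous_on_local_rep:
  "\<omega> \<in> smooth_forms A k \<Longrightarrow> c \<in> A \<Longrightarrow> length ws = k \<Longrightarrow> K \<subseteq> snd c ` fst c \<Longrightarrow> continuous_on K (\<lambda>y. local_rep A c \<omega> y ws)"
  using smooth_on_continuous_on[OF smooth_forms_local] continuous_on_subset by blast

text \<open>Taming in all frames over \<open>K\<close> is the sign of a real function on a compact
  set that is linear in the components of the form. Hence one \<open>\<epsilon>\<close> works for
  all frames and all orthonormal pairs.\<close>

lemma evaluation_sign_stable:
  fixes ws :: "'j::finite \<Rightarrow> (real^7) list"
    and g :: "'j \<Rightarrow> ((real^7) \<times> (real^7^7)) \<times> (real^7) \<times> (real^7) \<Rightarrow> real"
    and val :: "'a::topological_space form \<Rightarrow> real^7 \<Rightarrow> real^7^7 \<Rightarrow> real^7 \<Rightarrow> real^7 \<Rightarrow> real"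
  assumes \<omega>: "\<omega> \<in> smooth_forms A k" and c: "c \<in> A" and K: "K \<subseteq> snd c ` fst c"
    and Z: "compact Z" "\<And>y E. (y, E) \<in> Z \<Longrightarrow> y \<in> K"
    and ws: "\<And>j. length (ws j) = k" "\<And>j. set (ws j) \<subseteq> Basis"
    and g: "\<And>j. continuous_on (Z \<times> orthonormal_pairs) (g j)"
    and val: "\<And>\<omega> y E a b. \<omega> \<in> smooth_forms A k \<Longrightarrow> y \<in> K \<Longrightarrow>
      val \<omega> y E a b = (\<Sum>j\<in>UNIV. local_rep A c \<omega> y (ws j) * g j ((y, E), (a, b)))"
    and nz: "\<And>y E a b. (y, E) \<in> Z \<Longrightarrow> (a, b) \<in> orthonormal_pairs \<Longrightarrow> val \<omega> y E a b \<noteq> 0"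
  shows "\<exists>\<epsilon>>0. \<forall>\<omega>'\<in>smooth_forms A k.
    (\<forall>y\<in>K. \<forall>ws. length ws = k \<and> set ws \<subseteq> Basis \<longrightarrow> \<bar>local_rep A c \<omega>' y ws - local_rep A c \<omega> y ws\<bar> < \<epsilon>) \<longrightarrow>
    (\<forall>y E a b. (y, E) \<in> Z \<longrightarrow> (a, b) \<in> orthonormal_pairs \<longrightarrow> val \<omega> y E a b * val \<omega>' y E a b > 0)"
proof -
  let ?O = "Z \<times> orthonormal_pairs"
  have "\<exists>\<epsilon>>0. \<forall>z\<in>?O. \<forall>u'. (\<forall>j\<in>UNIV. \<bar>u' j - local_rep A c \<omega> (fst (fst z)) (ws j)\<bar> < \<epsilon>) \<longrightarrow>
      (\<Sum>j\<in>UNIV. local_rep A c \<omega> (fst (fst z)) (ws j) * g j z) * (\<Sum>j\<in>UNIV. u' j * g j z) > 0"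
  proof (rule pairing_sign_stable[OF _ finite _ g])
    show "compact ?O" by (intro compact_Times compact_orthonormal_pairs Z(1))
    show "continuous_on ?O (\<lambda>z. local_rep A c \<omega> (fst (fst z)) (ws j))" for j
      by (rule continuous_on_compose2[OF continuous_on_local_rep[OF \<omega> c ws(1) K]])
        (auto simp: Z(2) intro!: continuous_intros)
    show "(\<Sum>j\<in>UNIV. local_rep A c \<omega> (fst (fst z)) (ws j) * g j z) \<noteq> 0" if z: "z \<in> ?O" for z
    proof -
      obtain y E a b where ze: "z = ((y, E), (a, b))" by (metis prod.collapse)
      then show ?thesis using z nz[of y E a b] val[OF \<omega> Z(2), of y E E a b] by simp
    qed
  qed
  then obtain \<epsilon> where \<epsilon>: "\<epsilon> > 0" and st: "\<forall>z\<in>?O. \<forall>u'. (\<forall>j\<in>UNIV. \<bar>u' j - local_rep A c \<omega> (fst (fst z)) (ws j)\<bar> < \<epsilon>) \<longrightarrow>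
      (\<Sum>j\<in>UNIV. local_rep A c \<omega> (fst (fst z)) (ws j) * g j z) * (\<Sum>j\<in>UNIV. u' j * g j z) > 0" by blast
  show ?thesis
  proof (intro exI[of _ \<epsilon>] conjI \<epsilon> ballI allI impI)
    fix \<omega>' y E a b
    assume \<omega>': "\<omega>' \<in> smooth_forms A k" and
      close: "\<forall>y\<in>K. \<forall>ws. length ws = k \<and> set ws \<subseteq> Basis \<longrightarrow> \<bar>local_rep A c \<omega>' y ws - local_rep A c \<omega> y ws\<bar> < \<epsilon>"
      and yE: "(y, E) \<in> Z" and ab: "(a, b) \<in> orthonormal_pairs"
    have y: "y \<in> K" by (rule Z(2)[OF yE])
    have z: "((y, E), (a, b)) \<in> ?O" using yE ab by blast
    have "\<forall>j\<in>UNIV. \<bar>local_rep A c \<omega>' y (ws j) - local_rep A c \<omega> y (ws j)\<bar> < \<epsilon>"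
      using close y ws by blast
    then show "val \<omega> y E a b * val \<omega>' y E a b > 0"
      using st[rule_format, OF z, of "\<lambda>j. local_rep A c \<omega>' y (ws j)"] by (simp add: val[OF \<omega> y] val[OF \<omega>' y])
  qed
qed

text \<open>The frames adapted to the fixed 3-form, as matrices relative to the coordinate frames
  over \<open>K\<close>, form the compact set \<open>Z\<close>, and \<open>star_pb4_sum\<close>
  supplies the linear dependence on the 4-form.\<close>

lemma tame4_stable:
  assumes A: "smooth_atlas A" and \<phi>: "\<phi> \<in> smooth_forms A 3" "positive3 A \<phi>" and \<psi>: "\<psi> \<in> smooth_forms A 4"
    and tame: "\<And>x e. e \<in> g2_of3 A \<phi> x \<Longrightarrow> tame4 (form4 e (\<psi> x))"
    and c: "c \<in> A" and K: "compact K" "K \<subseteq> snd c ` fst c"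
  shows "\<exists>\<epsilon>>0. \<forall>\<psi>'\<in>smooth_forms A 4.
    (\<forall>y\<in>K. \<forall>ws. length ws = 4 \<and> set ws \<subseteq> Basis \<longrightarrow> \<bar>local_rep A c \<psi>' y ws - local_rep A c \<psi> y ws\<bar> < \<epsilon>) \<longrightarrow>
    (\<forall>y\<in>K. \<forall>e\<in>g2_of3 A \<phi> (chart_inv c y). tame4 (form4 e (\<psi>' (chart_inv c y))))"
proof -
  define X where "X y = chart_inv c y" for y
  define F where "F y = coord_frame A c (X y)" for y
  have F: "F y \<in> frames A (X y)" if "y \<in> K" for y
    unfolding F_def X_def using that K(2) by (intro frame_at_chart[OF A c]) auto
  define f where "f y = form3 (F y) (\<phi> (X y))" for y
  have fa: "alt3 (f y)" if "y \<in> K" for y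
    unfolding f_def by (rule alt3_form3[OF F[OF that] smooth_forms_alt[OF \<phi>(1)]])
  have fn: "nondeg3 (f y)" if y: "y \<in> K" for y
  proof -
    obtain e where e: "e \<in> frames A (X y)" "form3 e (\<phi> (X y)) = P3" using positive3D[OF \<phi>(2)] by blast
    obtain E where E: "invertible E" "e = (\<lambda>w. F y (E *v w))" using frames_matrix[OF F[OF y] e(1)] by metis
    have "pb3 E (f y) = P3" using e(2) by (simp add: f_def E(2) form3_compose)
    then show ?thesis by (rule nondeg3_pb3[OF E(1)])
  qed
  define Z where "Z = {(y, E). y \<in> K \<and> pb3 E (f y) = P3}"
  have Z: "compact Z"
    unfolding Z_def
  proof (rule compact_frames[OF K(1) fa fn])
    show "continuous_on K (\<lambda>y. f y (axis i 1) (axis j 1) (axis k 1))" for i j k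
      unfolding f_def F_def X_def local_rep_form3[symmetric]
      by (rule continuous_on_local_rep[OF \<phi>(1) c _ K(2)]) simp
  qed
  define val where "val \<psi> y E a b = star (form4 (\<lambda>w. F y (E *v w)) (\<psi> (X y))) a b (cross a b)" for \<psi> y E a b
  define ws where "ws = (\<lambda>(i, j, k, l). [axis i 1, axis j 1, axis k 1, axis l 1 :: real^7])"
  define g where "g = (\<lambda>(i, j, k, l) (z :: ((real^7) \<times> (real^7^7)) \<times> (real^7) \<times> (real^7)).
    det7 (transpose (snd (fst z)) *v axis i 1) (transpose (snd (fst z)) *v axis j 1) (transpose (snd (fst z)) *v axis k 1)
      (transpose (snd (fst z)) *v axis l 1) (fst (snd z)) (snd (snd z)) (cross (fst (snd z)) (snd (snd z))))"
  have val: "val \<psi> y E a b = (\<Sum>j\<in>UNIV. local_rep A c \<psi> y (ws j) * g j ((y, E), (a, b)))"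
    if "\<psi> \<in> smooth_forms A 4" "y \<in> K" for \<psi> y E a b
    unfolding val_def form4_compose star_pb4_sum[OF alt4_form4[OF F[OF that(2)] smooth_forms_alt[OF that(1)]]]
    by (simp add: g_def ws_def local_rep_form4 F_def X_def sum.cartesian_product case_prod_unfold flip: UNIV_Times_UNIV)
  have frame: "(\<lambda>w. F y (E *v w)) \<in> g2_of3 A \<phi> (X y)" if "(y, E) \<in> Z" for y E
  proof -
    have y: "y \<in> K" "pb3 E (f y) = P3" using that by (auto simp: Z_def)
    have "invertible E" by (rule pb3_P3_invertible[OF fa[OF y(1)] y(2)])
    then show ?thesis
      unfolding g2_of3_iff[OF \<phi>(1)] form3_compose using frames_compose(1)[OF F[OF y(1)]] y(2) by (simp add: f_def)
  qed
  have pos: "val \<psi> y E a b > 0" if "(y, E) \<in> Z" "(a, b) \<in> orthonormal_pairs" for y E a b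
    using tame[OF frame[OF that(1)]] that(2) unfolding tame4_def tame3_def val_def by simp
  have "\<exists>\<epsilon>>0. \<forall>\<psi>'\<in>smooth_forms A 4.
    (\<forall>y\<in>K. \<forall>ws. length ws = 4 \<and> set ws \<subseteq> Basis \<longrightarrow> \<bar>local_rep A c \<psi>' y ws - local_rep A c \<psi> y ws\<bar> < \<epsilon>) \<longrightarrow>
    (\<forall>y E a b. (y, E) \<in> Z \<longrightarrow> (a, b) \<in> orthonormal_pairs \<longrightarrow> val \<psi> y E a b * val \<psi>' y E a b > 0)"
  proof (rule evaluation_sign_stable[where ws = ws and g = g and val = val, OF \<psi> c K(2) Z _ _ _ _ val])
    show "continuous_on (Z \<times> orthonormal_pairs) (g j)" for j
      unfolding g_def case_prod_unfold by (intro continuous_intros)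
    show "val \<psi> y E a b \<noteq> 0" if "(y, E) \<in> Z" "(a, b) \<in> orthonormal_pairs" for y E a b
      using pos[OF that] by simp
  qed (auto simp: Z_def ws_def)
  then obtain \<epsilon> where \<epsilon>: "\<epsilon> > 0" and st: "\<forall>\<psi>'\<in>smooth_forms A 4.
    (\<forall>y\<in>K. \<forall>ws. length ws = 4 \<and> set ws \<subseteq> Basis \<longrightarrow> \<bar>local_rep A c \<psi>' y ws - local_rep A c \<psi> y ws\<bar> < \<epsilon>) \<longrightarrow>
    (\<forall>y E a b. (y, E) \<in> Z \<longrightarrow> (a, b) \<in> orthonormal_pairs \<longrightarrow> val \<psi> y E a b * val \<psi>' y E a b > 0)"
    by (elim exE conjE)
  show ?thesis
  proof (intro exI[of _ \<epsilon>] conjI \<epsilon> ballI impI)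
    fix \<psi>' y e
    assume \<psi>': "\<psi>' \<in> smooth_forms A 4" and
      close: "\<forall>y\<in>K. \<forall>ws. length ws = 4 \<and> set ws \<subseteq> Basis \<longrightarrow> \<bar>local_rep A c \<psi>' y ws - local_rep A c \<psi> y ws\<bar> < \<epsilon>"
      and y: "y \<in> K" and e: "e \<in> g2_of3 A \<phi> (chart_inv c y)"
    have ef: "e \<in> frames A (X y)" "form3 e (\<phi> (X y)) = P3" using e g2_of3_iff[OF \<phi>(1)] by (auto simp: X_def)
    obtain E where E: "invertible E" "e = (\<lambda>w. F y (E *v w))" using frames_matrix[OF F[OF y] ef(1)] by metis
    have yE: "(y, E) \<in> Z" using y ef(2) by (simp add: Z_def f_def E(2) form3_compose)
    have "val \<psi>' y E a b > 0" if "(a, b) \<in> orthonormal_pairs" for a b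
      using st[rule_format, OF \<psi>' close[rule_format] yE that] pos[OF yE that] by (simp add: zero_less_mult_iff)
    then show "tame4 (form4 e (\<psi>' (chart_inv c y)))"
      unfolding tame4_def tame3_def E(2) val_def X_def by simp
  qed
qed

text \<open>Compactness is taken for all frames adapted to the fixed 4-form, so the orientation
  stays out of it; the oriented frames, on which the sign is positive, are singled out at the
  end.\<close>

lemma tame3_stable:
  assumes A: "smooth_atlas A" and ori: "orientation A ori" and \<psi>: "\<psi> \<in> smooth_forms A 4" "positive4 A \<psi>" and \<phi>: "\<phi> \<in> smooth_forms A 3"
    and tame: "\<And>x e. e \<in> g2_of4 ori \<psi> x \<Longrightarrow> tame3 (form3 e (\<phi> x))"
    and c: "c \<in> A" and K: "compact K" "K \<subseteq> snd c ` fst c"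
  shows "\<exists>\<epsilon>>0. \<forall>\<phi>'\<in>smooth_forms A 3.
    (\<forall>y\<in>K. \<forall>ws. length ws = 3 \<and> set ws \<subseteq> Basis \<longrightarrow> \<bar>local_rep A c \<phi>' y ws - local_rep A c \<phi> y ws\<bar> < \<epsilon>) \<longrightarrow>
    (\<forall>y\<in>K. \<forall>e\<in>g2_of4 ori \<psi> (chart_inv c y). tame3 (form3 e (\<phi>' (chart_inv c y))))"
proof -
  define X where "X y = chart_inv c y" for y
  define F where "F y = coord_frame A c (X y)" for y
  have F: "F y \<in> frames A (X y)" if "y \<in> K" for y
    unfolding F_def X_def using that K(2) by (intro frame_at_chart[OF A c]) auto
  define f where "f y = form4 (F y) (\<psi> (X y))" for y
  have fa: "alt4 (f y)" if "y \<in> K" for y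
    unfolding f_def by (rule alt4_form4[OF F[OF that] smooth_forms_alt[OF \<psi>(1)]])
  have fn: "\<exists>E. pb4 E (f y) = S4" if y: "y \<in> K" for y
  proof -
    obtain e where e: "e \<in> frames A (X y)" "form4 e (\<psi> (X y)) = S4" using positive4D[OF \<psi>(2)] by blast
    obtain E where E: "invertible E" "e = (\<lambda>w. F y (E *v w))" using frames_matrix[OF F[OF y] e(1)] by metis
    have "pb4 E (f y) = S4" using e(2) by (simp add: f_def E(2) form4_compose)
    then show ?thesis by blast
  qed
  define Z where "Z = {(y, E). y \<in> K \<and> pb4 E (f y) = S4}"
  have Z: "compact Z"
    unfolding Z_def
  proof (rule compact_frames4[OF K(1) fa fn])
    show "continuous_on K (\<lambda>y. f y (axis i 1) (axis j 1) (axis k 1) (axis l 1))" for i j k l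
      unfolding f_def F_def X_def local_rep_form4[symmetric]
      by (rule continuous_on_local_rep[OF \<psi>(1) c _ K(2)]) simp
  qed
  define val where "val \<phi> y E a b = form3 (\<lambda>w. F y (E *v w)) (\<phi> (X y)) a b (cross a b)" for \<phi> y E a b
  define ws where "ws = (\<lambda>(i, j, k). [axis i 1, axis j 1, axis k 1 :: real^7])"
  define g where "g = (\<lambda>(i, j, k) (z :: ((real^7) \<times> (real^7^7)) \<times> (real^7) \<times> (real^7)).
    (snd (fst z) *v fst (snd z)) $ i * (snd (fst z) *v snd (snd z)) $ j * (snd (fst z) *v cross (fst (snd z)) (snd (snd z))) $ k)"
  have val: "val \<phi> y E a b = (\<Sum>j\<in>UNIV. local_rep A c \<phi> y (ws j) * g j ((y, E), (a, b)))"
    if "\<phi> \<in> smooth_forms A 3" "y \<in> K" for \<phi> y E a b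
    unfolding val_def form3_compose pb3_def alt3_expand[OF alt3_form3[OF F[OF that(2)] smooth_forms_alt[OF that(1)]], of "E *v a"]
    by (simp add: g_def ws_def local_rep_form3 F_def X_def sum.cartesian_product case_prod_unfold mult_ac flip: UNIV_Times_UNIV)
  \<comment> \<open>The frames in \<open>Z\<close> need not be oriented, but reversing a frame only changes the sign of \<open>val\<close>.\<close>
  have nz: "val \<phi> y E a b \<noteq> 0" if yE: "(y, E) \<in> Z" and ab: "(a, b) \<in> orthonormal_pairs" for y E a b
  proof -
    let ?e = "\<lambda>w. F y (E *v w)"
    have y: "y \<in> K" "pb4 E (f y) = S4" using yE by (auto simp: Z_def)
    have e: "?e \<in> frames A (X y)" "form4 ?e (\<psi> (X y)) = S4"
      using frames_compose(1)[OF F[OF y(1)] pb4_S4_invertible[OF fa[OF y(1)] y(2)]] y(2) by (simp_all add: form4_compose f_def)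
    obtain e0 where e0: "e0 \<in> frames A (X y)" "ori (X y) = {e' \<in> frames A (X y). same_orient e0 e'}"
      using ori unfolding orientation_def by blast
    obtain e' where e': "e' \<in> frames A (X y)" "form4 e' (\<psi> (X y)) = S4" "same_orient e0 e'" "e' = ?e \<or> e' = (\<lambda>w. ?e (- w))"
      by (rule oriented_frame4[OF e smooth_forms_alt[OF \<psi>(1)] e0(1)])
    have "e' \<in> g2_of4 ori \<psi> (X y)" using e' e0(2) by (simp add: g2_of4_iff[OF \<psi>(1)])
    then have "form3 e' (\<phi> (X y)) a b (cross a b) > 0"
      using tame ab unfolding tame3_def by blast
    moreover have "form3 (\<lambda>w. ?e (- w)) (\<phi> (X y)) a b (cross a b) = - val \<phi> y E a b"
      using alt3_simps(10-12)[OF alt3_form3[OF e(1) smooth_forms_alt[OF \<phi>]]] by (simp add: form3_def val_def)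
    ultimately show ?thesis using e'(4) by (auto simp: val_def)
  qed
  have "\<exists>\<epsilon>>0. \<forall>\<phi>'\<in>smooth_forms A 3.
    (\<forall>y\<in>K. \<forall>ws. length ws = 3 \<and> set ws \<subseteq> Basis \<longrightarrow> \<bar>local_rep A c \<phi>' y ws - local_rep A c \<phi> y ws\<bar> < \<epsilon>) \<longrightarrow>
    (\<forall>y E a b. (y, E) \<in> Z \<longrightarrow> (a, b) \<in> orthonormal_pairs \<longrightarrow> val \<phi> y E a b * val \<phi>' y E a b > 0)"
  proof (rule evaluation_sign_stable[where ws = ws and g = g and val = val, OF \<phi> c K(2) Z _ _ _ _ val nz])
    show "continuous_on (Z \<times> orthonormal_pairs) (g j)" for j
      unfolding g_def case_prod_unfold by (intro continuous_intros)
  qed (auto simp: Z_def ws_def)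
  then obtain \<epsilon> where \<epsilon>: "\<epsilon> > 0" and st: "\<forall>\<phi>'\<in>smooth_forms A 3.
    (\<forall>y\<in>K. \<forall>ws. length ws = 3 \<and> set ws \<subseteq> Basis \<longrightarrow> \<bar>local_rep A c \<phi>' y ws - local_rep A c \<phi> y ws\<bar> < \<epsilon>) \<longrightarrow>
    (\<forall>y E a b. (y, E) \<in> Z \<longrightarrow> (a, b) \<in> orthonormal_pairs \<longrightarrow> val \<phi> y E a b * val \<phi>' y E a b > 0)"
    by (elim exE conjE)
  show ?thesis
  proof (intro exI[of _ \<epsilon>] conjI \<epsilon> ballI impI)
    fix \<phi>' y e
    assume \<phi>': "\<phi>' \<in> smooth_forms A 3" and
      close: "\<forall>y\<in>K. \<forall>ws. length ws = 3 \<and> set ws \<subseteq> Basis \<longrightarrow> \<bar>local_rep A c \<phi>' y ws - local_rep A c \<phi> y ws\<bar> < \<epsilon>"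
      and y: "y \<in> K" and e: "e \<in> g2_of4 ori \<psi> (chart_inv c y)"
    have eo: "e \<in> ori (X y)" "form4 e (\<psi> (X y)) = S4" using e g2_of4_iff[OF \<psi>(1)] by (auto simp: X_def)
    have ef: "e \<in> frames A (X y)" using eo(1) ori unfolding orientation_def by blast
    obtain E where E: "invertible E" "e = (\<lambda>w. F y (E *v w))" using frames_matrix[OF F[OF y] ef] by metis
    have yE: "(y, E) \<in> Z" using y eo(2) by (simp add: Z_def f_def E(2) form4_compose)
    have "val \<phi>' y E a b > 0" if ab: "(a, b) \<in> orthonormal_pairs" for a b
    proof -
      have "val \<phi> y E a b > 0" using tame[OF e] ab unfolding tame3_def E(2) val_def X_def by blast
      then show ?thesis
        using st[rule_format, OF \<phi>' close[rule_format] yE ab] by (simp add: zero_less_mult_iff)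
    qed
    then show "tame3 (form3 e (\<phi>' (chart_inv c y)))"
      unfolding tame3_def E(2) val_def X_def by simp
  qed
qed

section \<open>The cones on a compact manifold\<close>

theorem proposition2p8:
  fixes A :: "'a::{t2_space, second_countable_topology} chart set"
  assumes "smooth_atlas A"
    and "compact (UNIV :: 'a set)"
  shows
    "(\<forall>ori \<psi>. orientation A ori \<and> \<psi> \<in> closed_forms A 4 \<and> positive4 A \<psi> \<longrightarrow>
        openin (closed_forms_topology A 3) (TA_cone3 A ori \<psi>) \<and>
        form_cone (TA_cone3 A ori \<psi>) \<and>
        openin (dR_quotient_topology A 3) (dR_class A 3 ` TA_cone3 A ori \<psi>) \<and>
        openin (dR_linear_topology A 3) (dR_class A 3 ` TA_cone3 A ori \<psi>) \<and>
        dR_cone A 3 (dR_class A 3 ` TA_cone3 A ori \<psi>)) \<and>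
     (\<forall>\<phi>. \<phi> \<in> closed_forms A 3 \<and> positive3 A \<phi> \<longrightarrow>
        openin (closed_forms_topology A 4) (TA_cone4 A \<phi>) \<and>
        form_cone (TA_cone4 A \<phi>) \<and>
        openin (dR_quotient_topology A 4) (dR_class A 4 ` TA_cone4 A \<phi>) \<and>
        openin (dR_linear_topology A 4) (dR_class A 4 ` TA_cone4 A \<phi>) \<and>
        dR_cone A 4 (dR_class A 4 ` TA_cone4 A \<phi>))"
proof -
  have "openin (closed_forms_topology A 3) (TA_cone3 A ori \<psi>) \<and>
        form_cone (TA_cone3 A ori \<psi>) \<and>
        openin (dR_quotient_topology A 3) (dR_class A 3 ` TA_cone3 A ori \<psi>) \<and>
        openin (dR_linear_topology A 3) (dR_class A 3 ` TA_cone3 A ori \<psi>) \<and>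
        dR_cone A 3 (dR_class A 3 ` TA_cone3 A ori \<psi>)"
    if ori: "orientation A ori" and \<psi>: "\<psi> \<in> closed_forms A 4" "positive4 A \<psi>" for ori \<psi>
  proof -
  note iff = TA_cone3_iff[OF ori \<psi>]
  have s\<psi>: "\<psi> \<in> smooth_forms A 4" by (rule closed_forms_smooth[OF \<psi>(1)])
  show ?thesis
  proof (rule open_cone_of_pointwise_condition[OF assms, where T = "\<lambda>x \<alpha>. \<forall>e\<in>g2_of4 ori \<psi> x. tame3 (form3 e \<alpha>)"])
    show "\<phi> \<in> TA_cone3 A ori \<psi> \<longleftrightarrow> \<phi> \<in> closed_forms A 3 \<and> (\<forall>x. \<forall>e\<in>g2_of4 ori \<psi> x. tame3 (form3 e (\<phi> x)))" for \<phi>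
      by (rule iff)
    show "\<forall>e\<in>g2_of4 ori \<psi> x. tame3 (form3 e (\<lambda>vs. s * \<alpha> vs + t * \<beta> vs))"
      if "\<forall>e\<in>g2_of4 ori \<psi> x. tame3 (form3 e \<alpha>)" "\<forall>e\<in>g2_of4 ori \<psi> x. tame3 (form3 e \<beta>)" "s \<ge> 0" "t \<ge> 0" "\<not> (s = 0 \<and> t = 0)"
      for x \<alpha> \<beta> s t
    proof
      fix e assume "e \<in> g2_of4 ori \<psi> x"
      then have "tame3 (\<lambda>u v w. s * form3 e \<alpha> u v w + t * form3 e \<beta> u v w)" using that by (intro tame3_lin) auto
      then show "tame3 (form3 e (\<lambda>vs. s * \<alpha> vs + t * \<beta> vs))" by (simp add: tame3_def form3_def)
    qed
    show "\<exists>\<epsilon>>0. \<forall>\<phi>'\<in>closed_forms A 3.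
        (\<forall>y\<in>K. \<forall>ws. length ws = 3 \<and> set ws \<subseteq> Basis \<longrightarrow> \<bar>local_rep A c \<phi>' y ws - local_rep A c \<phi> y ws\<bar> < \<epsilon>) \<longrightarrow>
        (\<forall>y\<in>K. \<forall>e\<in>g2_of4 ori \<psi> (chart_inv c y). tame3 (form3 e (\<phi>' (chart_inv c y))))"
      if w: "\<phi> \<in> TA_cone3 A ori \<psi>" "c \<in> A" "compact K" "K \<subseteq> snd c ` fst c" for \<phi> c K
    proof -
      have p: "\<phi> \<in> closed_forms A 3" "\<And>x e. e \<in> g2_of4 ori \<psi> x \<Longrightarrow> tame3 (form3 e (\<phi> x))"
        using iff w(1) by auto
      show ?thesis
        using tame3_stable[OF assms(1) ori s\<psi> \<psi>(2) closed_forms_smooth[OF p(1)] p(2) w(2-4)]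
        by (meson closed_forms_smooth)
    qed
  qed
  qed
  moreover have "openin (closed_forms_topology A 4) (TA_cone4 A \<phi>) \<and>
        form_cone (TA_cone4 A \<phi>) \<and>
        openin (dR_quotient_topology A 4) (dR_class A 4 ` TA_cone4 A \<phi>) \<and>
        openin (dR_linear_topology A 4) (dR_class A 4 ` TA_cone4 A \<phi>) \<and>
        dR_cone A 4 (dR_class A 4 ` TA_cone4 A \<phi>)"
    if \<phi>: "\<phi> \<in> closed_forms A 3" "positive3 A \<phi>" for \<phi>
  proof -
  note iff = TA_cone4_iff[OF \<phi>]
  have s\<phi>: "\<phi> \<in> smooth_forms A 3" by (rule closed_forms_smooth[OF \<phi>(1)])
  show ?thesis
  proof (rule open_cone_of_pointwise_condition[OF assms, where T = "\<lambda>x \<alpha>. \<forall>e\<in>g2_of3 A \<phi> x. tame4 (form4 e \<alpha>)"])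
    show "\<psi> \<in> TA_cone4 A \<phi> \<longleftrightarrow> \<psi> \<in> closed_forms A 4 \<and> (\<forall>x. \<forall>e\<in>g2_of3 A \<phi> x. tame4 (form4 e (\<psi> x)))" for \<psi>
      by (rule iff)
    show "\<forall>e\<in>g2_of3 A \<phi> x. tame4 (form4 e (\<lambda>vs. s * \<alpha> vs + t * \<beta> vs))"
      if "\<forall>e\<in>g2_of3 A \<phi> x. tame4 (form4 e \<alpha>)" "\<forall>e\<in>g2_of3 A \<phi> x. tame4 (form4 e \<beta>)" "s \<ge> 0" "t \<ge> 0" "\<not> (s = 0 \<and> t = 0)"
      for x \<alpha> \<beta> s t
    proof
      fix e assume "e \<in> g2_of3 A \<phi> x"
      then have "tame4 (\<lambda>u v w z. s * form4 e \<alpha> u v w z + t * form4 e \<beta> u v w z)" using that by (intro tame4_lin) auto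
      moreover have "form4 e (\<lambda>vs. s * \<alpha> vs + t * \<beta> vs) = (\<lambda>u v w z. s * form4 e \<alpha> u v w z + t * form4 e \<beta> u v w z)"
        by (simp add: form4_def fun_eq_iff)
      ultimately show "tame4 (form4 e (\<lambda>vs. s * \<alpha> vs + t * \<beta> vs))" by simp
    qed
    show "\<exists>\<epsilon>>0. \<forall>\<psi>'\<in>closed_forms A 4.
        (\<forall>y\<in>K. \<forall>ws. length ws = 4 \<and> set ws \<subseteq> Basis \<longrightarrow> \<bar>local_rep A c \<psi>' y ws - local_rep A c \<psi> y ws\<bar> < \<epsilon>) \<longrightarrow>
        (\<forall>y\<in>K. \<forall>e\<in>g2_of3 A \<phi> (chart_inv c y). tame4 (form4 e (\<psi>' (chart_inv c y))))"
      if w: "\<psi> \<in> TA_cone4 A \<phi>" "c \<in> A" "compact K" "K \<subseteq> snd c ` fst c" for \<psi> c K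
    proof -
      have p: "\<psi> \<in> closed_forms A 4" "\<And>x e. e \<in> g2_of3 A \<phi> x \<Longrightarrow> tame4 (form4 e (\<psi> x))"
        using iff w(1) by auto
      show ?thesis
        using tame4_stable[OF assms(1) s\<phi> \<phi>(2) closed_forms_smooth[OF p(1)] p(2) w(2-4)]
        by (meson closed_forms_smooth)
    qed
  qed
  qed
  ultimately show ?thesis by blast
qed

end
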